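(* Let $(\mathcal{F},\mathcal{T}^X)$ be a dynamical system of topological trees of spheres, where $\mathcal{F}:\mathcal{T}^Y\to\mathcal{T}^Z$ is a cover between trees of spheres of degree $D$. Then $(\mathcal{F},\mathcal{T}^X)$ has at most $2D-2$ cycles of spheres which are not post-critically finite.
   Context: Graphs and trees. A graph consists of a finite set $V$ of vertices and a set $E$ of edges, each edge being a $2$-element subset $\{v,v'\}\subseteq V$; $E_v$ denotes the set of edges containing $v$ and $\mathrm{val}(v)=\mathrm{card}\,E_v$. A tree is a connected graph without cycles; vertices of valence $1$ are leaves, the others are internal vertices (set $IV$). For a vertex $v$ and $e\in E_v$, the branch $B_v(e)$ is the connected component of $T\setminus\{v\}$ containing $e$ (the tree is viewed as the set $V\sqcup E$ with the topology whose closed sets are the sub-graphs). A vertex $v$ separates vertices $v_1,v_2,v_3$ if they lie in three distinct connected components of $T\setminus\{v\}$. A tree is stable if every internal vertex has valence at least $3$. Trees of spheres. Let $X$ be a finite set with at least $3$ elements. A tree $T^X$ marked by $X$ is a tree whose set of leaves is $X$. A (topological) tree of spheres $\mathcal{T}^X$ marked by $X$ consists of a tree $T^X$ marked by $X$ and, for each internal vertex $v$, a topological $2$-sphere $\mathcal{S}_v$ and an injective map $i_v:E_v\to\mathcal{S}_v$; $X_v:=i_v(E_v)$ is the set of attaching points, and $a_v:X\to\mathcal{S}_v$ is defined by $a_v(x)=i_v(e)$ when $x\in B_v(e)$. Covers. A trees map $F:T\to T'$ sends vertices to vertices and each edge $\{v,w\}$ to the edge $\{F(v),F(w)\}$. A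 cover between trees of spheres $\mathcal{F}:\mathcal{T}^Y\to\mathcal{T}^Z$ consists of a trees map $F:T^Y\to T^Z$ with $F(Y)\subseteq Z$, $F(IV^Y)\subseteq IV^Z$, and for each $v\in IV^Y$, $w=F(v)$, a topological branched covering $f_v:\mathcal{S}_v\to\mathcal{S}_w$ such that (a) $f_v:\mathcal{S}_v\setminus Y_v\to\mathcal{S}_w\setminus Z_w$ is a covering map, (b) $f_v\circ i_v=i_w\circ F$ on $E_v$, (c) for every edge $e=\{v_1,v_2\}$ between internal vertices, $\deg_{i_{v_1}(e)}f_{v_1}=\deg_{i_{v_2}(e)}f_{v_2}$. Put $\deg(v)=\deg f_v$ for internal $v$; for a leaf $y$ attached by an edge $e$ to the internal vertex $v$, $\deg(y)=\deg_{i_v(e)}f_v$. For a vertex $w$ of $T^Z$, $\sum_{v'\in F^{-1}(w)}\deg(v')$ does not depend on $w$; this number is the degree $D$ of $\mathcal{F}$. Dynamical systems (all trees assumed stable). A tree $T^X$ is compatible with $T^Y$ if $X\subseteq Y$, $IV^X\subseteq IV^Y$, and for all vertices $v,v_1,v_2,v_3$ of $T^X$, $v$ separates $v_1,v_2,v_3$ in $T^X$ iff it does in $T^Y$. A tree of spheres $\mathcal{T}^X$ is compatible with $\mathcal{T}^Y$ (written $\mathcal{T}^X\triangleleft\mathcal{T}^Y$) if $T^X$ is compatible with $T^Y$ and for every internal vertex $v$ of $T^X$, $\mathcal{S}^X_v=\mathcal{S}^Y_v$ and $a^X_v=a^Y_v|_X$. A dynamical system of trees of spheres is a pair $(\mathcal{F},\mathcal{T}^X)$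 where $\mathcal{F}:\mathcal{T}^Y\to\mathcal{T}^Z$ is a cover, $X\subseteq Y\cap Z$, $\mathcal{T}^X\triangleleft\mathcal{T}^Y$ and $\mathcal{T}^X\triangleleft\mathcal{T}^Z$. Iteration. Set $IV(F):=IV^X$ and $IV(F^{k+1}):=\{v\in IV(F^k): F^k(v)\in IV^X\}$, and $\mathrm{Prep}(F):=\bigcap_{k\ge1}IV(F^k)$. For $v\in IV(F^k)$ put $f_v^k:=f_{F^{k-1}(v)}\circ\cdots\circ f_{F(v)}\circ f_v$ ($f_v^0=\mathrm{id}$). The orbit of a point $z\in\mathcal{S}_v$, $v\in IV^Y$, is $\{f_v^k(z): k\ge0,\ v\in IV(F^k)\}$ (for $k=0$ no condition). A critical point is a point $x\in\mathcal{S}_v$, $v\in IV^Y$, with $\deg_x f_v\ge2$. A cycle of spheres is a set $\{v,F(v),\dots,F^{k-1}(v)\}$ with $v\in\mathrm{Prep}(F)$ and $F^k(v)=v$; it is not post-critically finite if one of the spheres $\mathcal{S}_{v'}$, $v'$ in the cycle, contains a critical point of $f_{v'}$ with infinite orbit. *)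

theory Defs
  imports "HOL-Analysis.Analysis"
begin

section \<open>Graphs and trees\<close>

text \<open>Edges are 2-element subsets of the vertex set.\<close>

definition edges_at :: "'v set set \<Rightarrow> 'v \<Rightarrow> 'v set set" where
  "edges_at E v = {e \<in> E. v \<in> e}"

definition val :: "'v set set \<Rightarrow> 'v \<Rightarrow> nat" where
  "val E v = card (edges_at E v)"

definition is_graph :: "'v set \<Rightarrow> 'v set set \<Rightarrow> bool" where
  "is_graph V E \<longleftrightarrow> finite V \<and> (\<forall>e\<in>E. e \<subseteq> V \<and> card e = 2)"

text \<open>Adjacency between vertices not in W (used for the graph with W removed).\<close>
definition adj_avoid :: "'v set set \<Rightarrow> 'v set \<Rightarrow> ('v \<times> 'v) set" where
  "adj_avoid E W = {(a, b). {a, b} \<in> E \<and> a \<notin> W \<and> b \<notin> W}"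

definition connected_graph :: "'v set \<Rightarrow> 'v set set \<Rightarrow> bool" where
  "connected_graph V E \<longleftrightarrow> (\<forall>a\<in>V. \<forall>b\<in>V. (a, b) \<in> (adj_avoid E {})\<^sup>*)"

definition has_cycle :: "'v set \<Rightarrow> 'v set set \<Rightarrow> bool" where
  "has_cycle V E \<longleftrightarrow> (\<exists>cs. 3 \<le> length cs \<and> distinct cs \<and> set cs \<subseteq> V \<and>
      (\<forall>k < length cs. {cs ! k, cs ! (Suc k mod length cs)} \<in> E))"

definition is_tree :: "'v set \<Rightarrow> 'v set set \<Rightarrow> bool" where
  "is_tree V E \<longleftrightarrow> is_graph V E \<and> connected_graph V E \<and> \<not> has_cycle V E"

definition leaves :: "'v set \<Rightarrow> 'v set set \<Rightarrow> 'v set" where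
  "leaves V E = {v \<in> V. val E v = 1}"

definition internal :: "'v set \<Rightarrow> 'v set set \<Rightarrow> 'v set" where
  "internal V E = V - leaves V E"

text \<open>Vertices of the branch B_v(e): the component of T minus v containing the edge e.\<close>
definition branch :: "'v set set \<Rightarrow> 'v \<Rightarrow> 'v set \<Rightarrow> 'v set" where
  "branch E v e = {w. \<exists>u. u \<in> e \<and> u \<noteq> v \<and> (u, w) \<in> (adj_avoid E {v})\<^sup>*}"

text \<open>v separates v1, v2, v3: they lie in three distinct components of T minus v.\<close>
definition separates :: "'v set set \<Rightarrow> 'v \<Rightarrow> 'v \<Rightarrow> 'v \<Rightarrow> 'v \<Rightarrow> bool" where
  "separates E v v1 v2 v3 \<longleftrightarrow> v1 \<noteq> v \<and> v2 \<noteq> v \<and> v3 \<noteq> v \<and>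
     (v1, v2) \<notin> (adj_avoid E {v})\<^sup>* \<and> (v1, v3) \<notin> (adj_avoid E {v})\<^sup>* \<and>
     (v2, v3) \<notin> (adj_avoid E {v})\<^sup>*"

definition stable :: "'v set \<Rightarrow> 'v set set \<Rightarrow> bool" where
  "stable V E \<longleftrightarrow> (\<forall>v \<in> internal V E. 3 \<le> val E v)"

section \<open>Topological branched coverings between 2-spheres\<close>

text \<open>Local model z \<mapsto> z^d at x, in charts onto the open unit disc.\<close>
definition local_model ::
  "'a::topological_space set \<Rightarrow> ('a \<Rightarrow> 'b) \<Rightarrow> 'b::topological_space set \<Rightarrow> 'a \<Rightarrow> nat \<Rightarrow> bool" where
  "local_model S f T x d \<longleftrightarrow> (\<exists>U W (\<phi>::'a \<Rightarrow> complex) \<phi>' (\<psi>::'b \<Rightarrow> complex) \<psi>'.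
      openin (top_of_set S) U \<and> x \<in> U \<and> openin (top_of_set T) W \<and>
      homeomorphism U (ball 0 1) \<phi> \<phi>' \<and> homeomorphism W (ball 0 1) \<psi> \<psi>' \<and>
      \<phi> x = 0 \<and> \<psi> (f x) = 0 \<and> (\<forall>z\<in>U. f z \<in> W \<and> \<psi> (f z) = (\<phi> z) ^ d))"

definition branched_cover ::
  "'a::topological_space set \<Rightarrow> ('a \<Rightarrow> 'b) \<Rightarrow> 'b::topological_space set \<Rightarrow> bool" where
  "branched_cover S f T \<longleftrightarrow> continuous_on S f \<and> f ` S = T \<and>
      (\<forall>x\<in>S. \<exists>d\<ge>1. local_model S f T x d)"

text \<open>Local degree deg_x f.\<close>
definition local_degree ::
  "'a::topological_space set \<Rightarrow> ('a \<Rightarrow> 'b) \<Rightarrow> 'b::topological_space set \<Rightarrow> 'a \<Rightarrow> nat" where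
  "local_degree S f T x = (THE d. 1 \<le> d \<and> local_model S f T x d)"

text \<open>Degree of a branched covering: sum of local degrees over a fibre
  (independent of the chosen point of T).\<close>
definition map_degree ::
  "'a::topological_space set \<Rightarrow> ('a \<Rightarrow> 'b) \<Rightarrow> 'b::topological_space set \<Rightarrow> nat" where
  "map_degree S f T = (let y = (SOME y. y \<in> T) in
      \<Sum>x\<in>{x\<in>S. f x = y}. local_degree S f T x)"

section \<open>Trees of spheres\<close>

record ('v, 'a) tos =
  tV :: "'v set"
  tE :: "'v set set"
  tS :: "'v \<Rightarrow> 'a set"
  ti :: "'v \<Rightarrow> 'v set \<Rightarrow> 'a"

definition LV :: "('v, 'a) tos \<Rightarrow> 'v set" where
  "LV T = leaves (tV T) (tE T)"

definition IV :: "('v, 'a) tos \<Rightarrow> 'v set" where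
  "IV T = internal (tV T) (tE T)"

text \<open>A tree of spheres marked by its set of leaves X (card X \<ge> 3).\<close>
definition tree_of_spheres :: "('v, 'a::topological_space) tos \<Rightarrow> bool" where
  "tree_of_spheres T \<longleftrightarrow> is_tree (tV T) (tE T) \<and> 3 \<le> card (LV T) \<and>
     (\<forall>v\<in>IV T. tS T v homeomorphic (sphere (0::real^3) 1) \<and>
        inj_on (ti T v) (edges_at (tE T) v) \<and>
        ti T v ` edges_at (tE T) v \<subseteq> tS T v)"

text \<open>Attaching points X_v.\<close>
definition attach :: "('v, 'a) tos \<Rightarrow> 'v \<Rightarrow> 'a set" where
  "attach T v = ti T v ` edges_at (tE T) v"

text \<open>a_v(x) = i_v(e) where x lies in the branch B_v(e).\<close>
definition amap :: "('v, 'a) tos \<Rightarrow> 'v \<Rightarrow> 'v \<Rightarrow> 'a" where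
  "amap T v x = ti T v (THE e. e \<in> edges_at (tE T) v \<and> x \<in> branch (tE T) v e)"

section \<open>Covers\<close>

text \<open>deg(v) of a vertex of T^Y: degree of f_v for internal v, local degree of f_u at
  the attaching point of the edge to its neighbour u for a leaf.\<close>
definition vdeg :: "('v, 'a::topological_space) tos \<Rightarrow> ('v, 'a) tos \<Rightarrow> ('v \<Rightarrow> 'v) \<Rightarrow>
    ('v \<Rightarrow> 'a \<Rightarrow> 'a) \<Rightarrow> 'v \<Rightarrow> nat" where
  "vdeg TY TZ F f v =
     (if v \<in> IV TY then map_degree (tS TY v) (f v) (tS TZ (F v))
      else (let e = (THE e. e \<in> edges_at (tE TY) v);
                u = (THE u. u \<in> e \<and> u \<noteq> v)
            in local_degree (tS TY u) (f u) (tS TZ (F u)) (ti TY u e)))"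

definition is_cover :: "('v, 'a::topological_space) tos \<Rightarrow> ('v, 'a) tos \<Rightarrow> ('v \<Rightarrow> 'v) \<Rightarrow>
    ('v \<Rightarrow> 'a \<Rightarrow> 'a) \<Rightarrow> bool" where
  "is_cover TY TZ F f \<longleftrightarrow> tree_of_spheres TY \<and> tree_of_spheres TZ \<and>
     (\<forall>v\<in>tV TY. F v \<in> tV TZ) \<and> (\<forall>e\<in>tE TY. F ` e \<in> tE TZ) \<and>
     F ` LV TY \<subseteq> LV TZ \<and> F ` IV TY \<subseteq> IV TZ \<and>
     (\<forall>v\<in>IV TY.
        branched_cover (tS TY v) (f v) (tS TZ (F v)) \<and>
        covering_space (tS TY v - attach TY v) (f v) (tS TZ (F v) - attach TZ (F v)) \<and>
        (\<forall>e\<in>edges_at (tE TY) v. f v (ti TY v e) = ti TZ (F v) (F ` e))) \<and>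
     (\<forall>v1 v2. {v1, v2} \<in> tE TY \<and> v1 \<in> IV TY \<and> v2 \<in> IV TY \<longrightarrow>
        local_degree (tS TY v1) (f v1) (tS TZ (F v1)) (ti TY v1 {v1, v2}) =
        local_degree (tS TY v2) (f v2) (tS TZ (F v2)) (ti TY v2 {v1, v2}))"

text \<open>Degree D of the cover: the sum of deg over the fibre F^{-1}(w), which does not
  depend on the vertex w of T^Z; we evaluate it at some vertex.\<close>
definition cover_degree :: "('v, 'a::topological_space) tos \<Rightarrow> ('v, 'a) tos \<Rightarrow> ('v \<Rightarrow> 'v) \<Rightarrow>
    ('v \<Rightarrow> 'a \<Rightarrow> 'a) \<Rightarrow> nat" where
  "cover_degree TY TZ F f = (let w = (SOME w. w \<in> tV TZ) in
      \<Sum>v\<in>{v\<in>tV TY. F v = w}. vdeg TY TZ F f v)"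

section \<open>Dynamical systems\<close>

definition tree_compat :: "('v, 'a) tos \<Rightarrow> ('v, 'a) tos \<Rightarrow> bool" where
  "tree_compat TX TY \<longleftrightarrow> LV TX \<subseteq> LV TY \<and> IV TX \<subseteq> IV TY \<and>
     (\<forall>v\<in>tV TX. \<forall>v1\<in>tV TX. \<forall>v2\<in>tV TX. \<forall>v3\<in>tV TX.
        separates (tE TX) v v1 v2 v3 \<longleftrightarrow> separates (tE TY) v v1 v2 v3)"

definition tos_compat :: "('v, 'a) tos \<Rightarrow> ('v, 'a) tos \<Rightarrow> bool" where
  "tos_compat TX TY \<longleftrightarrow> tree_compat TX TY \<and>
     (\<forall>v\<in>IV TX. tS TX v = tS TY v \<and> (\<forall>x\<in>LV TX. amap TX v x = amap TY v x))"

definition dyn_sys :: "('v, 'a::topological_space) tos \<Rightarrow> ('v, 'a) tos \<Rightarrow> ('v, 'a) tos \<Rightarrow>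
    ('v \<Rightarrow> 'v) \<Rightarrow> ('v \<Rightarrow> 'a \<Rightarrow> 'a) \<Rightarrow> bool" where
  "dyn_sys TX TY TZ F f \<longleftrightarrow>
     tree_of_spheres TX \<and> is_cover TY TZ F f \<and>
     stable (tV TX) (tE TX) \<and> stable (tV TY) (tE TY) \<and> stable (tV TZ) (tE TZ) \<and>
     LV TX \<subseteq> LV TY \<inter> LV TZ \<and> tos_compat TX TY \<and> tos_compat TX TZ"

section \<open>Iteration\<close>

text \<open>IVit TX F k = IV(F^(k+1)).\<close>
primrec IVit :: "('v, 'a) tos \<Rightarrow> ('v \<Rightarrow> 'v) \<Rightarrow> nat \<Rightarrow> 'v set" where
  "IVit TX F 0 = IV TX"
| "IVit TX F (Suc k) = {v \<in> IVit TX F k. (F ^^ Suc k) v \<in> IV TX}"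

definition Prep :: "('v, 'a) tos \<Rightarrow> ('v \<Rightarrow> 'v) \<Rightarrow> 'v set" where
  "Prep TX F = (\<Inter>k. IVit TX F k)"

text \<open>f_v^k = f_{F^{k-1}(v)} o ... o f_v.\<close>
primrec fit :: "('v \<Rightarrow> 'v) \<Rightarrow> ('v \<Rightarrow> 'a \<Rightarrow> 'a) \<Rightarrow> nat \<Rightarrow> 'v \<Rightarrow> 'a \<Rightarrow> 'a" where
  "fit F f 0 v = id"
| "fit F f (Suc k) v = f ((F ^^ k) v) \<circ> fit F f k v"

definition orbit :: "('v, 'a) tos \<Rightarrow> ('v \<Rightarrow> 'v) \<Rightarrow> ('v \<Rightarrow> 'a \<Rightarrow> 'a) \<Rightarrow> 'v \<Rightarrow> 'a \<Rightarrow> 'a set" where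
  "orbit TX F f v z = {fit F f k v z | k. k = 0 \<or> v \<in> IVit TX F (k - 1)}"

definition critical_point :: "('v, 'a::topological_space) tos \<Rightarrow> ('v, 'a) tos \<Rightarrow> ('v \<Rightarrow> 'v) \<Rightarrow>
    ('v \<Rightarrow> 'a \<Rightarrow> 'a) \<Rightarrow> 'v \<Rightarrow> 'a \<Rightarrow> bool" where
  "critical_point TY TZ F f v x \<longleftrightarrow> v \<in> IV TY \<and> x \<in> tS TY v \<and>
     2 \<le> local_degree (tS TY v) (f v) (tS TZ (F v)) x"

definition sphere_cycles :: "('v, 'a) tos \<Rightarrow> ('v \<Rightarrow> 'v) \<Rightarrow> 'v set set" where
  "sphere_cycles TX F = {C. \<exists>v k. 1 \<le> k \<and> v \<in> Prep TX F \<and> (F ^^ k) v = v \<and>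
                              C = {(F ^^ j) v | j. j < k}}"

definition not_pcf :: "('v, 'a::topological_space) tos \<Rightarrow> ('v, 'a) tos \<Rightarrow> ('v, 'a) tos \<Rightarrow>
    ('v \<Rightarrow> 'v) \<Rightarrow> ('v \<Rightarrow> 'a \<Rightarrow> 'a) \<Rightarrow> 'v set \<Rightarrow> bool" where
  "not_pcf TX TY TZ F f C \<longleftrightarrow>
     (\<exists>v\<in>C. \<exists>x. critical_point TY TZ F f v x \<and> infinite (orbit TX F f v x))"

end

theory Submission
  imports Defs
begin

text \<open>
  Off the attaching points \<open>f v\<close> is a covering, so every critical point is an attaching point.
  Each cycle that is not post-critically finite is assigned a critical leaf \<open>y\<close> of \<open>TY\<close> such that
  \<open>F y\<close> lies in a branch of \<open>TZ\<close> at a vertex of the cycle which contains no vertex of \<open>Prep\<close>; two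
  branches with this property at distinct vertices of \<open>Prep\<close> are disjoint, hence the assignment is
  injective. To find \<open>y\<close>, follow an infinite critical orbit \<open>x 0, x 1, \<dots>\<close> until it leaves the attaching
  points of \<open>TX\<close>, at time \<open>m\<close>, and take the last \<open>j < m\<close> for which the branch at \<open>x j\<close> contains a
  critical leaf mapped into the branch at \<open>x (j + 1)\<close>. Such a leaf exists for \<open>j = 0\<close>, because a
  branched covering of spheres of degree at least 2 has a critical point outside any given fibre (the
  sphere minus a point is simply connected), and this produces a path of critical edges whose image
  does not backtrack. After time \<open>j\<close> the branches are mapped into each other, so the branch at
  \<open>x (j + 1)\<close> cannot contain a vertex that stays in \<open>TX\<close> forever.

  There are at most \<open>2 D - 2\<close> critical leaves by the inequality \<open>n (k - 2) \<le> l - 2\<close> for an \<open>n\<close>-sheeted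
  covering of a sphere with \<open>k\<close> punctures by a sphere with \<open>l\<close> punctures, summed over the vertices of
  the trees. The inequality follows by lifting the graph of \<open>k\<close> meridians that separate the punctures:
  the lifted graph has \<open>2 n\<close> vertices and \<open>n k\<close> edges, hence at least \<open>n k - 2 n + 2\<close> faces by the
  Jordan curve theorem, and each face contains a puncture.
\<close>

section \<open>Euler's inequality for plane graphs whose edges are arcs\<close>

section \<open>Faces of planar graphs\<close>

text \<open>The constant \<open>2 D - 2\<close> is that of Riemann and Hurwitz. Let \<open>y\<close>
  and \<open>z\<close> be the numbers of leaves of \<open>TY\<close> and \<open>TZ\<close>. The
  degrees of the leaves of \<open>TY\<close> add up to \<open>D z\<close>, so their excess over 1 is
  \<open>D z - y\<close>. In a tree the numbers \<open>val - 2\<close> of the internal vertices add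
  up to the number of leaves minus 2, so the local inequalities give
  \<open>D (z - 2) \<le> y - 2\<close>, that is, \<open>D z - y \<le> 2 D - 2\<close>.

  The dynamical part is shaped by folding: two edges at a vertex may have the same image, and then a
  branch of \<open>TY\<close> need not be mapped into the branch of \<open>TZ\<close> in the image
  direction. A fold forces degree at least 2 at its vertex, and hence a critical leaf beyond it
  whose image moves away. So a direction either yields a critical leaf or is carried along
  faithfully, and the last direction of the first kind is the place for the leaf.

  Compatibility of trees speaks only of separated triples and of the directions of leaves;
  directions of internal vertices are therefore compared through leaves.\<close>

lemma arc_interior_not_open:
  fixes c :: "real \<Rightarrow> complex"
  assumes "arc c"
  shows "\<not> open (path_image c - {pathstart c, pathfinish c})"
proof
  let ?D = "path_image c - {pathstart c, pathfinish c}"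
  let ?A = "- {pathstart c, pathfinish c}"
  assume op: "open ?D"
  have con: "connected ?A"
    unfolding Compl_eq_Diff_UNIV by (intro connected_open_delete_finite) auto
  \<comment> \<open>\<open>?D\<close> would be open and closed in the connected set
    \<open>?A\<close>, hence equal to it; but an arc is bounded.\<close>
  have "openin (top_of_set ?A) ?D"
    using op by (intro open_subset) auto
  moreover have "closedin (top_of_set ?A) ?D"
    using closed_arc_image[OF assms] by (auto simp: closedin_closed)
  moreover have "?D \<noteq> {}"
    using assms arc_imp_simple_path nonempty_simple_path_endless by blast
  ultimately have "?D = ?A"
    using con by (auto simp: connected_clopen)
  then have "bounded ?A"
    using compact_arc_image[OF assms] compact_imp_bounded bounded_subset
    by (metis Diff_subset)
  then have "bounded (UNIV :: complex set)"
    using bounded_Un[of ?A "{pathstart c, pathfinish c}"] by (metis Compl_partition2 finite_imp_bounded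
        finite.intros)
  then show False
    by simp
qed

text \<open>An arc inside \<open>G\<close> from \<open>a\<close> to \<open>b\<close> closes
  \<open>c\<close> up to a Jordan curve. Each of its points lies on the frontier of both sides, so
  the neighbourhood \<open>D\<close> of \<open>m\<close> meets both, while a connected set off
  \<open>G\<close> and \<open>c\<close> stays on one side. This is how an edge that closes a cycle
  splits a face.\<close>

lemma simple_closed_curve_crossing_arc:
  fixes c :: "real \<Rightarrow> complex"
  assumes "arc c" "a = pathstart c" "b = pathfinish c"
    and G: "path_component G a b"
    and dj: "(path_image c - {a, b}) \<inter> G = {}"
    and D: "open D" "m \<in> D" "m \<in> path_image c - {a, b}"
  obtains r s where "r \<in> D - path_image c" "s \<in> D - path_image c"
    "\<not> connected_component (- (G \<union> path_image c)) r s"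
proof -
  have ab: "a \<noteq> b"
    unfolding assms(2,3) using arc_distinct_ends[OF assms(1)] by simp
  have "path_connected (path_component_set G a)"
    by simp
  moreover have "a \<in> path_component_set G a" "b \<in> path_component_set G a"
    using G path_component_refl[OF path_component_mem(1)[OF G]] by simp_all
  ultimately obtain p where p: "arc p" "path_image p \<subseteq> path_component_set G a"
      "pathstart p = a" "pathfinish p = b"
    using ab unfolding path_connected_arcwise by meson
  have pG: "path_image p \<subseteq> G"
    using p(2) path_component_subset[of G a] by blast
  define J where "J = p +++ reversepath c"
  have J: "simple_path J" "pathfinish J = pathstart J"
    unfolding J_def using p(1,3,4) assms(1-3) dj pG
    by (auto intro!: simple_path_join_loop arc_reversepath)
  have imJ: "path_image J = path_image p \<union> path_image c"
    unfolding J_def using p(4) assms(3) by (simp add: path_image_join)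
  note JJ = Jordan_inside_outside[OF J]
  have "m \<in> frontier (inside (path_image J))" "m \<in> frontier (outside (path_image J))"
    using JJ D(3) imJ by auto
  then have "m \<in> closure (inside (path_image J))" "m \<in> closure (outside (path_image J))"
    by (auto simp: frontier_def)
  then have "D \<inter> inside (path_image J) \<noteq> {}" "D \<inter> outside (path_image J) \<noteq> {}"
    using D open_Int_closure_eq_empty[of D] by blast+
  then obtain r s where rs: "r \<in> D \<inter> inside (path_image J)" "s \<in> D \<inter> outside (path_image J)"
    by blast
  have "\<not> connected_component (- (G \<union> path_image c)) r s"
  proof
    assume "connected_component (- (G \<union> path_image c)) r s"
    then obtain K where K: "connected K" "K \<subseteq> - (G \<union> path_image c)" "r \<in> K" "s \<in> K"
      by (auto simp: connected_component_def)
    have "K \<subseteq> inside (path_image J) \<union> outside (path_image J)"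
      using K(2) JJ imJ pG by auto
    then show False
      using connectedD[OF K(1), of "inside (path_image J)" "outside (path_image J)"] K rs JJ
      by blast
  qed
  moreover have "r \<notin> path_image c" "s \<notin> path_image c"
    using rs imJ inside_no_overlap[of "path_image J"] outside_no_overlap[of "path_image J"]
    by blast+
  ultimately show ?thesis
    using that rs by blast
qed

text \<open>Lower half of Euler's formula: the points of \<open>R\<close> represent distinct faces, those of
  \<open>K\<close> meet every connected component of the graph.\<close>

lemma planar_graph_faces_components:
  fixes c :: "'e \<Rightarrow> real \<Rightarrow> complex"
  assumes "finite Ed" "finite Vs"
    and "\<And>e. e \<in> Ed \<Longrightarrow> arc (c e)"
    and "\<And>e. e \<in> Ed \<Longrightarrow> pathstart (c e) \<in> Vs \<and> pathfinish (c e) \<in> Vs"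
    and "\<And>e. e \<in> Ed \<Longrightarrow> (path_image (c e) - {pathstart (c e), pathfinish (c e)}) \<inter> Vs = {}"
    and "\<And>e e'. e \<in> Ed \<Longrightarrow> e' \<in> Ed \<Longrightarrow> e \<noteq> e' \<Longrightarrow>
           (path_image (c e) - {pathstart (c e), pathfinish (c e)}) \<inter> path_image (c e') = {}"
  shows "\<exists>R K. finite R \<and> finite K \<and> K \<subseteq> Vs \<and> R \<subseteq> - (Vs \<union> (\<Union>e\<in>Ed. path_image (c e))) \<and>
     pairwise (\<lambda>r s. \<not> connected_component (- (Vs \<union> (\<Union>e\<in>Ed. path_image (c e)))) r s) R \<and>
     (\<forall>v\<in>Vs. \<exists>\<kappa>\<in>K. path_component (Vs \<union> (\<Union>e\<in>Ed. path_image (c e))) v \<kappa>) \<and>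
     card Ed + 1 + card K \<le> card R + card Vs"
  using assms
proof (induction Ed rule: finite_induct)
  case empty
  \<comment> \<open>Without edges there is one face, and every vertex is its own component: the
    bound holds with equality.\<close>
  obtain r where "r \<notin> Vs"
    using \<open>finite Vs\<close> ex_new_if_finite infinite_UNIV_char_0 by blast
  then show ?case
    using \<open>finite Vs\<close>
    by (intro exI[of _ "{r}"] exI[of _ Vs]) (auto intro: path_component_refl)
next
  case (insert e Ed)
  define G where "G = Vs \<union> (\<Union>e\<in>Ed. path_image (c e))"
  define G' where "G' = Vs \<union> (\<Union>e\<in>insert e Ed. path_image (c e))"
  have G': "G' = G \<union> path_image (c e)"
    by (auto simp: G_def G'_def)
  have "\<exists>R K. finite R \<and> finite K \<and> K \<subseteq> Vs \<and> R \<subseteq> - G \<and>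
      pairwise (\<lambda>r s. \<not> connected_component (- G) r s) R \<and>
      (\<forall>v\<in>Vs. \<exists>\<kappa>\<in>K. path_component G v \<kappa>) \<and> card Ed + 1 + card K \<le> card R + card Vs"
    unfolding G_def by (rule insert.IH; use insert.prems in blast)
  then obtain R K where RK: "finite R" "finite K" "K \<subseteq> Vs" "R \<subseteq> - G"
      "pairwise (\<lambda>r s. \<not> connected_component (- G) r s) R"
      "\<forall>v\<in>Vs. \<exists>\<kappa>\<in>K. path_component G v \<kappa>" "card Ed + 1 + card K \<le> card R + card Vs"
    by blast
  define a b where "a = pathstart (c e)" and "b = pathfinish (c e)"
  define I where "I = path_image (c e) - {a, b}"
  have arc: "arc (c e)"
    using insert.prems by auto
  have ab: "a \<in> Vs" "b \<in> Vs"
    using insert.prems(3)[of e] by (auto simp: a_def b_def)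
  have im: "path_image (c e) = I \<union> {a, b}"
    by (auto simp: I_def a_def b_def)
  have IG: "I \<inter> G = {}"
    using insert.prems(4)[of e] insert.prems(5)[of e] insert.hyps
    unfolding I_def a_def b_def G_def by blast
  have I: "connected I" "I \<noteq> {}"
    unfolding I_def a_def b_def
    using arc arc_imp_simple_path connected_simple_path_endless nonempty_simple_path_endless by blast+
  then obtain m where m: "m \<in> I"
    by blast
  \<comment> \<open>\<open>D\<close> is the face of the old graph that the new open edge runs
    through. Only the representative of this face has to be given up, so \<open>R0\<close> has at
    most one element less than \<open>R\<close>.\<close>
  define D where "D = connected_component_set (- G) m"
  have ID: "I \<subseteq> D"
    unfolding D_def using I IG m by (intro connected_component_maximal) auto
  have "closed G"
    unfolding G_def using insert.hyps insert.prems
    by (intro closed_Un finite_imp_closed closed_UN) (auto intro: closed_arc_image)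
  then have oD: "open D"
    unfolding D_def by (simp add: open_connected_component open_Compl)
  have DG: "D \<inter> G = {}"
    using connected_component_subset[of "- G" m] by (auto simp: D_def)
  define R0 where "R0 = R - D"
  have R0: "card R \<le> Suc (card R0)" "finite R0"
  proof -
    have "card (R \<inter> D) \<le> 1"
    proof (rule ccontr)
      assume "\<not> card (R \<inter> D) \<le> 1"
      then obtain r s where "r \<in> R \<inter> D" "s \<in> R \<inter> D" "r \<noteq> s"
        by (metis One_nat_def RK(1) card_le_Suc0_iff_eq finite_Int)
      then show False
        using RK(5) unfolding pairwise_def D_def
        by (metis IntE connected_component_sym connected_component_trans mem_Collect_eq)
    qed
    then show "card R \<le> Suc (card R0)" "finite R0"
      using card_Diff_subset_Int[of R D] RK(1) by (auto simp: R0_def)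
  qed
  have R0G': "R0 \<subseteq> - G'"
    using RK(4) ID ab im unfolding R0_def G' G_def by auto
  have mono: "connected_component (- G) r s" if "connected_component (- G') r s" for r s
    using that G' by (meson Compl_anti_mono connected_component_of_subset sup_ge1)
  have nD: "\<not> connected_component (- G) r s" if "r \<in> R0" "s \<in> D" for r s
    using that unfolding R0_def D_def
    by (metis DiffD2 connected_component_sym connected_component_trans mem_Collect_eq)
  have sep: "\<not> connected_component (- G') r s \<and> \<not> connected_component (- G') s r"
    if "r \<in> R0" "s \<in> D" for r s
    using nD[OF that] mono connected_component_sym by blast
  have pw0: "pairwise (\<lambda>r s. \<not> connected_component (- G') r s) R0"
    using RK(5) mono unfolding R0_def pairwise_def by blast
  have pmono: "path_component G' r s" if "path_component G r s" for r s
    using that G' path_component_of_subset by blast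
  have cEd: "card (insert e Ed) = Suc (card Ed)"
    using insert.hyps by simp
  show ?case
  proof (cases "path_component G a b")
    case True
    \<comment> \<open>The edge closes a cycle: two representatives, one on each side, replace that
      of \<open>D\<close>, and the components stay.\<close>
    obtain r s where rs: "r \<in> D - path_image (c e)" "s \<in> D - path_image (c e)"
        "\<not> connected_component (- G') r s"
      using simple_closed_curve_crossing_arc[OF arc a_def b_def True _ oD] m ID IG G'
      unfolding I_def by blast
    have rsn: "r \<noteq> s"
      using rs DG connected_component_refl[of r "- G'"] by (auto simp: G')
    define R' where "R' = insert r (insert s R0)"
    have c: "card R' = Suc (Suc (card R0))"
      using rs rsn R0 by (auto simp: R'_def R0_def)
    have "pairwise (\<lambda>r s. \<not> connected_component (- G') r s) R'"
      unfolding R'_def pairwise_insert using pw0 sep rs connected_component_sym by blast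
    moreover have "R' \<subseteq> - G'"
      using rs DG R0G' by (auto simp: R'_def G')
    moreover have "\<forall>v\<in>Vs. \<exists>\<kappa>\<in>K. path_component G' v \<kappa>"
      using RK(6) pmono by blast
    ultimately show ?thesis
      unfolding G'_def[symmetric] using RK R0 c cEd
      by (intro exI[of _ R'] exI[of _ K]) (auto simp: R'_def)
  next
    case False
    \<comment> \<open>The edge joins two components: the representative of one of them is dropped,
      and it is enough to find a new point of \<open>D\<close> off the edge.\<close>
    have "\<not> D \<subseteq> path_image (c e)"
    proof
      assume "D \<subseteq> path_image (c e)"
      then have "D = I"
        using ID DG im ab by (auto simp: G_def)
      then show False
        using arc_interior_not_open[OF arc] oD by (auto simp: I_def a_def b_def)
    qed
    then obtain r where r: "r \<in> D - path_image (c e)"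
      by blast
    define R' where "R' = insert r R0"
    have c: "card R' = Suc (card R0)"
      using r R0 by (auto simp: R'_def R0_def)
    have pw: "pairwise (\<lambda>r s. \<not> connected_component (- G') r s) R'"
      unfolding R'_def pairwise_insert using pw0 sep r by blast
    have R'G': "R' \<subseteq> - G'"
      using r DG R0G' by (auto simp: R'_def G')
    obtain x y where xy: "x \<in> K" "y \<in> K" "path_component G a x" "path_component G b y"
      using RK(6) ab by blast
    have xny: "x \<noteq> y"
      using xy False path_component_sym path_component_trans by blast
    have pab: "path_component G' a b"
      unfolding path_component_def using arc_imp_path[OF arc]
      by (intro exI[of _ "c e"]) (simp add: G' a_def b_def)
    have sp: "\<exists>\<kappa>\<in>K - {y}. path_component G' v \<kappa>" if v: "v \<in> Vs" for v
    proof -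
      obtain k where k: "k \<in> K" "path_component G v k"
        using v RK(6) by blast
      have "path_component G' b x"
        using path_component_trans[OF path_component_sym[OF pab] pmono[OF xy(3)]] .
      then have "path_component G' y x"
        using path_component_trans[OF path_component_sym[OF pmono[OF xy(4)]]] by blast
      then show ?thesis
        using k(1) pmono[OF k(2)] xny xy(1) path_component_trans[of G' v y x]
        by (cases "k = y") blast+
    qed
    have cK: "card K = Suc (card (K - {y}))"
      using RK(2) xy(2) by (metis card_Suc_Diff1)
    show ?thesis
      unfolding G'_def[symmetric] using RK R0 c cEd cK pw R'G' sp
      by (intro exI[of _ R'] exI[of _ "K - {y}"]) (auto simp: R'_def)
  qed
qed

section \<open>The graph of meridians and its faces\<close>

text \<open>The polygonal arc from \<open>\<i>\<close> to \<open>- \<i>\<close> through \<open>j + 1/2\<close>, parametrised by height.\<close>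

definition meridian :: "nat \<Rightarrow> real \<Rightarrow> complex" where
  "meridian j s = Complex ((real j + 1/2) * (1 - \<bar>1 - 2 * s\<bar>)) (1 - 2 * s)"

lemma meridian_eqD:
  assumes "meridian j s = meridian l t"
  shows "s = t" "0 < s \<Longrightarrow> s < 1 \<Longrightarrow> j = l"
proof -
  show st: "s = t"
    using assms by (simp add: meridian_def)
  assume "0 < s" "s < 1"
  then have "1 - \<bar>1 - 2 * s\<bar> \<noteq> 0"
    by auto
  then show "j = l"
    using assms st by (simp add: meridian_def)
qed

lemma meridian_ends: "meridian j 0 = \<i>" "meridian j 1 = - \<i>"
  by (simp_all add: meridian_def complex_eq_iff)

lemma path_meridian: "path (meridian j)"
  unfolding path_def meridian_def Complex_eq by (intro continuous_intros)

text \<open>Height 0 occurs only at \<open>s = 1/2\<close>, where the real part is the half-integer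
  \<open>j + 1/2\<close>.\<close>

lemma meridian_avoids_nat: "meridian j s \<notin> of_nat ` {1..k}"
proof
  assume "meridian j s \<in> of_nat ` {1..k}"
  then obtain m where "meridian j s = of_nat m"
    by auto
  then have "1 - 2 * s = 0" "(real j + 1/2) * (1 - \<bar>1 - 2 * s\<bar>) = real m"
    by (auto simp: meridian_def complex_eq_iff)
  then have "real (2 * j + 1) = real (2 * m)"
    by simp
  then have "2 * j + 1 = 2 * m"
    by linarith
  then show False
    by presburger
qed

text \<open>For fixed \<open>x\<close> this is the open polygonal arc between the poles that crosses
  the real axis at \<open>x\<close>, so the image is the sector swept out by an interval of such
  arcs.\<close>

lemma sector_connected:
  assumes "convex (I :: real set)"
  shows "connected ((\<lambda>(x, y). Complex (x * (1 - \<bar>y\<bar>)) y) ` (I \<times> {-1<..<1}))"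
proof (rule connected_continuous_image)
  show "continuous_on (I \<times> {-1<..<1}) (\<lambda>(x, y). Complex (x * (1 - \<bar>y\<bar>)) y)"
    unfolding Complex_eq case_prod_unfold by (intro continuous_intros)
  show "connected (I \<times> {-1<..<1::real})"
    using assms by (intro convex_connected convex_Times) auto
qed

text \<open>Consecutive meridians \<open>j - 1\<close> and \<open>j\<close> enclose the puncture
  \<open>j\<close>, and everything outside the first and the last one reaches infinity, where the
  remaining puncture of the sphere is. The set \<open>L\<close> leads from \<open>z\<close> to a
  puncture within one face.\<close>

lemma meridian_complement:
  assumes z: "z \<notin> (\<Union>j\<in>{..k}. meridian j ` {0..1})"
  obtains L where "connected L" "z \<in> L" "L \<inter> (\<Union>j\<in>{..k}. meridian j ` {0..1}) = {}"
    "L \<inter> of_nat ` {1..k} \<noteq> {} \<or> \<not> bounded L"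
proof (cases "\<bar>Im z\<bar> < 1")
  case False
  \<comment> \<open>The vertical ray from \<open>z\<close> away from the real axis. Meridians have
    height at most 1 in absolute value, so only the point \<open>z\<close> itself could lie on
    one.\<close>
  define L where "L = (\<lambda>t. z + of_real (t * sgn (Im z)) * \<i>) ` {0..}"
  have "connected L"
    unfolding L_def by (intro connected_continuous_image continuous_intros) auto
  moreover have "z \<in> L"
    unfolding L_def by (rule image_eqI[of _ _ 0]) auto
  moreover have "L \<inter> (\<Union>j\<in>{..k}. meridian j ` {0..1}) = {}"
  proof (rule ccontr)
    assume "L \<inter> (\<Union>j\<in>{..k}. meridian j ` {0..1}) \<noteq> {}"
    then obtain t j s where t: "t \<ge> 0" "0 \<le> s" "s \<le> 1" "j \<le> k"
        and eq: "z + of_real (t * sgn (Im z)) * \<i> = meridian j s"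
      by (auto simp: L_def)
    have 1: "Im z + t * sgn (Im z) = 1 - 2 * s"
      using arg_cong[OF eq, of Im] by (simp add: meridian_def)
    have "t = 0"
    proof (cases "Im z > 0")
      case True
      then show ?thesis using 1 t False by auto
    next
      case F: False
      then have "Im z < 0" using False by linarith
      then show ?thesis using 1 t False by auto
    qed
    then have "z = meridian j s"
      using eq by simp
    moreover have "meridian j s \<in> (\<Union>j\<in>{..k}. meridian j ` {0..1})"
      using t by (intro UN_I[of j] imageI) auto
    ultimately show False
      using z by simp
  qed
  moreover have "\<not> bounded L"
  proof
    assume "bounded L"
    then obtain B where B: "\<And>x. x \<in> L \<Longrightarrow> norm x \<le> B"
      by (auto simp: bounded_iff)
    define t where "t = \<bar>B\<bar> + 1"
    have "z + of_real (t * sgn (Im z)) * \<i> \<in> L"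
      unfolding L_def by (rule imageI) (simp add: t_def)
    then have "\<bar>Im (z + of_real (t * sgn (Im z)) * \<i>)\<bar> \<le> B"
      using B abs_Im_le_cmod order_trans by blast
    moreover have "Im z > 0 \<or> Im z < 0"
      using False by linarith
    ultimately show False
      by (auto simp: t_def)
  qed
  ultimately show ?thesis
    using that by blast
next
  case True
  \<comment> \<open>\<open>\<rho>\<close> is the abscissa at which the arc through \<open>z\<close>,
    from the family that contains the meridians, crosses the real axis.\<close>
  define \<rho> where "\<rho> = Re z / (1 - \<bar>Im z\<bar>)"
  have zeq: "z = Complex (\<rho> * (1 - \<bar>Im z\<bar>)) (Im z)"
    using True by (simp add: \<rho>_def complex_eq_iff)
  have nj: "\<rho> \<noteq> real j + 1/2" if "j \<le> k" for j
  proof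
    assume \<rho>: "\<rho> = real j + 1/2"
    have "1 - 2 * ((1 - Im z) / 2) = Im z"
      by (simp add: field_simps)
    then have "z = meridian j ((1 - Im z) / 2)"
      unfolding meridian_def using zeq \<rho> by simp
    moreover have "(1 - Im z) / 2 \<in> {0..1}"
      using True by auto
    ultimately show False
      using z that by blast
  qed
  define L where "L I = (\<lambda>(x, y). Complex (x * (1 - \<bar>y\<bar>)) y) ` (I \<times> {-1<..<1})" for I :: "real set"
  have avoid: "L I \<inter> (\<Union>j\<in>{..k}. meridian j ` {0..1}) = {}"
    if I: "\<And>j. j \<le> k \<Longrightarrow> real j + 1/2 \<notin> I" for I
  proof (rule ccontr)
    assume "L I \<inter> (\<Union>j\<in>{..k}. meridian j ` {0..1}) \<noteq> {}"
    then obtain x y j s where xy: "x \<in> I" "-1 < y" "y < 1" "j \<le> k"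
        and eq: "Complex (x * (1 - \<bar>y\<bar>)) y = meridian j s"
      by (auto simp: L_def)
    have "x * (1 - \<bar>y\<bar>) = (real j + 1/2) * (1 - \<bar>y\<bar>)"
      using eq by (auto simp: meridian_def)
    moreover have "1 - \<bar>y\<bar> \<noteq> 0"
      using xy by linarith
    ultimately have "x = real j + 1/2"
      using mult_right_cancel by blast
    then show False
      using I xy by auto
  qed
  have zL: "z \<in> L I" if "\<rho> \<in> I" for I
    unfolding L_def using that True zeq by (intro image_eqI[of _ _ "(\<rho>, Im z)"]) auto
  have inL: "of_real x \<in> L I" if "x \<in> I" for x I
    unfolding L_def using that by (intro image_eqI[of _ _ "(x, 0)"]) (auto simp: complex_eq_iff)
  have conn: "connected (L I)" if "convex I" for I
    unfolding L_def using sector_connected[OF that] .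
  consider "\<rho> < 1/2" | "\<rho> > real k + 1/2" | j where "1 \<le> j" "j \<le> k" "real j - 1/2 < \<rho>" "\<rho> < real j + 1/2"
  proof -
    have "\<rho> < 1/2 \<or> \<rho> > real k + 1/2 \<or>
        (\<exists>j. 1 \<le> j \<and> j \<le> k \<and> real j - 1/2 < \<rho> \<and> \<rho> < real j + 1/2)"
    proof (cases "\<rho> < 1/2 \<or> \<rho> > real k + 1/2")
      case False
      \<comment> \<open>The integer nearest to \<open>\<rho>\<close>; half-integers between
        \<open>1/2\<close> and \<open>k + 1/2\<close> are excluded by \<open>nj\<close>.\<close>
      define j where "j = nat \<lfloor>\<rho> + 1/2\<rfloor>"
      have fl: "\<lfloor>\<rho> + 1/2\<rfloor> \<ge> 1"
        using False by linarith
      then have j: "real j \<le> \<rho> + 1/2" "\<rho> + 1/2 < real j + 1" "j \<ge> 1"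
        unfolding j_def by linarith+
      have "\<rho> \<noteq> real k + 1/2"
        using nj by blast
      then have jk: "j \<le> k"
        using False j by linarith
      have "real (j - 1) + 1/2 = real j - 1/2"
        using j by (simp add: of_nat_diff)
      then have "\<rho> \<noteq> real j - 1/2"
        using nj[of "j - 1"] jk by auto
      then have "real j - 1/2 < \<rho> \<and> \<rho> < real j + 1/2"
        using j by auto
      then show ?thesis
        using jk j by blast
    qed auto
    then show ?thesis
      using that by blast
  qed
  then show ?thesis
  proof cases
    case 1
    have "\<not> bounded (L {..<1/2})"
    proof
      assume "bounded (L {..<1/2})"
      then obtain B where B: "\<And>x. x \<in> L {..<1/2} \<Longrightarrow> norm x \<le> B"
        by (auto simp: bounded_iff)
      show False
        using B[OF inL[of "- \<bar>B\<bar> - 1" "{..<1/2}"]] abs_ge_zero[of B]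
        unfolding norm_of_real by force
    qed
    moreover have "L {..<1/2} \<inter> (\<Union>j\<in>{..k}. meridian j ` {0..1}) = {}"
      by (rule avoid) auto
    ultimately show ?thesis
      using that[of "L {..<1/2}"] conn[of "{..<1/2}"] zL 1 by auto
  next
    case 2
    have "\<not> bounded (L {real k + 1/2<..})"
    proof
      assume "bounded (L {real k + 1/2<..})"
      then obtain B where B: "\<And>x. x \<in> L {real k + 1/2<..} \<Longrightarrow> norm x \<le> B"
        by (auto simp: bounded_iff)
      show False
        using B[OF inL[of "\<bar>B\<bar> + 1 + real k" "{real k + 1/2<..}"]] abs_ge_zero[of B]
        unfolding norm_of_real by force
    qed
    moreover have "L {real k + 1/2<..} \<inter> (\<Union>j\<in>{..k}. meridian j ` {0..1}) = {}"
      by (rule avoid) auto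
    ultimately show ?thesis
      using that[of "L {real k + 1/2<..}"] conn[of "{real k + 1/2<..}"] zL 2 by auto
  next
    case (3 j)
    define I where "I = {real j - 1/2<..<real j + 1/2}"
    have "L I \<inter> (\<Union>j\<in>{..k}. meridian j ` {0..1}) = {}"
    proof (rule avoid)
      fix l
      show "real l + 1/2 \<notin> I"
      proof
        assume "real l + 1/2 \<in> I"
        then have "real l < real j" "real j < real (Suc l)"
          by (auto simp: I_def)
        then show False
          unfolding of_nat_less_iff by simp
      qed
    qed
    moreover have "of_nat j \<in> L I \<inter> of_nat ` {1..k}"
      using inL[of "real j" I] 3 by (auto simp: I_def)
    moreover have "connected (L I)" "z \<in> L I"
      using conn[of I] zL[of I] 3 by (auto simp: I_def)
    ultimately show ?thesis
      using that[of "L I"] by blast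
  qed
qed

section \<open>Counting the punctures of a covering by lifting the meridians\<close>

section \<open>Coverings of punctured planes\<close>

text \<open>A covering of punctured spheres with one puncture on each side moved to infinity: there
  are \<open>k + 1\<close> punctures below and \<open>card Q + 1\<close> above. The finite ones
  below are placed at \<open>1, ..., k\<close> so that the meridians \<open>0, ..., k\<close>
  separate them.\<close>

locale plane_covering =
  fixes Q :: "complex set" and q :: "complex \<Rightarrow> complex" and k n :: nat
  assumes finQ: "finite Q"
    and cov: "covering_space (- Q) q (- of_nat ` {1..k})"
    and fib: "\<And>y. y \<notin> of_nat ` {1..k} \<Longrightarrow> card {x \<in> - Q. q x = y} = n"
    and npos: "1 \<le> n"
begin

definition merid :: "complex set" where
  "merid = (\<Union>j\<in>{..k}. meridian j ` {0..1})"

definition poles :: "complex \<Rightarrow> complex set" where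
  "poles y = {x \<in> - Q. q x = y}"

definition lift :: "complex \<times> nat \<Rightarrow> real \<Rightarrow> complex" where
  "lift e = (SOME h. path h \<and> path_image h \<subseteq> - Q \<and> pathstart h = fst e \<and>
      (\<forall>t\<in>{0..1}. q (h t) = meridian (snd e) t))"

definition graph_edges :: "(complex \<times> nat) set" where
  "graph_edges = poles \<i> \<times> {..k}"

definition graph :: "complex set" where
  "graph = (poles \<i> \<union> poles (- \<i>)) \<union> (\<Union>e\<in>graph_edges. path_image (lift e))"

lemma pole_not_nat: "\<i> \<notin> of_nat ` {1..k}" "- \<i> \<notin> of_nat ` {1..k}"
  by (auto simp: complex_eq_iff)

lemma card_poles: "card (poles \<i>) = n" "card (poles (- \<i>)) = n"
  unfolding poles_def using fib pole_not_nat by blast+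

lemma finite_poles: "finite (poles \<i>)" "finite (poles (- \<i>))"
  using card_poles npos by (metis card.infinite not_one_le_zero)+

lemma merid_image: "meridian j ` T \<subseteq> - of_nat ` {1..k}"
  using meridian_avoids_nat by fastforce

lemma lift:
  assumes "e \<in> graph_edges"
  shows "path (lift e)" "path_image (lift e) \<subseteq> - Q" "pathstart (lift e) = fst e"
    "\<And>t. t \<in> {0..1} \<Longrightarrow> q (lift e t) = meridian (snd e) t"
proof -
  obtain a j where e: "e = (a, j)" "a \<in> - Q" "q a = \<i>"
    using assms by (auto simp: graph_edges_def poles_def)
  have "\<exists>h. path h \<and> path_image h \<subseteq> - Q \<and> pathstart h = fst e \<and>
      (\<forall>t\<in>{0..1}. q (h t) = meridian (snd e) t)"
    using covering_space_lift_path_strong[OF cov e(2) path_meridian[of j]] merid_image e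
    by (metis fst_conv snd_conv meridian_ends(1) path_image_def pathstart_def)
  then have "path (lift e) \<and> path_image (lift e) \<subseteq> - Q \<and> pathstart (lift e) = fst e \<and>
      (\<forall>t\<in>{0..1}. q (lift e t) = meridian (snd e) t)"
    unfolding lift_def by (rule someI_ex)
  then show "path (lift e)" "path_image (lift e) \<subseteq> - Q" "pathstart (lift e) = fst e"
    "\<And>t. t \<in> {0..1} \<Longrightarrow> q (lift e t) = meridian (snd e) t"
    by auto
qed

lemma lift_in: "e \<in> graph_edges \<Longrightarrow> t \<in> {0..1} \<Longrightarrow> lift e t \<in> - Q"
  using lift(2)[of e] unfolding path_image_def by blast

text \<open>Meridians are parametrised by height, so a common point forces equal times. Away from
  the poles it also fixes the meridian, and two lifts of one path that agree at one time agree at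
  time 0.\<close>

lemma lift_eqD:
  assumes "e \<in> graph_edges" "e' \<in> graph_edges" "s \<in> {0..1}" "t \<in> {0..1}" "lift e s = lift e' t"
  shows "s = t" "0 < s \<Longrightarrow> s < 1 \<Longrightarrow> e = e'"
proof -
  have eq: "meridian (snd e) s = meridian (snd e') t"
    using lift(4)[OF assms(1,3)] lift(4)[OF assms(2,4)] assms(5) by simp
  show st: "s = t"
    using meridian_eqD(1)[OF eq] .
  assume "0 < s" "s < 1"
  then have j: "snd e = snd e'"
    using meridian_eqD(2)[OF eq] by blast
  have "lift e 0 = lift e' 0"
  proof (rule covering_space_lift_unique[OF cov, where T = "{0..1}" and f = "meridian (snd e)" and a = s])
    show "continuous_on {0..1} (meridian (snd e))"
      using path_meridian by (simp add: path_def)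
    show "meridian (snd e) \<in> {0..1} \<rightarrow> - of_nat ` {1..k}"
      using merid_image by blast
    show "continuous_on {0..1} (lift e)" "continuous_on {0..1} (lift e')"
      using lift(1) assms by (auto simp: path_def)
    show "lift e \<in> {0..1} \<rightarrow> - Q" "lift e' \<in> {0..1} \<rightarrow> - Q"
      using lift_in assms by blast+
  qed (use assms lift(4) j st in auto)
  then have "fst e = fst e'"
    using lift(3)[OF assms(1)] lift(3)[OF assms(2)] by (simp add: pathstart_def)
  then show "e = e'"
    using j by (simp add: prod_eq_iff)
qed

lemma arc_lift: "e \<in> graph_edges \<Longrightarrow> arc (lift e)"
  unfolding arc_def inj_on_def using lift(1) lift_eqD(1) by blast

lemma lift_ends:
  assumes "e \<in> graph_edges"
  shows "pathstart (lift e) \<in> poles \<i>" "pathfinish (lift e) \<in> poles (- \<i>)"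
  using lift(4)[OF assms, of 0] lift(4)[OF assms, of 1] lift_in[OF assms, of 0] lift_in[OF assms, of 1]
  by (auto simp: poles_def pathstart_def pathfinish_def meridian_ends)

lemma lift_interior:
  assumes "x \<in> path_image (lift e) - {pathstart (lift e), pathfinish (lift e)}"
  obtains t where "0 < t" "t < 1" "x = lift e t"
proof -
  obtain t where t: "t \<in> {0..1}" "x = lift e t"
    using assms by (auto simp: path_image_def)
  have "t \<noteq> 0" "t \<noteq> 1"
    using assms t by (auto simp: pathstart_def pathfinish_def)
  then show ?thesis
    using that[of t] t by auto
qed

text \<open>The lifts exhaust the preimage of the meridians: from a point over a meridian, lift the
  way back to the pole \<open>\<i>\<close>; the edge that starts at the end of this lift passes
  through the given point.\<close>

lemma graph_eq: "graph = {z \<in> - Q. q z \<in> merid}"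
proof
  show "graph \<subseteq> {z \<in> - Q. q z \<in> merid}"
  proof
    fix z assume "z \<in> graph"
    then consider "z \<in> poles \<i>" | "z \<in> poles (- \<i>)" | e where "e \<in> graph_edges" "z \<in> path_image (lift e)"
      by (auto simp: graph_def)
    then show "z \<in> {z \<in> - Q. q z \<in> merid}"
    proof cases
      case 1
      then show ?thesis
        using imageI[of 0 "{0..1}" "meridian 0"] by (auto simp: poles_def merid_def meridian_ends)
    next
      case 2
      then show ?thesis
        using imageI[of 1 "{0..1}" "meridian 0"] by (auto simp: poles_def merid_def meridian_ends)
    next
      case (3 e)
      then obtain t where "t \<in> {0..1}" "z = lift e t"
        by (auto simp: path_image_def)
      then show ?thesis
        using lift(4)[OF 3(1)] lift_in[OF 3(1)] 3(1) unfolding merid_def graph_edges_def by fastforce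
    qed
  qed
  show "{z \<in> - Q. q z \<in> merid} \<subseteq> graph"
  proof
    fix z assume "z \<in> {z \<in> - Q. q z \<in> merid}"
    then obtain j t where z: "z \<in> - Q" "j \<le> k" "t \<in> {0..1}" "q z = meridian j t"
      by (auto simp: merid_def)
    \<comment> \<open>The part of meridian \<open>j\<close> from \<open>q z\<close> back to
      \<open>\<i>\<close>.\<close>
    define g where "g s = meridian j (t * (1 - s))" for s
    have g: "path g" "path_image g \<subseteq> - of_nat ` {1..k}" "pathstart g = q z"
    proof -
      have "continuous_on {0..1} (meridian j \<circ> (\<lambda>s. t * (1 - s)))"
        using z(3) by (intro continuous_on_compose continuous_intros
            continuous_on_subset[OF path_meridian[unfolded path_def]]) (auto simp: mult_le_one)
      then show "path g"
        by (simp add: path_def g_def o_def)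
      show "path_image g \<subseteq> - of_nat ` {1..k}"
        using meridian_avoids_nat by (auto simp: path_image_def g_def)
      show "pathstart g = q z"
        using z by (simp add: pathstart_def g_def)
    qed
    obtain h where h: "path h" "path_image h \<subseteq> - Q" "pathstart h = z"
        "\<And>s. s \<in> {0..1} \<Longrightarrow> q (h s) = g s"
      using covering_space_lift_path_strong[OF cov z(1) g] by blast
    have hin: "h s \<in> - Q" if "s \<in> {0..1}" for s
      using that h(2) unfolding path_image_def by blast
    define a where "a = h 1"
    have a: "a \<in> poles \<i>"
      using h(4)[of 1] hin[of 1] by (auto simp: a_def poles_def g_def meridian_ends)
    define e where "e = (a, j)"
    have e: "e \<in> graph_edges"
      using a z by (simp add: e_def graph_edges_def)
    have t: "t * (1 - s) \<in> {0..1}" if "s \<in> {0..1}" for s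
      using that z(3) by (auto simp: mult_le_one)
    \<comment> \<open>Both are lifts of \<open>g\<close> that start from \<open>a\<close> at time
      1.\<close>
    have "h 0 = lift e (t * (1 - 0))"
    proof (rule covering_space_lift_unique[OF cov, where T = "{0..1}" and f = g and a = 1
          and ?g1.0 = h and ?g2.0 = "\<lambda>s. lift e (t * (1 - s))"])
      show "h 1 = lift e (t * (1 - 1))"
        using lift(3)[OF e] by (simp add: a_def e_def pathstart_def)
      show "continuous_on {0..1} g" "continuous_on {0..1} h"
        using g h by (auto simp: path_def)
      show "g \<in> {0..1} \<rightarrow> - of_nat ` {1..k}"
        using g(2) by (auto simp: path_image_def)
      show "h \<in> {0..1} \<rightarrow> - Q"
        using hin by blast
      have "continuous_on {0..1} (lift e \<circ> (\<lambda>s. t * (1 - s)))"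
        using t by (intro continuous_on_compose continuous_intros
            continuous_on_subset[OF lift(1)[OF e, unfolded path_def]]) auto
      then show "continuous_on {0..1} (\<lambda>s. lift e (t * (1 - s)))"
        by (simp add: o_def)
      show "(\<lambda>s. lift e (t * (1 - s))) \<in> {0..1} \<rightarrow> - Q"
        using lift_in[OF e] t by blast
      show "g s = q (lift e (t * (1 - s)))" if "s \<in> {0..1}" for s
        using lift(4)[OF e t[OF that]] by (simp add: g_def e_def)
    qed (use h(4) in auto)
    then have "z = lift e t"
      using h(3) by (simp add: pathstart_def)
    then show "z \<in> graph"
      using e z(3) unfolding graph_def path_image_def by blast
  qed
qed

lemma closed_graph: "closed graph" and bounded_graph: "bounded graph"
proof -
  have "finite graph_edges"
    using finite_poles by (simp add: graph_edges_def)
  then have "compact graph"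
    unfolding graph_def using finite_poles arc_lift
    by (intro compact_Un compact_UN finite_imp_compact[OF finite_poles(1)]
        finite_imp_compact[OF finite_poles(2)] compact_arc_image) auto
  then show "closed graph" "bounded graph"
    by (auto simp: compact_imp_closed compact_imp_bounded)
qed

text \<open>If a bounded face contained no puncture, its closure would be compact in
  \<open>- Q\<close>, and so would be its image \<open>K\<close> in the punctured plane below. But
  \<open>K\<close> then fills the whole set \<open>L\<close> that leads to a puncture or to
  infinity.\<close>

lemma bounded_face_meets_Q:
  assumes r: "r \<notin> graph" and bd: "bounded (connected_component_set (- graph) r)"
  shows "connected_component_set (- graph) r \<inter> Q \<noteq> {}"
proof
  define D where "D = connected_component_set (- graph) r"
  assume "connected_component_set (- graph) r \<inter> Q = {}"
  then have DQ: "D \<inter> Q = {}"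
    by (simp add: D_def)
  have oD: "open D"
    using closed_graph by (simp add: D_def open_connected_component open_Compl)
  have rD: "r \<in> D"
    using r by (simp add: D_def connected_component_refl_eq)
  have DG: "D \<inter> graph = {}"
    using connected_component_subset[of "- graph" r] by (auto simp: D_def)
  have cl: "closure D \<subseteq> D \<union> graph"
  proof
    fix x assume x: "x \<in> closure D"
    show "x \<in> D \<union> graph"
    proof (rule ccontr)
      assume "x \<notin> D \<union> graph"
      then have "x \<in> connected_component_set (- graph) x"
        by (simp add: connected_component_refl_eq)
      moreover have "open (connected_component_set (- graph) x)"
        using closed_graph by (simp add: open_connected_component open_Compl)
      ultimately have "connected_component_set (- graph) x \<inter> D \<noteq> {}"
        using x open_Int_closure_eq_empty by blast
      then have "connected_component (- graph) r x"
        unfolding D_def by (metis connected_component_overlap connected_component_eq_eq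
            \<open>x \<in> connected_component_set (- graph) x\<close> mem_Collect_eq)
      then show False
        using \<open>x \<notin> D \<union> graph\<close> by (simp add: D_def)
    qed
  qed
  then have clQ: "closure D \<subseteq> - Q"
    using DQ graph_eq by blast
  define K where "K = q ` closure D"
  have "compact K"
    unfolding K_def using bd covering_space_imp_continuous[OF cov] clQ
    by (intro compact_continuous_image) (auto simp: D_def intro: continuous_on_subset)
  have KP: "K \<subseteq> - of_nat ` {1..k}"
    using clQ covering_space_imp_surjective[OF cov] by (auto simp: K_def)
  have "openin (top_of_set (- of_nat ` {1..k})) (q ` D)"
    using oD DQ by (intro covering_space_open_map[OF cov] open_subset) auto
  moreover have "open (- of_nat ` {1..k} :: complex set)"
    by (simp add: finite_imp_closed open_Compl)
  ultimately have oqD: "open (q ` D)"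
    using openin_open_trans by blast
  have qD: "q ` D \<inter> merid = {}"
    using DG DQ graph_eq by auto
  have KD: "K \<subseteq> q ` D \<union> merid"
    using cl graph_eq by (auto simp: K_def)
  have "q r \<notin> merid"
    using qD rD by blast
  then obtain L where L: "connected L" "q r \<in> L" "L \<inter> merid = {}"
      "L \<inter> of_nat ` {1..k} \<noteq> {} \<or> \<not> bounded L"
    using meridian_complement unfolding merid_def by metis
  \<comment> \<open>\<open>L\<close> avoids the meridians, so on \<open>L\<close> the closed set
    \<open>K\<close> and the open image of the face coincide: their trace is open and closed in the
    connected \<open>L\<close>.\<close>
  have LK: "L \<inter> K = L \<inter> q ` D"
    using KD L(3) closure_subset[of D] by (auto simp: K_def)
  have "openin (top_of_set L) (L \<inter> K)"
    unfolding LK using oqD by blast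
  moreover have "closedin (top_of_set L) (L \<inter> K)"
    by (rule closedin_closed_Int[OF compact_imp_closed[OF \<open>compact K\<close>]])
  moreover have "L \<inter> K \<noteq> {}"
    using LK L(2) rD by blast
  ultimately have "L \<inter> K = L"
    using L(1) by (auto simp: connected_clopen)
  then have "L \<subseteq> K"
    by blast
  then show False
    using L(4) KP \<open>compact K\<close> compact_imp_bounded bounded_subset by blast
qed

text \<open>The lifted graph has \<open>2 n\<close> vertices, \<open>n (k + 1)\<close> edges and at
  least one component, and each face takes up a puncture. With the punctures at infinity included
  this reads \<open>n ((k + 1) - 2) \<le> (card Q + 1) - 2\<close>.\<close>

lemma card_punctures: "n * (k + 1) + 1 \<le> card Q + 2 * n"
proof -
  let ?Vs = "poles \<i> \<union> poles (- \<i>)"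
  have disj: "poles \<i> \<inter> poles (- \<i>) = {}"
    by (auto simp: poles_def complex_eq_iff)
  have "\<exists>R K. finite R \<and> finite K \<and> K \<subseteq> ?Vs \<and>
     R \<subseteq> - (?Vs \<union> (\<Union>e\<in>graph_edges. path_image (lift e))) \<and>
     pairwise (\<lambda>r s. \<not> connected_component (- (?Vs \<union> (\<Union>e\<in>graph_edges. path_image (lift e)))) r s) R \<and>
     (\<forall>v\<in>?Vs. \<exists>\<kappa>\<in>K. path_component (?Vs \<union> (\<Union>e\<in>graph_edges. path_image (lift e))) v \<kappa>) \<and>
     card graph_edges + 1 + card K \<le> card R + card ?Vs"
  proof (rule planar_graph_faces_components)
    fix e assume e: "e \<in> graph_edges"
    show "pathstart (lift e) \<in> ?Vs \<and> pathfinish (lift e) \<in> ?Vs"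
      using lift_ends[OF e] by blast
    show "(path_image (lift e) - {pathstart (lift e), pathfinish (lift e)}) \<inter> ?Vs = {}"
    proof (rule ccontr)
      assume "(path_image (lift e) - {pathstart (lift e), pathfinish (lift e)}) \<inter> ?Vs \<noteq> {}"
      then obtain x where x: "x \<in> path_image (lift e) - {pathstart (lift e), pathfinish (lift e)}" "x \<in> ?Vs"
        by blast
      obtain t where t: "0 < t" "t < 1" "x = lift e t"
        using lift_interior[OF x(1)] by blast
      have "meridian (snd e) t = \<i> \<or> meridian (snd e) t = - \<i>"
        using lift(4)[OF e, of t] t x(2) by (auto simp: poles_def)
      then show False
        using t by (auto simp: meridian_def complex_eq_iff)
    qed
    fix e' assume e': "e' \<in> graph_edges" "e \<noteq> e'"
    show "(path_image (lift e) - {pathstart (lift e), pathfinish (lift e)}) \<inter> path_image (lift e') = {}"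
    proof (rule ccontr)
      assume "(path_image (lift e) - {pathstart (lift e), pathfinish (lift e)}) \<inter> path_image (lift e') \<noteq> {}"
      then obtain x s where x: "x \<in> path_image (lift e) - {pathstart (lift e), pathfinish (lift e)}"
          "s \<in> {0..1}" "x = lift e' s"
        unfolding path_image_def[of "lift e'"] by blast
      obtain t where t: "0 < t" "t < 1" "x = lift e t"
        using lift_interior[OF x(1)] by blast
      show False
        using lift_eqD(2)[OF e e'(1), of t s] t x e'(2) by auto
    qed
  qed (use finite_poles arc_lift in \<open>auto simp: graph_edges_def\<close>)
  then obtain R K where R: "finite R" "finite K" "R \<subseteq> - graph"
      "pairwise (\<lambda>r s. \<not> connected_component (- graph) r s) R"
      "\<forall>v\<in>?Vs. \<exists>\<kappa>\<in>K. path_component graph v \<kappa>"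
      "card graph_edges + 1 + card K \<le> card R + card ?Vs"
    unfolding graph_def by blast
  have "poles \<i> \<noteq> {}"
    using card_poles npos by force
  then have "K \<noteq> {}"
    using R(5) by blast
  then have "1 \<le> card K"
    using R(2) by (simp add: Suc_le_eq card_gt_0_iff)
  moreover have "card ?Vs = 2 * n"
    using card_Un_disjoint[OF finite_poles disj] card_poles by simp
  moreover have "card graph_edges = n * (k + 1)"
    by (simp add: graph_edges_def card_cartesian_product card_poles)
  moreover have "card R \<le> card Q + 1"
  proof -
    let ?C = "\<lambda>r. connected_component_set (- graph) r"
    \<comment> \<open>Bounded faces inject into \<open>Q\<close>. There is at most one unbounded
      face, because the graph is bounded; it accounts for the puncture at infinity.\<close>
    define Rb where "Rb = {r \<in> R. bounded (?C r)}"
    have inj: "r = s" if "r \<in> R" "s \<in> R" "?C r \<inter> ?C s \<noteq> {}" for r s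
    proof (rule ccontr)
      assume "r \<noteq> s"
      then have "\<not> connected_component (- graph) r s"
        using R(4) that by (auto simp: pairwise_def)
      then show False
        using that(3) connected_component_sym connected_component_trans by blast
    qed
    have "\<forall>r\<in>Rb. \<exists>p. p \<in> ?C r \<inter> Q"
      using bounded_face_meets_Q R(3) unfolding Rb_def by blast
    then obtain p where p: "\<And>r. r \<in> Rb \<Longrightarrow> p r \<in> ?C r \<inter> Q"
      by metis
    have "inj_on p Rb"
      using inj p unfolding inj_on_def Rb_def by (metis (no_types, lifting) IntD1 IntI empty_iff mem_Collect_eq)
    then have b: "card Rb \<le> card Q"
      using p finQ by (intro card_inj_on_le[of p]) auto
    have "card (R - Rb) \<le> 1"
    proof -
      have "r = s" if "r \<in> R - Rb" "s \<in> R - Rb" for r s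
      proof -
        have "?C r = ?C s"
          using that bounded_graph
          by (intro cobounded_unique_unbounded_component) (auto simp: Rb_def)
        moreover have "r \<in> ?C r"
          using that R(3) connected_component_refl by auto
        ultimately show ?thesis
          using inj that by blast
      qed
      then show ?thesis
        using R(1) by (metis One_nat_def card_le_Suc0_iff_eq finite_Diff)
    qed
    moreover have "card R = card Rb + card (R - Rb)"
      using card_Int_Diff[OF R(1), of Rb] by (simp add: Rb_def Int_def)
    ultimately show ?thesis
      using b by linarith
  qed
  ultimately show ?thesis
    using R(6) by linarith
qed

end

section \<open>Local degrees as numbers of nearby preimages\<close>

section \<open>Local degrees\<close>

text \<open>Everything is read off from \<open>z ^ d\<close> between discs of radii \<open>r\<close>
  and \<open>r ^ d\<close>, where a nonzero value has \<open>d\<close> roots. The set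
  \<open>X\<close> allows arbitrarily small neighbourhoods, and the clause on \<open>N'\<close>
  supplies values close to \<open>f x\<close> but different from it.\<close>

lemma local_model_nbhd:
  assumes lm: "local_model S f T x d" and d: "1 \<le> d"
    and X: "openin (top_of_set S) X" "x \<in> X"
  shows "\<exists>O' N. openin (top_of_set S) O' \<and> x \<in> O' \<and> O' \<subseteq> X \<and> openin (top_of_set T) N \<and>
     f x \<in> N \<and> {z \<in> O'. f z = f x} = {x} \<and>
     (\<forall>y\<in>N - {f x}. card {z \<in> O'. f z = y} = d) \<and>
     (\<forall>N'. openin (top_of_set T) N' \<and> f x \<in> N' \<longrightarrow> \<not> N' \<subseteq> {f x}) \<and>
     (d = 1 \<longrightarrow> (\<exists>g. homeomorphism O' N f g))"
proof -
  obtain U W \<phi> \<phi>' \<psi> \<psi>' where U: "openin (top_of_set S) U" "x \<in> U" and W: "openin (top_of_set T) W"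
    and \<phi>: "homeomorphism U (ball (0::complex) 1) \<phi> \<phi>'"
    and \<psi>: "homeomorphism W (ball (0::complex) 1) \<psi> \<psi>'"
    and x0: "\<phi> x = 0" "\<psi> (f x) = 0" and f: "\<And>z. z \<in> U \<Longrightarrow> f z \<in> W" "\<And>z. z \<in> U \<Longrightarrow> \<psi> (f z) = (\<phi> z) ^ d"
    using lm unfolding local_model_def by metis
  have fxW: "f x \<in> W"
    using f U by blast
  have "openin (top_of_set U) (U \<inter> X)"
    by (metis X(1) U(1) inf_commute openin_Int openin_imp_subset openin_subset_trans inf_le1)
  then have "openin (top_of_set (ball 0 1)) (\<phi> ` (U \<inter> X))"
    using homeomorphism_imp_open_map[OF \<phi>] by blast
  then have "open (\<phi> ` (U \<inter> X))"
    using openin_open_trans by blast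
  moreover have "0 \<in> \<phi> ` (U \<inter> X)"
    using x0 X U by force
  ultimately obtain r0 where r0: "r0 > 0" "ball 0 r0 \<subseteq> \<phi> ` (U \<inter> X)"
    by (meson open_contains_ball)
  define r where "r = min r0 1"
  have r: "0 < r" "r \<le> 1" "ball 0 r \<subseteq> \<phi> ` (U \<inter> X)"
    using r0 by (auto simp: r_def)
  have rd: "0 < r ^ d" "r ^ d \<le> 1"
    using r by (auto simp: power_le_one)
  define O' where "O' = \<phi>' ` ball 0 r"
  define N where "N = \<psi>' ` ball 0 (r ^ d)"
  have balls: "ball 0 r \<subseteq> ball (0::complex) 1" "ball 0 (r ^ d) \<subseteq> ball (0::complex) 1"
    using r rd by auto
  have iU: "\<phi>' (\<phi> z) = z" if "z \<in> U" for z
    using \<phi> that by (simp add: homeomorphism_def)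
  have iW: "\<psi>' (\<psi> z) = z" if "z \<in> W" for z
    using \<psi> that by (simp add: homeomorphism_def)
  have jU: "\<phi> (\<phi>' c) = c" "\<phi>' c \<in> U" if "c \<in> ball 0 1" for c
    using \<phi> that by (auto simp: homeomorphism_def)
  have jW: "\<psi> (\<psi>' c) = c" "\<psi>' c \<in> W" if "c \<in> ball 0 1" for c
    using \<psi> that by (auto simp: homeomorphism_def)
  have O'_iff: "z \<in> O' \<longleftrightarrow> z \<in> U \<and> norm (\<phi> z) < r" for z
  proof
    assume "z \<in> O'"
    then obtain c where "c \<in> ball 0 r" "z = \<phi>' c"
      by (auto simp: O'_def)
    then show "z \<in> U \<and> norm (\<phi> z) < r"
      using jU[of c] balls by auto
  next
    assume "z \<in> U \<and> norm (\<phi> z) < r"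
    then show "z \<in> O'"
      unfolding O'_def using iU[of z] by (intro image_eqI[of _ _ "\<phi> z"]) auto
  qed
  have N_iff: "y \<in> N \<longleftrightarrow> y \<in> W \<and> norm (\<psi> y) < r ^ d" for y
  proof
    assume "y \<in> N"
    then obtain c where "c \<in> ball 0 (r ^ d)" "y = \<psi>' c"
      by (auto simp: N_def)
    then show "y \<in> W \<and> norm (\<psi> y) < r ^ d"
      using jW[of c] balls by auto
  next
    assume "y \<in> W \<and> norm (\<psi> y) < r ^ d"
    then show "y \<in> N"
      unfolding N_def using iW[of y] by (intro image_eqI[of _ _ "\<psi> y"]) auto
  qed
  have opO': "openin (top_of_set S) O'"
  proof -
    have "openin (top_of_set (ball 0 1)) (ball (0::complex) r)"
      using balls by (intro open_subset) auto
    then have "openin (top_of_set U) O'"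
      unfolding O'_def using homeomorphism_imp_open_map[OF homeomorphism_symD[OF \<phi>]] by blast
    then show ?thesis
      using U openin_trans by blast
  qed
  have opN: "openin (top_of_set T) N"
  proof -
    have "openin (top_of_set (ball 0 1)) (ball (0::complex) (r ^ d))"
      using balls by (intro open_subset) auto
    then have "openin (top_of_set W) N"
      unfolding N_def using homeomorphism_imp_open_map[OF homeomorphism_symD[OF \<psi>]] by blast
    then show ?thesis
      using W openin_trans by blast
  qed
  have xO': "x \<in> O'" "f x \<in> N"
    using O'_iff N_iff U fxW x0 r rd by auto
  have O'X: "O' \<subseteq> X"
  proof
    fix z assume "z \<in> O'"
    then have z: "z \<in> U" "\<phi> z \<in> ball 0 r"
      using O'_iff by auto
    then obtain z' where "z' \<in> U \<inter> X" "\<phi> z' = \<phi> z"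
      using r(3) by force
    then show "z \<in> X"
      using iU z by (metis IntD1 IntD2)
  qed
  have fib: "{z \<in> O'. f z = y} = \<phi>' ` {c. c ^ d = \<psi> y}" if "y \<in> N" for y
  proof
    show "{z \<in> O'. f z = y} \<subseteq> \<phi>' ` {c. c ^ d = \<psi> y}"
    proof
      fix z assume "z \<in> {z \<in> O'. f z = y}"
      then show "z \<in> \<phi>' ` {c. c ^ d = \<psi> y}"
        using O'_iff f(2)[of z] iU[of z] by (intro image_eqI[of _ _ "\<phi> z"]) auto
    qed
    show "\<phi>' ` {c. c ^ d = \<psi> y} \<subseteq> {z \<in> O'. f z = y}"
    proof
      fix z assume "z \<in> \<phi>' ` {c. c ^ d = \<psi> y}"
      then obtain c where c: "c ^ d = \<psi> y" "z = \<phi>' c"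
        by blast
      have "norm c ^ d < r ^ d"
        using that N_iff c by (metis norm_power)
      then have cr: "norm c < r"
        using r(1) by (meson less_imp_le power_less_imp_less_base)
      then have c1: "c \<in> ball 0 1"
        using r by auto
      have zO': "z \<in> O'"
        using c cr by (auto simp: O'_def)
      have "\<psi> (f z) = \<psi> y"
        using f(2) jU[OF c1] c by simp
      then have "f z = y"
        using iW[of "f z"] iW[of y] f(1) O'_iff zO' N_iff that by metis
      then show "z \<in> {z \<in> O'. f z = y}"
        using zO' by blast
    qed
  qed
  have one: "{z \<in> O'. f z = f x} = {x}"
  proof -
    have "{c::complex. c ^ d = 0} = {0}"
      using d by auto
    then show ?thesis
      using fib[OF xO'(2)] x0 iU[OF U(2)] by simp
  qed
  have cnt: "card {z \<in> O'. f z = y} = d" if y: "y \<in> N - {f x}" for y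
  proof -
    have yW: "y \<in> W" "norm (\<psi> y) < r ^ d"
      using y N_iff by auto
    have "\<psi> y \<noteq> 0"
      using iW[OF yW(1)] iW[OF fxW] x0 y by force
    then have 1: "card {c. c ^ d = \<psi> y} = d"
      using d by (intro card_nth_roots) auto
    have sub: "{c. c ^ d = \<psi> y} \<subseteq> ball 0 1"
    proof
      fix c assume "c \<in> {c. c ^ d = \<psi> y}"
      then have "norm c ^ d = norm (\<psi> y)"
        by (simp add: norm_power[symmetric])
      then have "norm c ^ d < 1 ^ d"
        using yW rd by simp
      then show "c \<in> ball 0 1"
        using power_less_imp_less_base[of "norm c" d 1] by simp
    qed
    have "inj_on \<phi>' {c. c ^ d = \<psi> y}"
      using jU(1) sub by (metis (no_types, lifting) inj_onI subsetD)
    then show ?thesis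
      using fib[of y] y 1 by (simp add: card_image)
  qed
  have iso: "\<not> N' \<subseteq> {f x}" if N': "openin (top_of_set T) N'" "f x \<in> N'" for N'
  proof
    assume "N' \<subseteq> {f x}"
    then have "N' = {f x}"
      using N' by blast
    then have "openin (top_of_set W) {f x}"
      using N' W fxW by (metis empty_subsetI insert_subset openin_imp_subset openin_subset_trans)
    then have "openin (top_of_set (ball 0 1)) (\<psi> ` {f x})"
      using homeomorphism_imp_open_map[OF \<psi>] by blast
    then have "open {0::complex}"
      using x0 openin_open_trans by force
    then show False
      using not_open_singleton by blast
  qed
  have hom: "\<exists>g. homeomorphism O' N f g" if "d = 1"
  proof -
    have fO': "f z = \<psi>' (\<phi> z)" if "z \<in> O'" for z
      using that f[of z] O'_iff iW[of "f z"] \<open>d = 1\<close> by simp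
    have 1: "homeomorphism O' (ball 0 r) \<phi> \<phi>'"
      unfolding O'_def using homeomorphism_symD[OF homeomorphism_of_subsets[OF
            homeomorphism_symD[OF \<phi>] balls(1) empty_subsetI refl]] .
    have 2: "homeomorphism (ball 0 r) N \<psi>' \<psi>"
      using homeomorphism_of_subsets[OF homeomorphism_symD[OF \<psi>] balls(2) empty_subsetI refl] that
      by (simp add: N_def)
    have "homeomorphism O' N (\<psi>' \<circ> \<phi>) (\<phi>' \<circ> \<psi>)"
      using homeomorphism_compose[OF 1 2] .
    then have "homeomorphism O' N f (\<phi>' \<circ> \<psi>)"
      by (rule homeomorphism_cong) (auto simp: fO')
    then show ?thesis
      by blast
  qed
  show ?thesis
  proof (rule exI[of _ O'], rule exI[of _ N], intro conjI ballI allI impI)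
    show "\<not> N' \<subseteq> {f x}" if "openin (top_of_set T) N' \<and> f x \<in> N'" for N'
      using iso that by blast
  qed (fact opO' opN xO' O'X one cnt hom)+
qed

text \<open>Nested neighbourhoods of \<open>x\<close> are compared over a common value near
  \<open>f x\<close>: the smaller one cannot contain more preimages. By symmetry the exponent is
  unique, which makes \<open>THE\<close> in \<open>local_degree\<close> meaningful.\<close>

lemma local_model_le:
  assumes "local_model S f T x d" "local_model S f T x d'" "1 \<le> d" "1 \<le> d'" "x \<in> S"
  shows "d' \<le> d"
proof -
  obtain O1 N1 where 1: "openin (top_of_set S) O1" "x \<in> O1" "openin (top_of_set T) N1" "f x \<in> N1"
      "\<forall>y\<in>N1 - {f x}. card {z \<in> O1. f z = y} = d"
      "\<forall>N'. openin (top_of_set T) N' \<and> f x \<in> N' \<longrightarrow> \<not> N' \<subseteq> {f x}"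
    using local_model_nbhd[OF assms(1,3), of S] assms(5) by auto
  obtain O2 N2 where 2: "openin (top_of_set S) O2" "x \<in> O2" "O2 \<subseteq> O1" "openin (top_of_set T) N2" "f x \<in> N2"
      "\<forall>y\<in>N2 - {f x}. card {z \<in> O2. f z = y} = d'"
    using local_model_nbhd[OF assms(2,4) 1(1,2)] by metis
  obtain y where y: "y \<in> N1 \<inter> N2" "y \<noteq> f x"
    using 1(6) openin_Int[OF 1(3) 2(4)] 1(4) 2(5) by blast
  have "card {z \<in> O1. f z = y} = d"
    using 1 y by blast
  then have "finite {z \<in> O1. f z = y}"
    using assms(3) by (metis card.infinite not_one_le_zero)
  then have "card {z \<in> O2. f z = y} \<le> card {z \<in> O1. f z = y}"
    using 2(3) by (intro card_mono) auto
  then show ?thesis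
    using 1 2 y by auto
qed

lemma local_degree_eq:
  assumes "local_model S f T x d" "1 \<le> d" "x \<in> S"
  shows "local_degree S f T x = d"
  unfolding local_degree_def
proof (rule the_equality)
  show "1 \<le> d \<and> local_model S f T x d"
    using assms by blast
  fix d' assume "1 \<le> d' \<and> local_model S f T x d'"
  then show "d' = d"
    using local_model_le[of S f T x d d'] local_model_le[of S f T x d' d] assms by simp
qed

lemma local_degree_inj:
  assumes "local_model S f T x d" "1 \<le> d" "x \<in> S" "openin (top_of_set S) X" "x \<in> X" "inj_on f X"
  shows "d = 1"
proof -
  obtain O1 N1 where 1: "openin (top_of_set S) O1" "x \<in> O1" "O1 \<subseteq> X" "openin (top_of_set T) N1" "f x \<in> N1"
      "\<forall>y\<in>N1 - {f x}. card {z \<in> O1. f z = y} = d"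
      "\<forall>N'. openin (top_of_set T) N' \<and> f x \<in> N' \<longrightarrow> \<not> N' \<subseteq> {f x}"
    using local_model_nbhd[OF assms(1,2,4,5)] by auto
  obtain y where y: "y \<in> N1" "y \<noteq> f x"
    using 1 by blast
  have d: "card {z \<in> O1. f z = y} = d"
    using 1 y by blast
  have "is_singleton {z \<in> O1. f z = y} \<or> {z \<in> O1. f z = y} = {}"
    using 1(3) assms(6) unfolding is_singleton_def inj_on_def by blast
  then show ?thesis
    using d assms(2) by (metis card.empty is_singleton_altdef not_one_le_zero)
qed

lemma local_model_transfer:
  assumes hS: "homeomorphism S S' hS kS" and hT: "homeomorphism T T' hT kT"
    and x: "x \<in> S" and lm: "local_model S f T x d"
  shows "local_model S' (hT \<circ> f \<circ> kS) T' (hS x) d"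
proof -
  obtain U W \<phi> \<phi>' \<psi> \<psi>' where U: "openin (top_of_set S) U" "x \<in> U" and W: "openin (top_of_set T) W"
    and \<phi>: "homeomorphism U (ball (0::complex) 1) \<phi> \<phi>'"
    and \<psi>: "homeomorphism W (ball (0::complex) 1) \<psi> \<psi>'"
    and x0: "\<phi> x = 0" "\<psi> (f x) = 0" and f: "\<And>z. z \<in> U \<Longrightarrow> f z \<in> W" "\<And>z. z \<in> U \<Longrightarrow> \<psi> (f z) = (\<phi> z) ^ d"
    using lm unfolding local_model_def by metis
  have US: "U \<subseteq> S" "W \<subseteq> T"
    using U W openin_imp_subset by blast+
  have iS: "kS (hS z) = z" if "z \<in> S" for z
    using hS that by (simp add: homeomorphism_def)
  have iT: "kT (hT z) = z" if "z \<in> T" for z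
    using hT that by (simp add: homeomorphism_def)
  have hU: "homeomorphism (hS ` U) U kS hS"
    by (rule homeomorphism_symD[OF homeomorphism_of_subsets[OF hS US(1) empty_subsetI refl]])
  have hW: "homeomorphism (hT ` W) W kT hT"
    by (rule homeomorphism_symD[OF homeomorphism_of_subsets[OF hT US(2) empty_subsetI refl]])
  have A: "\<forall>z\<in>hS ` U. (hT \<circ> f \<circ> kS) z \<in> hT ` W \<and> (\<psi> \<circ> kT) ((hT \<circ> f \<circ> kS) z) = ((\<phi> \<circ> kS) z) ^ d"
  proof
    fix z assume "z \<in> hS ` U"
    then obtain u where u: "u \<in> U" "z = hS u"
      by blast
    then have k: "kS z = u"
      using iS US by blast
    have "kT (hT (f u)) = f u"
      using iT US f(1) u by blast
    then show "(hT \<circ> f \<circ> kS) z \<in> hT ` W \<and> (\<psi> \<circ> kT) ((hT \<circ> f \<circ> kS) z) = ((\<phi> \<circ> kS) z) ^ d"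
      using k f u by simp
  qed
  have "kT (hT (f x)) = f x"
    using iT US f(1) U by blast
  then have B: "(\<phi> \<circ> kS) (hS x) = 0" "(\<psi> \<circ> kT) ((hT \<circ> f \<circ> kS) (hS x)) = 0"
    using iS[OF x] x0 by simp_all
  have C: "openin (top_of_set S') (hS ` U)" "openin (top_of_set T') (hT ` W)" "hS x \<in> hS ` U"
    using homeomorphism_imp_open_map[OF hS U(1)] homeomorphism_imp_open_map[OF hT W] U by auto
  show ?thesis
    unfolding local_model_def
    using A B C homeomorphism_compose[OF hU \<phi>] homeomorphism_compose[OF hW \<psi>] by metis
qed

lemma covering_space_transfer:
  assumes cov: "covering_space c p S"
    and h: "homeomorphism c c' h h'" and k: "homeomorphism S S' k k'"
  shows "covering_space c' (k \<circ> p \<circ> h') S'"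
proof
  have pc: "p ` c = S"
    using cov by (rule covering_space_imp_surjective)
  show "continuous_on c' (k \<circ> p \<circ> h')"
    using h k cov covering_space_imp_continuous[OF cov] pc
    by (intro continuous_on_compose) (auto simp: homeomorphism_def)
  show "(k \<circ> p \<circ> h') ` c' = S'"
    using homeomorphism_image2[OF h] homeomorphism_image1[OF k] pc by (metis image_comp)
  fix x assume "x \<in> S'"
  then have kx: "k' x \<in> S" "k (k' x) = x"
    using k by (auto simp: homeomorphism_def)
  obtain T v where T: "k' x \<in> T" "openin (top_of_set S) T" and v: "\<Union>v = c \<inter> p -` T"
      "\<And>u. u \<in> v \<Longrightarrow> openin (top_of_set c) u" "pairwise disjnt v"
      "\<And>u. u \<in> v \<Longrightarrow> \<exists>q. homeomorphism u T p q"
    using cov kx unfolding covering_space_def by metis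
  have TS: "T \<subseteq> S"
    using T openin_imp_subset by blast
  have vc: "u \<subseteq> c" if "u \<in> v" for u
    using v(2)[OF that] openin_imp_subset by blast
  have ih: "h' (h z) = z" if "z \<in> c" for z
    using h that by (simp add: homeomorphism_def)
  have ih2: "h (h' z) = z" "h' z \<in> c" if "z \<in> c'" for z
    using h that by (auto simp: homeomorphism_def)
  have ik: "k' (k z) = z" if "z \<in> S" for z
    using k that by (simp add: homeomorphism_def)
  show "\<exists>T. x \<in> T \<and> openin (top_of_set S') T \<and>
         (\<exists>v. \<Union>v = c' \<inter> (k \<circ> p \<circ> h') -` T \<and> (\<forall>u\<in>v. openin (top_of_set c') u) \<and>
           pairwise disjnt v \<and> (\<forall>u\<in>v. \<exists>q. homeomorphism u T (k \<circ> p \<circ> h') q))"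
  proof (rule exI[of _ "k ` T"], intro conjI exI[of _ "(`) h ` v"] ballI)
    show "x \<in> k ` T"
      using T kx by force
    show "openin (top_of_set S') (k ` T)"
      using homeomorphism_imp_open_map[OF k T(2)] .
    show "\<Union>((`) h ` v) = c' \<inter> (k \<circ> p \<circ> h') -` k ` T"
    proof
      show "\<Union>((`) h ` v) \<subseteq> c' \<inter> (k \<circ> p \<circ> h') -` k ` T"
      proof
        fix z assume "z \<in> \<Union>((`) h ` v)"
        then obtain u w where u: "u \<in> v" "w \<in> u" "z = h w"
          by blast
        then have "w \<in> c" "p w \<in> T"
          using v(1) by auto
        then show "z \<in> c' \<inter> (k \<circ> p \<circ> h') -` k ` T"
          using u ih h by (auto simp: homeomorphism_def)
      qed
      show "c' \<inter> (k \<circ> p \<circ> h') -` k ` T \<subseteq> \<Union>((`) h ` v)"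
      proof
        fix z assume z: "z \<in> c' \<inter> (k \<circ> p \<circ> h') -` k ` T"
        then obtain t where t: "t \<in> T" "k (p (h' z)) = k t"
          by auto
        have "p (h' z) \<in> S"
          using pc ih2 z by blast
        then have "p (h' z) = t"
          using t TS ik by (metis subsetD)
        then have "h' z \<in> \<Union>v"
          using v(1) ih2 z t by auto
        then obtain u where "u \<in> v" "h' z \<in> u"
          by blast
        then show "z \<in> \<Union>((`) h ` v)"
          using ih2 z by (metis IntD1 UN_iff imageI)
      qed
    qed
    show "openin (top_of_set c') u" if "u \<in> (`) h ` v" for u
      using that v(2) homeomorphism_imp_open_map[OF h] by blast
    show "pairwise disjnt ((`) h ` v)"
    proof (rule pairwiseI)
      fix a b assume ab: "a \<in> (`) h ` v" "b \<in> (`) h ` v" "a \<noteq> b"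
      then obtain u w where u: "u \<in> v" "w \<in> v" "a = h ` u" "b = h ` w"
        by blast
      have "disjnt u w"
        using v(3) u ab by (auto simp: pairwise_def)
      moreover have "inj_on h c"
        using ih by (metis inj_onI)
      ultimately show "disjnt a b"
        using u vc unfolding disjnt_def by (metis image_empty inj_on_image_Int)
    qed
    fix u' assume "u' \<in> (`) h ` v"
    then obtain u where u: "u \<in> v" "u' = h ` u"
      by blast
    obtain q where q: "homeomorphism u T p q"
      using v(4) u by blast
    have 1: "homeomorphism u' u h' h"
      unfolding u(2)
      by (rule homeomorphism_symD[OF homeomorphism_of_subsets[OF h vc[OF u(1)] empty_subsetI refl]])
    have 2: "homeomorphism T (k ` T) k k'"
      by (rule homeomorphism_of_subsets[OF k TS empty_subsetI refl])
    have "homeomorphism u' (k ` T) (k \<circ> p \<circ> h') (h \<circ> (q \<circ> k'))"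
      using homeomorphism_compose[OF 1 homeomorphism_compose[OF q 2]] by (simp add: o_assoc)
    then show "\<exists>q. homeomorphism u' (k ` T) (k \<circ> p \<circ> h') q"
      by blast
  qed
qed

section \<open>Sheets, ramification and critical points on the round sphere\<close>

section \<open>Branched coverings of the sphere\<close>

definition S2 :: "(real^3) set" where
  "S2 = sphere 0 1"

lemma compact_S2: "compact S2" and closed_S2: "closed S2" and connected_S2: "connected S2"
  by (auto simp: S2_def intro: connected_sphere)

lemma punctured_S2_homeomorphic_plane:
  assumes "a \<in> S2"
  shows "(S2 - {a}) homeomorphic (UNIV :: complex set)"
proof -
  obtain c :: "real^3" where c: "c \<noteq> 0"
    by (metis zero_neq_one vector_choose_size norm_zero zero_le_one)
  have "(S2 - {a}) homeomorphic {x. c \<bullet> x = 0}"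
    unfolding S2_def using assms c by (intro homeomorphic_punctured_sphere_hyperplane) (auto simp: S2_def)
  moreover have "{x. c \<bullet> x = 0} homeomorphic (UNIV :: complex set)"
    using c by (intro homeomorphic_affine_sets) (auto simp: affine_hyperplane)
  ultimately show ?thesis
    by (rule homeomorphic_trans)
qed

lemma homeomorphism_imp_inj_on: "homeomorphism S T f g \<Longrightarrow> inj_on f S"
  by (auto simp: homeomorphism_def intro: inj_on_inverseI)

text \<open>Without \<open>a\<close> the sphere is a plane, and finitely many points do not
  disconnect a plane.\<close>

lemma connected_S2_minus_finite:
  assumes "finite F" "a \<in> F" "a \<in> S2"
  shows "connected (S2 - F)"
proof -
  obtain h k where h: "homeomorphism (S2 - {a}) (UNIV :: complex set) h k"
    using punctured_S2_homeomorphic_plane[OF assms(3)] by (auto simp: homeomorphic_def)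
  have "S2 - F = k ` (UNIV - h ` (F \<inter> (S2 - {a})))"
  proof
    show "S2 - F \<subseteq> k ` (UNIV - h ` (F \<inter> (S2 - {a})))"
    proof
      fix x assume x: "x \<in> S2 - F"
      then have xa: "x \<in> S2 - {a}"
        using assms by blast
      have "h x \<notin> h ` (F \<inter> (S2 - {a}))"
      proof
        assume "h x \<in> h ` (F \<inter> (S2 - {a}))"
        then obtain w where w: "w \<in> F" "w \<in> S2 - {a}" "h x = h w"
          by blast
        then have "x = w"
          using inj_onD[OF homeomorphism_imp_inj_on[OF h]] xa by blast
        then show False
          using w x by blast
      qed
      then show "x \<in> k ` (UNIV - h ` (F \<inter> (S2 - {a})))"
        using homeomorphism_apply1[OF h xa] by (intro image_eqI[of _ _ "h x"]) auto
    qed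
    show "k ` (UNIV - h ` (F \<inter> (S2 - {a}))) \<subseteq> S2 - F"
    proof
      fix x assume "x \<in> k ` (UNIV - h ` (F \<inter> (S2 - {a})))"
      then obtain z where z: "x = k z" "z \<notin> h ` (F \<inter> (S2 - {a}))"
        by blast
      have "k z \<in> S2 - {a}" "h (k z) = z"
        using homeomorphism_image2[OF h] homeomorphism_apply2[OF h] by blast+
      then show "x \<in> S2 - F"
        using z imageI[of "k z" "F \<inter> (S2 - {a})" h] by auto
    qed
  qed
  moreover have "connected (UNIV - h ` (F \<inter> (S2 - {a})))"
    using assms(1) by (intro connected_open_delete_finite) auto
  ultimately show ?thesis
    using connected_continuous_image[OF continuous_on_subset[OF homeomorphism_cont2[OF h] subset_UNIV]]
    by simp
qed

lemma openin_S2_infinite: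
  assumes "openin (top_of_set S2) N" "y \<in> N"
  shows "infinite N"
proof
  assume fin: "finite N"
  obtain V where V: "open V" "N = S2 \<inter> V"
    using assms(1) by (auto simp: openin_open)
  have "\<not> (\<exists>a. S2 = {a})"
  proof
    assume "\<exists>a. S2 = {a}"
    then obtain a where a: "S2 = {a}"
      by blast
    have "a \<in> S2"
      using a by blast
    then have "norm a = 1" "- a \<in> S2"
      by (auto simp: S2_def)
    then have "- a = a"
      using a by blast
    then have "a + a = 0"
      by (metis add.right_inverse)
    then have "2 *\<^sub>R a = 0"
      by (simp add: scaleR_2)
    then show False
      using \<open>norm a = 1\<close> by simp
  qed
  then have "y islimpt S2"
    using assms V connected_S2 by (intro connected_imp_perfect) auto
  then have "infinite (V \<inter> S2)"
    unfolding islimpt_eq_acc_point using assms(2) V by blast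
  then show False
    using fin V(2) by (simp add: Int_commute)
qed

locale S2_cover =
  fixes f :: "real^3 \<Rightarrow> real^3" and A B :: "(real^3) set"
  assumes bc: "branched_cover S2 f S2"
    and cov: "covering_space (S2 - A) f (S2 - B)"
    and finA: "finite A" "A \<subseteq> S2"
    and finB: "finite B" "B \<subseteq> S2" "B \<noteq> {}"
    and AB: "f ` A \<subseteq> B"
begin

abbreviation ld :: "real^3 \<Rightarrow> nat" where
  "ld \<equiv> local_degree S2 f S2"

definition n :: nat where
  "n = card {x \<in> S2. f x = (SOME y. y \<in> S2 - B)}"

lemma f_S2: "f ` S2 = S2" and cont_f: "continuous_on S2 f"
  using bc by (auto simp: branched_cover_def)

lemma f_in: "x \<in> S2 \<Longrightarrow> f x \<in> S2"
  using f_S2 by blast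

lemma f_onto:
  assumes "y \<in> S2"
  obtains x where "x \<in> S2" "f x = y"
proof -
  have "y \<in> f ` S2"
    using assms f_S2 by simp
  then show ?thesis
    using that by blast
qed

lemma A_iff: "x \<in> S2 \<Longrightarrow> x \<in> A \<longleftrightarrow> f x \<in> B"
  using AB covering_space_imp_surjective[OF cov] by blast

lemma ld_model:
  assumes "x \<in> S2"
  shows "local_model S2 f S2 x (ld x)" "1 \<le> ld x"
proof -
  obtain d where "d \<ge> 1" "local_model S2 f S2 x d"
    using bc assms unfolding branched_cover_def by blast
  then show "local_model S2 f S2 x (ld x)" "1 \<le> ld x"
    using local_degree_eq[of S2 f S2 x d] assms by auto
qed

text \<open>An infinite fibre would accumulate, by compactness, at a point that belongs to the fibre
  by continuity; but the local model isolates every point in its fibre.\<close>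

lemma finite_fibre: "finite {x \<in> S2. f x = y}"
proof (rule ccontr)
  let ?F = "{x \<in> S2. f x = y}"
  assume "infinite ?F"
  then obtain x where x: "x \<in> S2" "x islimpt ?F"
    using compact_S2 unfolding compact_eq_Bolzano_Weierstrass
    by (metis (no_types, lifting) mem_Collect_eq subsetI)
  have "closedin (top_of_set S2) ?F"
    using continuous_closedin_preimage_constant[OF cont_f, of y] by (simp add: Int_def vimage_def)
  then have "closed ?F"
    using closedin_closed_trans closed_S2 by blast
  then have fx: "f x = y"
    using x(2) closed_limpt by blast
  obtain O' where O': "openin (top_of_set S2) O'" "x \<in> O'" "{z \<in> O'. f z = f x} = {x}"
    using local_model_nbhd[OF ld_model[OF x(1)], of S2] x(1) by auto
  obtain V where V: "open V" "O' = S2 \<inter> V"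
    using O'(1) by (auto simp: openin_open)
  then obtain z where z: "z \<in> ?F" "z \<in> V" "z \<noteq> x"
    using x(2) O'(2) unfolding islimpt_def by blast
  have "z \<in> {z \<in> O'. f z = f x}"
    using z V(2) fx by simp
  then show False
    unfolding O'(3) using z(3) by simp
qed

text \<open>The analogue of an evenly covered neighbourhood when ramification is allowed.
  \<open>N'\<close> appears because \<open>N\<close> is cut down for all points of the fibre
  together, while each \<open>u x\<close> keeps its size.\<close>

definition fibre_chart :: "real^3 \<Rightarrow> (real^3 \<Rightarrow> (real^3) set) \<Rightarrow> (real^3) set \<Rightarrow> bool" where
  "fibre_chart y u N \<longleftrightarrow> openin (top_of_set S2) N \<and> y \<in> N \<and>
     (\<forall>x\<in>S2. f x = y \<longrightarrow> openin (top_of_set S2) (u x)) \<and>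
     (\<forall>x\<in>S2. \<forall>x'\<in>S2. f x = y \<longrightarrow> f x' = y \<longrightarrow> x \<noteq> x' \<longrightarrow> u x \<inter> u x' = {}) \<and>
     (\<forall>z\<in>S2. f z \<in> N \<longrightarrow> (\<exists>x\<in>S2. f x = y \<and> z \<in> u x)) \<and>
     (\<forall>x\<in>S2. f x = y \<longrightarrow> (\<forall>y'\<in>N - {y}. card {z \<in> u x. f z = y'} = ld x)) \<and>
     (\<forall>x\<in>S2. f x = y \<longrightarrow> ld x = 1 \<longrightarrow> (\<exists>N' g. N \<subseteq> N' \<and> homeomorphism (u x) N' f g))"

lemma fibre_chartD:
  assumes "fibre_chart y u N"
  shows "openin (top_of_set S2) N" "y \<in> N"
    "\<And>x. x \<in> S2 \<Longrightarrow> f x = y \<Longrightarrow> openin (top_of_set S2) (u x)"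
    "\<And>x x'. x \<in> S2 \<Longrightarrow> x' \<in> S2 \<Longrightarrow> f x = y \<Longrightarrow> f x' = y \<Longrightarrow> x \<noteq> x' \<Longrightarrow> u x \<inter> u x' = {}"
    "\<And>z. z \<in> S2 \<Longrightarrow> f z \<in> N \<Longrightarrow> \<exists>x\<in>S2. f x = y \<and> z \<in> u x"
    "\<And>x y'. x \<in> S2 \<Longrightarrow> f x = y \<Longrightarrow> y' \<in> N - {y} \<Longrightarrow> card {z \<in> u x. f z = y'} = ld x"
    "\<And>x. x \<in> S2 \<Longrightarrow> f x = y \<Longrightarrow> ld x = 1 \<Longrightarrow> \<exists>N' g. N \<subseteq> N' \<and> homeomorphism (u x) N' f g"
  using assms by (simp_all add: fibre_chart_def)

lemma fibre_chart_exists: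
  assumes y: "y \<in> S2"
  shows "\<exists>u N. fibre_chart y u N"
proof -
  let ?F = "{x \<in> S2. f x = y}"
  have F: "finite ?F"
    by (rule finite_fibre)
  obtain \<delta> where \<delta>: "\<delta> > 0" "\<And>x x'. x \<in> ?F \<Longrightarrow> x' \<in> ?F \<Longrightarrow> x \<noteq> x' \<Longrightarrow> 2 * \<delta> \<le> dist x x'"
  proof -
    \<comment> \<open>\<open>D\<close> is empty when the fibre is a single point; the 1 inserted
      below keeps \<open>Min\<close> defined in that case.\<close>
    define D where "D = (\<lambda>(x, x'). dist x x') ` {(x, x') \<in> ?F \<times> ?F. x \<noteq> x'}"
    have "finite {(x, x') \<in> ?F \<times> ?F. x \<noteq> x'}"
      by (rule finite_subset[of _ "?F \<times> ?F"]) (use F in auto)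
    then have "finite D"
      unfolding D_def by (rule finite_imageI)
    moreover have "\<forall>d\<in>D. d > 0"
      by (auto simp: D_def)
    ultimately have m: "Min (insert 1 D) > 0" "\<And>d. d \<in> D \<Longrightarrow> Min (insert 1 D) \<le> d"
      by auto
    have "2 * (Min (insert 1 D) / 2) \<le> dist x x'" if "x \<in> ?F" "x' \<in> ?F" "x \<noteq> x'" for x x'
      using m(2)[of "dist x x'"] that by (auto simp: D_def)
    then show ?thesis
      using that[of "Min (insert 1 D) / 2"] m(1) by simp
  qed
  define good where "good x O' N \<longleftrightarrow> openin (top_of_set S2) O' \<and> x \<in> O' \<and>
     O' \<subseteq> S2 \<inter> ball x \<delta> \<and> openin (top_of_set S2) N \<and>
     f x \<in> N \<and> (\<forall>y\<in>N - {f x}. card {z \<in> O'. f z = y} = ld x) \<and>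
     (ld x = 1 \<longrightarrow> (\<exists>g. homeomorphism O' N f g))" for x O' N
  have "\<exists>O' N. good x O' N" if x: "x \<in> ?F" for x
  proof -
    have "x \<in> S2" "openin (top_of_set S2) (S2 \<inter> ball x \<delta>)" "x \<in> S2 \<inter> ball x \<delta>"
      using x \<delta>(1) by (auto simp: openin_open)
    from local_model_nbhd[OF ld_model[OF this(1)] this(2,3)] show ?thesis
      unfolding good_def by (elim exE conjE) (intro exI conjI; assumption)
  qed
  then obtain u M where "\<And>x. x \<in> ?F \<Longrightarrow> good x (u x) (M x)"
    by metis
  then have uM: "\<And>x. x \<in> ?F \<Longrightarrow> openin (top_of_set S2) (u x) \<and> x \<in> u x \<and>
     u x \<subseteq> S2 \<inter> ball x \<delta> \<and> openin (top_of_set S2) (M x) \<and>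
     f x \<in> M x \<and> (\<forall>y\<in>M x - {f x}. card {z \<in> u x. f z = y} = ld x) \<and>
     (ld x = 1 \<longrightarrow> (\<exists>g. homeomorphism (u x) (M x) f g))"
    unfolding good_def .
  \<comment> \<open>The values taken outside all \<open>u x\<close>. They form a compact set that
    misses \<open>y\<close>, and over its complement every preimage lies in some
    \<open>u x\<close>.\<close>
  define C where "C = f ` (S2 - (\<Union>x\<in>?F. u x))"
  have "openin (top_of_set S2) (\<Union>x\<in>?F. u x)"
    using uM by blast
  then have "closedin (top_of_set S2) (S2 - (\<Union>x\<in>?F. u x))"
    by (simp add: closedin_diff)
  then have "compact (S2 - (\<Union>x\<in>?F. u x))"
    using closedin_compact compact_S2 by blast
  then have "compact C"
    unfolding C_def by (intro compact_continuous_image continuous_on_subset[OF cont_f]) auto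
  then have oC: "openin (top_of_set S2) (S2 - C)"
    by (metis Diff_Compl Compl_eq_Diff_UNIV compact_imp_closed inf_commute open_Compl
        openin_open_Int Diff_eq)
  have "?F \<noteq> {}"
    using f_onto[OF y] by blast
  define N where "N = (S2 - C) \<inter> (\<Inter>x\<in>?F. M x)"
  have "openin (top_of_set S2) (\<Inter>x\<in>?F. M x)"
    using F \<open>?F \<noteq> {}\<close> uM by (intro openin_INT2) auto
  then have oN: "openin (top_of_set S2) N"
    unfolding N_def using oC by blast
  have yN: "y \<in> N"
  proof -
    have "y \<notin> C"
      unfolding C_def using uM by blast
    then show ?thesis
      using y uM by (auto simp: N_def)
  qed
  have "fibre_chart y u N"
    unfolding fibre_chart_def
  proof (intro conjI ballI impI)
    show "u x \<inter> u x' = {}" if xx': "x \<in> S2" "x' \<in> S2" "f x = y" "f x' = y" "x \<noteq> x'" for x x'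
    proof (rule ccontr)
      assume "u x \<inter> u x' \<noteq> {}"
      moreover have "u x \<subseteq> ball x \<delta>" "u x' \<subseteq> ball x' \<delta>"
        using uM[of x] uM[of x'] xx' by auto
      ultimately obtain z where z: "z \<in> ball x \<delta>" "z \<in> ball x' \<delta>"
        by blast
      have "dist x x' \<le> dist x z + dist x' z"
        by (rule dist_triangle2)
      then have "dist x x' < 2 * \<delta>"
        using z by simp
      moreover have "2 * \<delta> \<le> dist x x'"
        using \<delta>(2)[of x x'] xx' by simp
      ultimately show False
        by simp
    qed
    show "\<exists>x\<in>S2. f x = y \<and> z \<in> u x" if "z \<in> S2" "f z \<in> N" for z
      using that unfolding N_def C_def by blast
    show "card {z \<in> u x. f z = y'} = ld x" if "x \<in> S2" "f x = y" "y' \<in> N - {y}" for x y'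
      using that uM[of x] by (auto simp: N_def)
    show "\<exists>N' g. N \<subseteq> N' \<and> homeomorphism (u x) N' f g" if "x \<in> S2" "f x = y" "ld x = 1" for x
    proof -
      have "N \<subseteq> M x"
        using that by (auto simp: N_def)
      then show ?thesis
        using uM[of x] that by blast
    qed
  qed (use uM oN yN in auto)
  then show ?thesis
    by blast
qed

lemma connected_S2_B: "connected (S2 - B)"
  using connected_S2_minus_finite finB by blast

lemma S2_B_nonempty: "S2 - B - {t} \<noteq> {}"
proof
  assume "S2 - B - {t} = {}"
  then have "finite S2"
    using finB(1) by (metis Diff_insert2 finite.insertI finite_Diff2 finite.emptyI)
  moreover obtain b where "b \<in> B"
    using finB by blast
  ultimately show False
    using openin_S2_infinite[of S2 b] finB by auto
qed

text \<open>Over an evenly covered set the fibre has one point in each slice, so its size is locally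
  constant, and \<open>S2 - B\<close> is connected.\<close>

lemma card_fibre:
  assumes "y \<in> S2 - B"
  shows "card {x \<in> S2. f x = y} = n"
proof -
  define g where "g y = card {x \<in> S2 - A. f x = y}" for y
  have "g constant_on (S2 - B)"
  proof (rule locally_constant_imp_constant[OF connected_S2_B])
    fix a assume "a \<in> S2 - B"
    then obtain T v where T: "a \<in> T" "openin (top_of_set (S2 - B)) T"
        and v: "\<Union>v = (S2 - A) \<inter> f -` T" "pairwise disjnt v" "\<And>u. u \<in> v \<Longrightarrow> \<exists>q. homeomorphism u T f q"
      using cov unfolding covering_space_def by metis
    obtain q where q: "\<And>u. u \<in> v \<Longrightarrow> homeomorphism u T f (q u)"
      using v(3) by metis
    have gv: "g y = card v" if y: "y \<in> T" for y
    proof -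
      have "bij_betw (\<lambda>u. q u y) v {x \<in> S2 - A. f x = y}"
      proof (rule bij_betw_imageI)
        show "inj_on (\<lambda>u. q u y) v"
        proof (rule inj_onI)
          fix u w assume uw: "u \<in> v" "w \<in> v" "q u y = q w y"
          have "q u y \<in> u" "q w y \<in> w"
            using homeomorphism_image2[OF q] uw y by blast+
          then show "u = w"
            using v(2) uw unfolding pairwise_def disjnt_def by (metis IntI empty_iff)
        qed
        show "(\<lambda>u. q u y) ` v = {x \<in> S2 - A. f x = y}"
        proof
          show "(\<lambda>u. q u y) ` v \<subseteq> {x \<in> S2 - A. f x = y}"
          proof
            fix x assume "x \<in> (\<lambda>u. q u y) ` v"
            then obtain u where u: "u \<in> v" "x = q u y"
              by blast
            then have "x \<in> u" "f x = y"
              using homeomorphism_image2[OF q] homeomorphism_apply2[OF q] y by blast+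
            then show "x \<in> {x \<in> S2 - A. f x = y}"
              using v(1) u by blast
          qed
          show "{x \<in> S2 - A. f x = y} \<subseteq> (\<lambda>u. q u y) ` v"
          proof
            fix x assume x: "x \<in> {x \<in> S2 - A. f x = y}"
            then obtain u where u: "u \<in> v" "x \<in> u"
              using v(1) y by blast
            then have "q u y = x"
              using homeomorphism_apply1[OF q] x by auto
            then show "x \<in> (\<lambda>u. q u y) ` v"
              using u by blast
          qed
        qed
      qed
      then show ?thesis
        unfolding g_def by (rule bij_betw_same_card[symmetric])
    qed
    show "\<exists>T. openin (top_of_set (S2 - B)) T \<and> a \<in> T \<and> (\<forall>x\<in>T. g x = g a)"
      using T gv by (intro exI[of _ T]) auto
  qed
  then obtain c where c: "\<And>y. y \<in> S2 - B \<Longrightarrow> g y = c"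
    unfolding constant_on_def by blast
  have gy: "g y = card {x \<in> S2. f x = y}" if "y \<in> S2 - B" for y
    unfolding g_def using that A_iff by (intro arg_cong[of _ _ card]) auto
  have "(SOME y. y \<in> S2 - B) \<in> S2 - B"
    using assms by (rule someI)
  then have "n = c"
    unfolding n_def using gy[of "SOME y. y \<in> S2 - B"] c[of "SOME y. y \<in> S2 - B"] by simp
  then show ?thesis
    using gy[OF assms] c[OF assms] by simp
qed

text \<open>Move \<open>y\<close> to a nearby value outside \<open>B\<close>: its \<open>n\<close>
  preimages are distributed over the sets \<open>u x\<close>, with \<open>ld x\<close> of them in
  each.\<close>

lemma fibre_sum:
  assumes "y \<in> S2"
  shows "(\<Sum>x\<in>{x \<in> S2. f x = y}. ld x) = n"
proof -
  let ?F = "{x \<in> S2. f x = y}"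
  obtain u N where "fibre_chart y u N"
    using fibre_chart_exists[OF assms] by blast
  note u = fibre_chartD[OF this]
  have "\<not> N \<subseteq> insert y B"
    using openin_S2_infinite[OF u(1,2)] finB(1) finite_subset by blast
  then obtain y' where y': "y' \<in> N" "y' \<noteq> y" "y' \<notin> B"
    by blast
  have uS: "u x \<subseteq> S2" if "x \<in> ?F" for x
    using u(3) that openin_imp_subset by blast
  have y'S: "y' \<in> S2"
    using y'(1) u(1) openin_imp_subset by blast
  have eq: "{z \<in> S2. f z = y'} = (\<Union>x\<in>?F. {z \<in> u x. f z = y'})"
    using uS u(5) y'(1) by blast
  have fin: "finite {z \<in> u x. f z = y'}" if "x \<in> ?F" for x
    by (rule finite_subset[OF _ finite_fibre[of y']]) (use uS[OF that] in auto)
  have "n = card (\<Union>x\<in>?F. {z \<in> u x. f z = y'})"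
    using card_fibre[of y'] y' y'S eq by simp
  also have "\<dots> = (\<Sum>x\<in>?F. card {z \<in> u x. f z = y'})"
    using finite_fibre fin u(4) by (intro card_UN_disjoint) blast+
  also have "\<dots> = (\<Sum>x\<in>?F. ld x)"
    using u(6) y' by (intro sum.cong) auto
  finally show ?thesis
    by simp
qed

lemma ld_off_A:
  assumes "x \<in> S2 - A"
  shows "ld x = 1"
proof -
  obtain u w q where u: "x \<in> u" "openin (top_of_set (S2 - A)) u" "homeomorphism u w f q"
    using covering_space_local_homeomorphism[OF cov assms] by metis
  have "openin (top_of_set S2) (S2 - A)"
    using finA by (simp add: finite_imp_closed Diff_eq openin_open_Int open_Compl)
  then have "openin (top_of_set S2) u"
    using u(2) openin_trans by blast
  moreover have "inj_on f u"
    by (rule homeomorphism_imp_inj_on[OF u(3)])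
  ultimately show ?thesis
    using local_degree_inj[OF ld_model] assms u(1) by blast
qed

text \<open>Otherwise \<open>f\<close> restricts to a covering of the simply connected
  \<open>S2 - {t}\<close> by a connected set. Such a covering has a section, which must be inverse
  to \<open>f\<close>, and there is only one sheet. The map \<open>z ^ d\<close>, ramified over two
  values only, shows that one fibre is all that can be excluded.\<close>

lemma critical_point_off_fibre:
  assumes "2 \<le> n" "t \<in> S2"
  shows "\<exists>x\<in>S2. f x \<noteq> t \<and> 2 \<le> ld x"
proof (rule ccontr)
  assume "\<not> ?thesis"
  then have ld1: "ld x = 1" if "x \<in> S2" "f x \<noteq> t" for x
    using ld_model(2)[of x] that by force
  define M where "M = {x \<in> S2. f x \<noteq> t}"
  have MS: "M = S2 - {x \<in> S2. f x = t}"
    by (auto simp: M_def)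
  obtain x0 where "x0 \<in> S2" "f x0 = t"
    using f_onto[OF assms(2)] by blast
  then have conM: "connected M"
    unfolding MS using finite_fibre[of t] by (intro connected_S2_minus_finite[where a = x0]) auto
  have oM: "openin (top_of_set S2) M"
    unfolding MS using finite_imp_closed[OF finite_fibre[of t]]
    by (simp add: Diff_eq openin_open_Int open_Compl)
  have covM: "covering_space M f (S2 - {t})"
  proof
    show "continuous_on M f"
      by (rule continuous_on_subset[OF cont_f]) (auto simp: M_def)
    show "f ` M = S2 - {t}"
    proof
      show "f ` M \<subseteq> S2 - {t}"
        using f_in by (auto simp: M_def)
      show "S2 - {t} \<subseteq> f ` M"
      proof
        fix y assume "y \<in> S2 - {t}"
        then show "y \<in> f ` M"
          using f_onto[of y] by (auto simp: M_def)
      qed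
    qed
    fix y assume y: "y \<in> S2 - {t}"
    then have yS: "y \<in> S2" by blast
    let ?F = "{x \<in> S2. f x = y}"
    obtain u N where "fibre_chart y u N"
      using fibre_chart_exists[OF yS] by blast
    note u = fibre_chartD[OF this]
    define N0 where "N0 = N \<inter> (S2 - {t})"
    have oN0: "openin (top_of_set S2) N0"
      unfolding N0_def using u(1) by (intro openin_Int) (auto simp: Diff_eq openin_open_Int open_Compl)
    define w where "w x = u x \<inter> (S2 \<inter> f -` N0)" for x
    have opw: "openin (top_of_set M) (w x)" if "x \<in> ?F" for x
    proof -
      have "openin (top_of_set S2) (S2 \<inter> f -` N0)"
        using continuous_openin_preimage[OF cont_f _ oN0] f_in by blast
      then have "openin (top_of_set S2) (w x)"
        unfolding w_def using u(3) that by blast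
      moreover have "w x \<subseteq> M"
        by (auto simp: w_def M_def N0_def)
      ultimately show ?thesis
        by (rule openin_subset_trans) (auto simp: M_def)
    qed
    show "\<exists>T. y \<in> T \<and> openin (top_of_set (S2 - {t})) T \<and>
         (\<exists>v. \<Union>v = M \<inter> f -` T \<and> (\<forall>u\<in>v. openin (top_of_set M) u) \<and>
           pairwise disjnt v \<and> (\<forall>u\<in>v. \<exists>q. homeomorphism u T f q))"
    proof (rule exI[of _ N0], intro conjI exI[of _ "w ` ?F"] ballI)
      show "y \<in> N0"
        using y u(2) by (auto simp: N0_def)
      show "openin (top_of_set (S2 - {t})) N0"
        by (rule openin_subset_trans[OF oN0]) (auto simp: N0_def)
      show "\<Union>(w ` ?F) = M \<inter> f -` N0"
      proof
        show "\<Union>(w ` ?F) \<subseteq> M \<inter> f -` N0"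
          by (auto simp: w_def M_def N0_def)
        show "M \<inter> f -` N0 \<subseteq> \<Union>(w ` ?F)"
        proof
          fix z assume z: "z \<in> M \<inter> f -` N0"
          then have "z \<in> S2" "f z \<in> N"
            by (auto simp: M_def N0_def)
          then obtain x where "x \<in> S2" "f x = y" "z \<in> u x"
            using u(5) by blast
          then show "z \<in> \<Union>(w ` ?F)"
            using z by (auto simp: w_def M_def)
        qed
      qed
      show "openin (top_of_set M) v" if "v \<in> w ` ?F" for v
        using that opw by blast
      show "pairwise disjnt (w ` ?F)"
      proof (rule pairwiseI)
        fix a b assume "a \<in> w ` ?F" "b \<in> w ` ?F" "a \<noteq> b"
        then obtain x x' where "x \<in> ?F" "x' \<in> ?F" "x \<noteq> x'" "a = w x" "b = w x'"
          by blast
        then show "disjnt a b"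
          using u(4)[of x x'] by (auto simp: disjnt_def w_def)
      qed
      fix v assume "v \<in> w ` ?F"
      then obtain x where x: "x \<in> S2" "f x = y" "v = w x"
        by blast
      obtain N' g where g: "N \<subseteq> N'" "homeomorphism (u x) N' f g"
        using u(7)[OF x(1,2)] ld1 x y by blast
      have "f ` w x = N0"
      proof
        show "f ` w x \<subseteq> N0"
          by (auto simp: w_def)
        show "N0 \<subseteq> f ` w x"
        proof
          fix z assume z: "z \<in> N0"
          then have "z \<in> N'"
            using g(1) by (auto simp: N0_def)
          then have "g z \<in> u x" "f (g z) = z"
            using homeomorphism_image2[OF g(2)] homeomorphism_apply2[OF g(2)] by auto
          moreover have "u x \<subseteq> S2"
            using u(3)[OF x(1,2)] openin_imp_subset by blast
          ultimately show "z \<in> f ` w x"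
            using z by (intro image_eqI[of _ _ "g z"]) (auto simp: w_def)
        qed
      qed
      then have "homeomorphism v N0 f g"
        unfolding x(3) by (intro homeomorphism_of_subsets[OF g(2) _ empty_subsetI]) (auto simp: w_def)
      then show "\<exists>q. homeomorphism v N0 f q"
        by blast
    qed
  qed
  have hp: "(S2 - {t}) homeomorphic (UNIV :: complex set)"
    by (rule punctured_S2_homeomorphic_plane[OF assms(2)])
  have sc: "simply_connected (S2 - {t})"
    using homeomorphic_simply_connected_eq[OF hp] convex_imp_simply_connected[OF convex_UNIV] by blast
  have lp: "locally path_connected (S2 - {t})"
    using homeomorphic_locally[OF hp, of path_connected path_connected] homeomorphic_path_connectedness
      convex_imp_locally_path_connected[OF convex_UNIV] by metis
  obtain y where y: "y \<in> S2 - B - {t}"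
    using S2_B_nonempty by blast
  have "\<not> card {x \<in> S2. f x = y} \<le> Suc 0"
    using card_fibre[of y] y assms(1) by auto
  then obtain x1 x2 where x: "x1 \<in> S2" "f x1 = y" "x2 \<in> S2" "f x2 = y" "x1 \<noteq> x2"
    unfolding card_le_Suc0_iff_eq[OF finite_fibre[of y]] by auto
  have xM: "x1 \<in> M" "x2 \<in> M"
    using x y by (auto simp: M_def)
  obtain g where g: "continuous_on (S2 - {t}) g" "g \<in> S2 - {t} \<rightarrow> M" "g y = x1"
      "\<And>z. z \<in> S2 - {t} \<Longrightarrow> f (g z) = z"
  proof (rule covering_space_lift_strong[OF covM xM(1), of y "S2 - {t}" "\<lambda>z. z"])
    fix g
    assume "continuous_on (S2 - {t}) g" "g \<in> S2 - {t} \<rightarrow> M" "g y = x1" "\<And>z. z \<in> S2 - {t} \<Longrightarrow> f (g z) = z"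
    then show thesis
      by (rule that)
  qed (use y x sc lp in auto)
  have fM: "continuous_on M f" "f \<in> M \<rightarrow> S2 - {t}"
    using covM covering_space_imp_continuous covering_space_imp_surjective by blast+
  \<comment> \<open>\<open>g \<circ> f\<close> and the identity are lifts of \<open>f\<close>
    through \<open>f\<close> that agree at \<open>x1\<close>, hence on \<open>M\<close>. At
    \<open>x2\<close> this contradicts \<open>g y = x1\<close>.\<close>
  have "(g \<circ> f) x2 = id x2"
  proof (rule covering_space_lift_unique[OF covM, where T = M and f = f and a = x1
        and ?g1.0 = "g \<circ> f" and ?g2.0 = id])
    show "(g \<circ> f) x1 = id x1"
      using g(3) x by simp
    show "continuous_on M (g \<circ> f)"
      using fM g(1) by (intro continuous_on_compose continuous_on_subset[OF g(1)]) auto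
    show "g \<circ> f \<in> M \<rightarrow> M"
      using fM(2) g(2) by auto
    show "f z = f ((g \<circ> f) z)" if "z \<in> M" for z
      using g(4)[OF funcset_mem[OF fM(2) that]] by simp
  qed (use fM conM xM in auto)
  then show False
    using g(3) x by simp
qed

text \<open>Stereographic projection from \<open>a0\<close> above and from \<open>b0\<close> below
  turns the covering into one of punctured planes; this accounts for one puncture on each
  side.\<close>

lemma card_attaching: "n * card B + 2 \<le> card A + 2 * n"
proof -
  obtain b0 where b0: "b0 \<in> B"
    using finB by blast
  obtain a0 where "a0 \<in> S2" "f a0 = b0"
    using b0 finB(2) f_onto[of b0] by auto
  then have a0: "a0 \<in> A"
    using A_iff b0 by simp
  obtain \<alpha> \<alpha>' where \<alpha>: "homeomorphism (S2 - {a0}) (UNIV :: complex set) \<alpha> \<alpha>'"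
    using punctured_S2_homeomorphic_plane a0 finA by (meson homeomorphic_def subsetD)
  obtain \<beta> \<beta>' where \<beta>: "homeomorphism (S2 - {b0}) (UNIV :: complex set) \<beta> \<beta>'"
    using punctured_S2_homeomorphic_plane b0 finB by (meson homeomorphic_def subsetD)
  define Q where "Q = \<alpha> ` (A - {a0})"
  define P where "P = \<beta> ` (B - {b0})"
  have inj\<alpha>: "inj_on \<alpha> (S2 - {a0})" and inj\<beta>: "inj_on \<beta> (S2 - {b0})"
    using homeomorphism_imp_inj_on[OF \<alpha>] homeomorphism_imp_inj_on[OF \<beta>] .
  define k where "k = card P"
  have cP: "card B = k + 1"
  proof -
    have "k = card (B - {b0})"
      unfolding k_def P_def using finB by (intro card_image inj_on_subset[OF inj\<beta>]) auto
    then show ?thesis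
      using b0 finB by (metis Suc_eq_plus1 card_Suc_Diff1)
  qed
  have cQ: "card A = card Q + 1"
  proof -
    have "card Q = card (A - {a0})"
      unfolding Q_def using finA by (intro card_image inj_on_subset[OF inj\<alpha>]) auto
    then show ?thesis
      using a0 finA by (metis Suc_eq_plus1 card_Suc_Diff1)
  qed
  have finP: "finite P"
    using finB by (simp add: P_def)
  obtain e where e: "bij_betw e {1..k} P"
    using finP by (metis k_def ex_bij_betw_nat_finite_1)
  have pw: "pairwise (\<lambda>i j. e i \<noteq> e j \<and> (of_nat i :: complex) \<noteq> of_nat j) {1..k}"
    using bij_betw_imp_inj_on[OF e] by (intro pairwiseI conjI) (auto dest: inj_onD)
  \<comment> \<open>The meridians separate punctures in standard position only, so a homeomorphism
    of the plane first moves \<open>P\<close> onto \<open>1, ..., k\<close>.\<close>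
  obtain \<gamma> \<gamma>' where \<gamma>: "homeomorphism (UNIV :: complex set) (UNIV :: complex set) \<gamma> \<gamma>'"
      "\<And>i. i \<in> {1..k} \<Longrightarrow> \<gamma> (e i) = of_nat i"
  proof (rule homeomorphism_moving_points_exists[of UNIV UNIV "{1..k}" e "of_nat :: nat \<Rightarrow> complex"])
    fix g g' :: "complex \<Rightarrow> complex"
    assume "homeomorphism UNIV UNIV g g'" "\<And>i. i \<in> {1..k} \<Longrightarrow> g (e i) = of_nat i"
    then show thesis
      by (rule that)
  qed (use pw convex_connected[OF convex_UNIV, where 'a = complex] in auto)
  have \<gamma>P: "\<gamma> ` P = of_nat ` {1..k}"
    unfolding bij_betw_imp_surj_on[OF e, symmetric] image_image using \<gamma>(2) by (intro image_cong) auto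
  have h1: "homeomorphism (S2 - A) (- Q) \<alpha> \<alpha>'"
  proof (rule homeomorphism_of_subsets[OF \<alpha> _ empty_subsetI])
    show "\<alpha> ` (S2 - A) = - Q"
    proof -
      have "\<alpha> ` (S2 - A) = \<alpha> ` ((S2 - {a0}) - (A - {a0}))"
        using a0 by (intro arg_cong[of _ _ "(`) \<alpha>"]) auto
      also have "\<dots> = \<alpha> ` (S2 - {a0}) - Q"
        unfolding Q_def using finA by (intro inj_on_image_set_diff[OF inj\<alpha>]) auto
      finally show ?thesis
        using homeomorphism_image1[OF \<alpha>] by auto
    qed
  qed (use a0 in auto)
  have h2: "homeomorphism (S2 - B) (- P) \<beta> \<beta>'"
  proof (rule homeomorphism_of_subsets[OF \<beta> _ empty_subsetI])
    show "\<beta> ` (S2 - B) = - P"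
    proof -
      have "\<beta> ` (S2 - B) = \<beta> ` ((S2 - {b0}) - (B - {b0}))"
        using b0 by (intro arg_cong[of _ _ "(`) \<beta>"]) auto
      also have "\<dots> = \<beta> ` (S2 - {b0}) - P"
        unfolding P_def using finB by (intro inj_on_image_set_diff[OF inj\<beta>]) auto
      finally show ?thesis
        using homeomorphism_image1[OF \<beta>] by auto
    qed
  qed (use b0 in auto)
  have h3: "homeomorphism (- P) (- of_nat ` {1..k}) \<gamma> \<gamma>'"
  proof (rule homeomorphism_of_subsets[OF \<gamma>(1) _ empty_subsetI])
    have "inj \<gamma>" "surj \<gamma>"
      using homeomorphism_imp_inj_on[OF \<gamma>(1)] homeomorphism_image1[OF \<gamma>(1)] .
    then show "\<gamma> ` (- P) = - of_nat ` {1..k}"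
      using \<gamma>P by (metis bij_def bij_image_Compl_eq)
  qed auto
  define q where "q = (\<gamma> \<circ> \<beta>) \<circ> f \<circ> \<alpha>'"
  have h: "homeomorphism (S2 - B) (- of_nat ` {1..k}) (\<gamma> \<circ> \<beta>) (\<beta>' \<circ> \<gamma>')"
    by (rule homeomorphism_compose[OF h2 h3])
  have "plane_covering Q q k n"
  proof
    show "finite Q"
      using finA by (simp add: Q_def)
    show "covering_space (- Q) q (- of_nat ` {1..k})"
      unfolding q_def by (rule covering_space_transfer[OF cov h1 h])
    have S2B: "S2 - B \<noteq> {}"
      using S2_B_nonempty by blast
    then obtain y where y: "y \<in> S2 - B" by blast
    then have "{x \<in> S2. f x = y} \<noteq> {}"
      using f_onto[of y] by blast
    then show "1 \<le> n"
      using card_fibre[OF y] finite_fibre[of y] by (metis One_nat_def Suc_leI card_gt_0_iff)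
    fix y :: complex assume y: "y \<notin> of_nat ` {1..k}"
    define y' where "y' = (\<beta>' \<circ> \<gamma>') y"
    have y': "y' \<in> S2 - B" "(\<gamma> \<circ> \<beta>) y' = y"
      using homeomorphism_image2[OF h] homeomorphism_apply2[OF h] y unfolding y'_def by blast+
    have "{x \<in> - Q. q x = y} = \<alpha> ` {x \<in> S2. f x = y'}"
    proof
      show "{x \<in> - Q. q x = y} \<subseteq> \<alpha> ` {x \<in> S2. f x = y'}"
      proof
        fix z assume z: "z \<in> {x \<in> - Q. q x = y}"
        then have 1: "\<alpha>' z \<in> S2 - A" "\<alpha> (\<alpha>' z) = z"
          using homeomorphism_image2[OF h1] homeomorphism_apply2[OF h1] by blast+
        then have "f (\<alpha>' z) \<in> S2 - B"
          using A_iff f_in by blast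
        moreover have "(\<gamma> \<circ> \<beta>) (f (\<alpha>' z)) = (\<gamma> \<circ> \<beta>) y'"
          using z y' by (simp add: q_def)
        ultimately have "f (\<alpha>' z) = y'"
          using inj_onD[OF homeomorphism_imp_inj_on[OF h]] y'(1) by blast
        then show "z \<in> \<alpha> ` {x \<in> S2. f x = y'}"
          using 1 by (intro image_eqI[of _ _ "\<alpha>' z"]) auto
      qed
      show "\<alpha> ` {x \<in> S2. f x = y'} \<subseteq> {x \<in> - Q. q x = y}"
      proof
        fix z assume "z \<in> \<alpha> ` {x \<in> S2. f x = y'}"
        then obtain x where x: "x \<in> S2" "f x = y'" "z = \<alpha> x"
          by blast
        then have xA: "x \<in> S2 - A"
          using A_iff y' by blast
        then have "\<alpha>' z = x" "z \<in> - Q"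
          using homeomorphism_apply1[OF h1 xA] homeomorphism_image1[OF h1] x by auto
        then show "z \<in> {x \<in> - Q. q x = y}"
          using x y' by (simp add: q_def)
      qed
    qed
    moreover have "inj_on \<alpha> {x \<in> S2. f x = y'}"
      using a0 A_iff y' finA by (intro inj_on_subset[OF inj\<alpha>]) auto
    ultimately show "card {x \<in> - Q. q x = y} = n"
      using card_fibre[OF y'(1)] by (simp add: card_image)
  qed
  then have "n * (k + 1) + 1 \<le> card Q + 2 * n"
    by (rule plane_covering.card_punctures)
  then show ?thesis
    using cP cQ by simp
qed

end

section \<open>Transport to abstract 2-spheres\<close>

locale sphere_map =
  fixes S :: "'a::topological_space set" and T :: "'b::topological_space set"
    and f :: "'a \<Rightarrow> 'b" and A :: "'a set" and B :: "'b set"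
  assumes homS: "S homeomorphic sphere (0::real^3) 1" and homT: "T homeomorphic sphere (0::real^3) 1"
    and bc: "branched_cover S f T" and cov: "covering_space (S - A) f (T - B)"
    and finA: "finite A" "A \<subseteq> S" and finB: "finite B" "B \<subseteq> T" "B \<noteq> {}"
    and AB: "f ` A \<subseteq> B"
begin

lemma f_img: "f ` S = T"
  using bc by (simp add: branched_cover_def)

lemma A_iff: "x \<in> S \<Longrightarrow> x \<in> A \<longleftrightarrow> f x \<in> B"
  using AB covering_space_imp_surjective[OF cov] by blast

lemma ld_model:
  assumes "x \<in> S"
  shows "local_model S f T x (local_degree S f T x)" "1 \<le> local_degree S f T x"
proof -
  obtain d where "d \<ge> 1" "local_model S f T x d"
    using bc assms unfolding branched_cover_def by blast
  then show "local_model S f T x (local_degree S f T x)" "1 \<le> local_degree S f T x"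
    using local_degree_eq[of S f T x d] assms by auto
qed

text \<open>The spheres of a tree live in an arbitrary topological space and are merely homeomorphic
  to the round one. Conjugation by homeomorphisms preserves local models, hence local degrees, and
  covering maps.\<close>

lemma conjugate_S2_cover:
  obtains hS kS hT kT where "homeomorphism S S2 hS kS" "homeomorphism T S2 hT kT"
    "S2_cover (hT \<circ> f \<circ> kS) (hS ` A) (hT ` B)"
    "\<And>x. x \<in> S \<Longrightarrow> local_degree S2 (hT \<circ> f \<circ> kS) S2 (hS x) = local_degree S f T x"
proof -
  obtain hS kS where hS: "homeomorphism S S2 hS kS"
    using homS by (auto simp: homeomorphic_def S2_def)
  obtain hT kT where hT: "homeomorphism T S2 hT kT"
    using homT by (auto simp: homeomorphic_def S2_def)
  define g where "g = hT \<circ> f \<circ> kS"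
  have lm: "local_model S2 g S2 (hS x) d" if "x \<in> S" "local_model S f T x d" for x d
    unfolding g_def by (rule local_model_transfer[OF hS hT that])
  have gh: "g (hS x) = hT (f x)" if "x \<in> S" for x
    using homeomorphism_apply1[OF hS that] by (simp add: g_def)
  have inS: "hS x \<in> S2" if "x \<in> S" for x
    using homeomorphism_image1[OF hS] that by blast
  have ld: "local_degree S2 g S2 (hS x) = local_degree S f T x" if "x \<in> S" for x
    using local_degree_eq[OF lm[OF that ld_model(1)[OF that]] ld_model(2)[OF that] inS[OF that]] .
  have kS: "kS z \<in> S" "hS (kS z) = z" if "z \<in> S2" for z
    using homeomorphism_image2[OF hS] homeomorphism_apply2[OF hS] that by blast+
  have gimg: "g ` S2 = S2"
    unfolding g_def image_comp[symmetric] homeomorphism_image2[OF hS] f_img homeomorphism_image1[OF hT] ..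
  have hA: "homeomorphism (S - A) (S2 - hS ` A) hS kS"
  proof (rule homeomorphism_of_subsets[OF hS _ empty_subsetI])
    show "hS ` (S - A) = S2 - hS ` A"
      using inj_on_image_set_diff[OF homeomorphism_imp_inj_on[OF hS], of S A] finA(2)
        homeomorphism_image1[OF hS] by auto
  qed auto
  have hB: "homeomorphism (T - B) (S2 - hT ` B) hT kT"
  proof (rule homeomorphism_of_subsets[OF hT _ empty_subsetI])
    show "hT ` (T - B) = S2 - hT ` B"
      using inj_on_image_set_diff[OF homeomorphism_imp_inj_on[OF hT], of T B] finB(2)
        homeomorphism_image1[OF hT] by auto
  qed auto
  have "S2_cover g (hS ` A) (hT ` B)"
  proof
    show "branched_cover S2 g S2"
      unfolding branched_cover_def
    proof (intro conjI ballI)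
      have "continuous_on (f ` S) hT"
        unfolding f_img by (rule homeomorphism_cont1[OF hT])
      moreover have "continuous_on (kS ` S2) f"
        unfolding homeomorphism_image2[OF hS] using bc by (simp add: branched_cover_def)
      ultimately show "continuous_on S2 g"
        unfolding g_def using homeomorphism_cont2[OF hS] homeomorphism_image2[OF hS]
        by (metis continuous_on_compose image_comp)
      show "g ` S2 = S2"
        by (rule gimg)
      fix z assume "z \<in> S2"
      then show "\<exists>d\<ge>1. local_model S2 g S2 z d"
        using lm[OF kS(1) ld_model(1)[OF kS(1)], of z] ld_model(2)[OF kS(1)] kS(2) by metis
    qed
    show "covering_space (S2 - hS ` A) g (S2 - hT ` B)"
      unfolding g_def by (rule covering_space_transfer[OF cov hA hB])
    show "finite (hS ` A)" "finite (hT ` B)" "hT ` B \<noteq> {}"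
      using finA finB by auto
    show "hS ` A \<subseteq> S2" "hT ` B \<subseteq> S2"
      using image_mono[OF finA(2), of hS] image_mono[OF finB(2), of hT]
        homeomorphism_image1[OF hS] homeomorphism_image1[OF hT] by auto
    show "g ` hS ` A \<subseteq> hT ` B"
    proof
      fix z assume "z \<in> g ` hS ` A"
      then obtain x where x: "x \<in> A" "z = g (hS x)"
        by blast
      then have "z = hT (f x)"
        using gh finA(2) by blast
      then show "z \<in> hT ` B"
        using AB x by blast
    qed
  qed
  then show ?thesis
    using that[OF hS hT] ld unfolding g_def by blast
qed

lemma local_degree_off_attaching:
  assumes "x \<in> S - A"
  shows "local_degree S f T x = 1"
proof -
  obtain hS kS hT kT where h: "homeomorphism S S2 hS kS" "homeomorphism T S2 hT kT"
    "S2_cover (hT \<circ> f \<circ> kS) (hS ` A) (hT ` B)"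
    "\<And>x. x \<in> S \<Longrightarrow> local_degree S2 (hT \<circ> f \<circ> kS) S2 (hS x) = local_degree S f T x"
    using conjugate_S2_cover by blast
  have "hS x \<notin> hS ` A"
    using inj_onD[OF homeomorphism_imp_inj_on[OF h(1)]] assms finA(2) by blast
  then have "hS x \<in> S2 - hS ` A"
    using homeomorphism_image1[OF h(1)] assms by blast
  then show ?thesis
    using S2_cover.ld_off_A[OF h(3), of "hS x"] h(4)[of x] assms by simp
qed

lemma fibre_conjugate:
  assumes "homeomorphism S S2 hS kS" "homeomorphism T S2 hT kT" "y \<in> T"
  shows "{z \<in> S2. (hT \<circ> f \<circ> kS) z = hT y} = hS ` {x \<in> S. f x = y}"
proof
  show "hS ` {x \<in> S. f x = y} \<subseteq> {z \<in> S2. (hT \<circ> f \<circ> kS) z = hT y}"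
    using homeomorphism_image1[OF assms(1)] homeomorphism_apply1[OF assms(1)] by auto
  show "{z \<in> S2. (hT \<circ> f \<circ> kS) z = hT y} \<subseteq> hS ` {x \<in> S. f x = y}"
  proof
    fix z assume z: "z \<in> {z \<in> S2. (hT \<circ> f \<circ> kS) z = hT y}"
    then have k: "kS z \<in> S" "hS (kS z) = z"
      using homeomorphism_image2[OF assms(1)] homeomorphism_apply2[OF assms(1)] by auto
    have "f (kS z) \<in> T"
      using k f_img by blast
    then have "f (kS z) = y"
      using inj_onD[OF homeomorphism_imp_inj_on[OF assms(2)], of "f (kS z)" y] z assms(3) by simp
    then show "z \<in> hS ` {x \<in> S. f x = y}"
      using k by (intro image_eqI[of _ _ "kS z"]) auto
  qed
qed

text \<open>\<open>map_degree\<close> is evaluated on one chosen fibre; since every fibre sum equals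
  the number of sheets, the choice is harmless, and the facts on the round sphere carry
  over.\<close>

lemma sphere_map_invariants:
  shows "\<And>y. y \<in> T \<Longrightarrow> finite {x \<in> S. f x = y}"
    and "\<And>y. y \<in> T \<Longrightarrow> (\<Sum>x\<in>{x \<in> S. f x = y}. local_degree S f T x) = map_degree S f T"
    and "\<And>t. 2 \<le> map_degree S f T \<Longrightarrow> t \<in> T \<Longrightarrow> \<exists>x\<in>S. f x \<noteq> t \<and> 2 \<le> local_degree S f T x"
    and "map_degree S f T * card B + 2 \<le> card A + 2 * map_degree S f T"
proof -
  obtain hS kS hT kT where h: "homeomorphism S S2 hS kS" "homeomorphism T S2 hT kT"
    "S2_cover (hT \<circ> f \<circ> kS) (hS ` A) (hT ` B)"
    "\<And>x. x \<in> S \<Longrightarrow> local_degree S2 (hT \<circ> f \<circ> kS) S2 (hS x) = local_degree S f T x"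
    using conjugate_S2_cover by blast
  define g where "g = hT \<circ> f \<circ> kS"
  interpret G: S2_cover g "hS ` A" "hT ` B"
    using h(3) by (simp add: g_def)
  have injS: "inj_on hS S" and injT: "inj_on hT T"
    using homeomorphism_imp_inj_on[OF h(1)] homeomorphism_imp_inj_on[OF h(2)] .
  have inT: "hT y \<in> S2" if "y \<in> T" for y
    using homeomorphism_image1[OF h(2)] that by blast
  have injF: "inj_on hS {x \<in> S. f x = y}" for y
    by (rule inj_on_subset[OF injS]) auto
  have fib: "{z \<in> S2. g z = hT y} = hS ` {x \<in> S. f x = y}" if "y \<in> T" for y
    unfolding g_def by (rule fibre_conjugate[OF h(1,2) that])
  show fin: "finite {x \<in> S. f x = y}" if "y \<in> T" for y
    using G.finite_fibre[of "hT y"] fib[OF that] finite_imageD[OF _ injF] by simp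
  have sum_n: "(\<Sum>x\<in>{x \<in> S. f x = y}. local_degree S f T x) = G.n" if y: "y \<in> T" for y
  proof -
    have "G.n = (\<Sum>z\<in>hS ` {x \<in> S. f x = y}. local_degree S2 g S2 z)"
      using G.fibre_sum[OF inT[OF y]] fib[OF y] by simp
    also have "\<dots> = (\<Sum>x\<in>{x \<in> S. f x = y}. local_degree S f T x)"
      unfolding sum.reindex[OF injF] by (intro sum.cong) (auto simp: h(4) g_def[symmetric] h(4)[folded g_def])
    finally show ?thesis ..
  qed
  have "(SOME y. y \<in> T) \<in> T"
    using finB(2,3) by (metis bot.extremum_uniqueI ex_in_conv someI_ex)
  then have md: "map_degree S f T = G.n"
    unfolding map_degree_def Let_def by (rule sum_n)
  show "(\<Sum>x\<in>{x \<in> S. f x = y}. local_degree S f T x) = map_degree S f T" if "y \<in> T" for y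
    using sum_n[OF that] md by simp
  show "\<exists>x\<in>S. f x \<noteq> t \<and> 2 \<le> local_degree S f T x" if t: "2 \<le> map_degree S f T" "t \<in> T" for t
  proof -
    obtain z where z: "z \<in> S2" "g z \<noteq> hT t" "2 \<le> local_degree S2 g S2 z"
      using G.critical_point_off_fibre[of "hT t"] t md inT by auto
    have k: "kS z \<in> S" "hS (kS z) = z"
      using homeomorphism_image2[OF h(1)] homeomorphism_apply2[OF h(1)] z(1) by auto
    have "f (kS z) \<noteq> t"
      using z(2) by (auto simp: g_def)
    moreover have "2 \<le> local_degree S f T (kS z)"
      using h(4)[OF k(1)] z(3) k(2) by (simp add: g_def)
    ultimately show ?thesis
      using k(1) by blast
  qed
  have "card (hS ` A) = card A" "card (hT ` B) = card B"
    using card_image[OF inj_on_subset[OF injS finA(2)]] card_image[OF inj_on_subset[OF injT finB(2)]] .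
  then show "map_degree S f T * card B + 2 \<le> card A + 2 * map_degree S f T"
    using G.card_attaching md by simp
qed

end

section \<open>Branches, leaves and counting in a tree\<close>

section \<open>Trees\<close>

lemma adj_avoid_sym: "(a, b) \<in> adj_avoid E W \<Longrightarrow> (b, a) \<in> adj_avoid E W"
  by (auto simp: adj_avoid_def insert_commute)

lemma adj_avoid_rtrancl_sym: "(a, b) \<in> (adj_avoid E W)\<^sup>* \<Longrightarrow> (b, a) \<in> (adj_avoid E W)\<^sup>*"
  using adj_avoid_sym by (metis (no_types, lifting) converseI rtrancl_converse rtrancl_converseD
      subrelI rtrancl_mono subsetD)

lemma adj_avoid_rtrancl_notin:
  assumes "(a, b) \<in> (adj_avoid E {v})\<^sup>*" "a \<noteq> v"
  shows "b \<noteq> v"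
  using assms by (induction rule: rtrancl_induct) (auto simp: adj_avoid_def)

text \<open>A walk off \<open>a\<close> that starts in a component without \<open>b\<close> never
  meets \<open>b\<close>. Inclusion and disjointness of branches at different vertices rest on this
  exchange of the forbidden vertex.\<close>

lemma avoid_switch:
  assumes "(c, x) \<in> (adj_avoid E {a})\<^sup>*" "(c, b) \<notin> (adj_avoid E {a})\<^sup>*"
  shows "(c, x) \<in> (adj_avoid E {b})\<^sup>*"
  using assms(1)
proof (induction rule: rtrancl_induct)
  case (step y z)
  have "y \<noteq> b" "z \<noteq> b"
    using assms(2) step.hyps by (metis, metis rtrancl.rtrancl_into_rtrancl)
  then have "(y, z) \<in> adj_avoid E {b}"
    using step.hyps(2) by (auto simp: adj_avoid_def)
  then show ?case
    using step.IH by (rule rtrancl_into_rtrancl[rotated])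
qed simp

locale tree =
  fixes V :: "'v set" and E :: "'v set set"
  assumes tree: "is_tree V E"
begin

lemma finV: "finite V" and edgeV: "e \<in> E \<Longrightarrow> e \<subseteq> V" and edge2: "e \<in> E \<Longrightarrow> card e = 2"
  using tree by (auto simp: is_tree_def is_graph_def)

lemma finE: "finite E"
  using finV edgeV by (meson PowI finite_Pow_iff finite_subset subsetI)

lemma edge_neq: "{a, b} \<in> E \<Longrightarrow> a \<noteq> b"
  using edge2 by fastforce

lemma fin_edges_at: "finite (edges_at E v)"
  using finE by (simp add: edges_at_def)

lemma edge_other:
  assumes "e \<in> edges_at E v"
  obtains u where "e = {v, u}" "u \<noteq> v" "{v, u} \<in> E" "u \<in> V" "v \<in> V"
proof -
  have e: "e \<in> E" "v \<in> e" "card e = 2"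
    using assms edge2 by (auto simp: edges_at_def)
  then obtain a b where "e = {a, b}" "a \<noteq> b"
    by (meson card_2_iff)
  then show ?thesis
    using that e edgeV[OF e(1)] by (cases "v = a") (auto simp: insert_commute)
qed

lemma edges_at_iff: "{v, u} \<in> edges_at E v \<longleftrightarrow> {v, u} \<in> E" "{u, v} \<in> edges_at E v \<longleftrightarrow> {u, v} \<in> E"
  by (auto simp: edges_at_def)

lemma branch_edge: "{v, u} \<in> E \<Longrightarrow> branch E v {v, u} = {w. (u, w) \<in> (adj_avoid E {v})\<^sup>*}"
  using edge_neq by (auto simp: branch_def)

lemma branch_step:
  assumes "x \<in> branch E v e" "(x, z) \<in> (adj_avoid E {v})\<^sup>*"
  shows "z \<in> branch E v e"
  using assms unfolding branch_def by (auto intro: rtrancl_trans)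

lemma branch_notin: "v \<notin> branch E v e"
  unfolding branch_def by (auto dest: adj_avoid_rtrancl_notin)

lemma branch_V:
  assumes "e \<in> E"
  shows "branch E v e \<subseteq> V"
proof
  fix w assume "w \<in> branch E v e"
  then obtain u where u: "u \<in> e" "(u, w) \<in> (adj_avoid E {v})\<^sup>*"
    by (auto simp: branch_def)
  from u(2) show "w \<in> V"
  proof (induction rule: rtrancl_induct)
    case base
    then show ?case using u edgeV assms by blast
  next
    case (step y z)
    then show ?case using edgeV by (auto simp: adj_avoid_def)
  qed
qed

lemma finite_branch: "e \<in> E \<Longrightarrow> finite (branch E v e)"
  using branch_V finV finite_subset by blast

text \<open>A shortest path between two neighbours of \<open>v\<close> in the complement of \<open>v\<close> closes up to a cycle
  through \<open>v\<close>.\<close>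

lemma branch_disjoint:
  assumes e: "e \<in> edges_at E v" "e' \<in> edges_at E v" and x: "x \<in> branch E v e" "x \<in> branch E v e'"
  shows "e = e'"
proof (rule ccontr)
  assume ne: "e \<noteq> e'"
  obtain a where a: "e = {v, a}" "a \<noteq> v" "{v, a} \<in> E" "a \<in> V" "v \<in> V"
    using edge_other[OF e(1)] by metis
  obtain b where b: "e' = {v, b}" "b \<noteq> v" "{v, b} \<in> E" "b \<in> V"
    using edge_other[OF e(2)] by metis
  have "(a, b) \<in> (adj_avoid E {v})\<^sup>*"
    using x a b branch_edge by (metis adj_avoid_rtrancl_sym mem_Collect_eq rtrancl_trans)
  then have "\<exists>s. (a, b) \<in> adj_avoid E {v} ^^ s"
    by (simp add: rtrancl_power)
  then have "\<exists>s. (a, b) \<in> adj_avoid E {v} ^^ s \<and> (\<forall>t<s. (a, b) \<notin> adj_avoid E {v} ^^ t)"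
    by (subst (asm) exists_least_iff)
  then obtain s where s: "(a, b) \<in> adj_avoid E {v} ^^ s"
      and mn: "\<And>t. t < s \<Longrightarrow> (a, b) \<notin> adj_avoid E {v} ^^ t"
    by blast
  obtain p where p: "p 0 = a" "p s = b" "\<And>i. i < s \<Longrightarrow> (p i, p (Suc i)) \<in> adj_avoid E {v}"
    using s by (auto simp: relpow_fun_conv)
  have inj: "inj_on p {..s}"
  proof (rule linorder_inj_onI)
    fix i j assume ij: "i < j" "i \<in> {..s}" "j \<in> {..s}"
    show "p i \<noteq> p j"
    proof
      assume eq: "p i = p j"
      \<comment> \<open>If \<open>p\<close> took the same value at times \<open>i\<close> and
        \<open>j\<close>, cutting out the loop between them would give a shorter path, against the
        choice of \<open>s\<close>.\<close>
      define q where "q k = (if k \<le> i then p k else p (k + (j - i)))" for k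
      have "q 0 = a"
        using p by (simp add: q_def)
      moreover have "q (s - (j - i)) = b"
        using p(2) ij eq by (cases "j = s") (auto simp: q_def)
      moreover have "(q k, q (Suc k)) \<in> adj_avoid E {v}" if "k < s - (j - i)" for k
      proof -
        consider "Suc k \<le> i" | "k = i" | "i < k" by linarith
        then show ?thesis
        proof cases
          case 1
          then show ?thesis using p(3)[of k] ij by (simp add: q_def)
        next
          case 2
          then show ?thesis using p(3)[of j] ij eq that by (simp add: q_def)
        next
          case 3
          then show ?thesis using p(3)[of "k + (j - i)"] that by (simp add: q_def)
        qed
      qed
      ultimately have "(a, b) \<in> adj_avoid E {v} ^^ (s - (j - i))"
        unfolding relpow_fun_conv by blast
      moreover have "s - (j - i) < s"
        using ij by auto
      ultimately show False
        using mn by blast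
    qed
  qed (auto)
  have s1: "1 \<le> s"
    using p ne a b by (cases s) auto
  have pv: "p i \<noteq> v \<and> p i \<in> V" if "i \<le> s" for i
  proof (cases "i < s")
    case True
    then show ?thesis
      using p(3)[of i] edgeV[of "{p i, p (Suc i)}"] by (auto simp: adj_avoid_def)
  next
    case False
    then show ?thesis
      using that p b by simp
  qed
  define cs where "cs = v # map p [0..<Suc s]"
  have len: "length cs = s + 2"
    by (simp add: cs_def)
  have st: "set (map p [0..<Suc s]) = p ` {..s}"
    by (simp add: atLeast0LessThan lessThan_Suc_atMost del: upt_Suc)
  have "distinct (map p [0..<Suc s])"
    using inj by (simp add: distinct_map atLeast0LessThan lessThan_Suc_atMost del: upt_Suc)
  moreover have "v \<notin> p ` {..s}"
    using pv by auto
  ultimately have "distinct cs"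
    unfolding cs_def distinct.simps(2) st by blast
  moreover have "set cs \<subseteq> V"
    unfolding cs_def list.set(2) st using pv a(5) by auto
  moreover have "{cs ! k, cs ! (Suc k mod length cs)} \<in> E" if k: "k < length cs" for k
  proof -
    have nthS: "cs ! Suc i = p i" if "i \<le> s" for i
      using that by (simp add: cs_def nth_map del: upt_Suc)
    have nth0: "cs ! 0 = v"
      by (simp add: cs_def)
    consider "k = 0" | i where "k = Suc i" "i < s" | "k = Suc s"
      using k len by (cases k) (auto simp: less_Suc_eq)
    then show ?thesis
    proof cases
      case 1
      then show ?thesis
        using nthS[of 0] nth0 p(1) a(3) len by simp
    next
      case (2 i)
      then show ?thesis
        using nthS[of i] nthS[of "Suc i"] p(3)[of i] len by (simp add: adj_avoid_def)
    next
      case 3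
      then show ?thesis
        using nthS[of s] nth0 p(2) b(3) len by (simp add: insert_commute)
    qed
  qed
  ultimately have "has_cycle V E"
    unfolding has_cycle_def using len s1 by (intro exI[of _ cs]) auto
  then show False
    using tree by (simp add: is_tree_def)
qed

lemma in_some_branch:
  assumes "v \<in> V" "x \<in> V" "x \<noteq> v"
  obtains e where "e \<in> edges_at E v" "x \<in> branch E v e"
proof -
  have "(v, x) \<in> (adj_avoid E {})\<^sup>*"
    using tree assms by (auto simp: is_tree_def connected_graph_def)
  then have "x = v \<or> (\<exists>e\<in>edges_at E v. x \<in> branch E v e)"
  proof (induction rule: rtrancl_induct)
    case (step y z)
    have yz: "{y, z} \<in> E"
      using step.hyps(2) by (simp add: adj_avoid_def)
    show ?case
    proof (cases "z = v")
      case False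
      show ?thesis
      proof (cases "y = v")
        case True
        then have "{v, z} \<in> edges_at E v" "z \<in> branch E v {v, z}"
          using yz branch_edge edges_at_iff by auto
        then show ?thesis
          by (intro disjI2 bexI[of _ "{v, z}"])
      next
        case F: False
        then obtain e where e: "e \<in> edges_at E v" "y \<in> branch E v e"
          using step.IH by blast
        have "(y, z) \<in> adj_avoid E {v}"
          using F False yz by (simp add: adj_avoid_def)
        then show ?thesis
          using e branch_step by blast
      qed
    qed simp
  qed simp
  then show ?thesis
    using assms that by blast
qed

text \<open>Seen from \<open>v'\<close>, the vertex \<open>v\<close> lies in the branch of the
  common edge, so any other branch at \<open>v'\<close> avoids \<open>v\<close> and is joined to
  \<open>v'\<close> off \<open>v\<close>.\<close>

lemma branch_sub:
  assumes e: "{v, v'} \<in> E" and e': "e' \<in> edges_at E v'" "e' \<noteq> {v, v'}"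
  shows "branch E v' e' \<subseteq> branch E v {v, v'}"
proof
  fix x assume x: "x \<in> branch E v' e'"
  obtain c where c: "e' = {v', c}" "c \<noteq> v'" "{v', c} \<in> E"
    using edge_other[OF e'(1)] by metis
  have cv: "c \<noteq> v"
    using c e' by (auto simp: insert_commute)
  have "v \<in> branch E v' {v, v'}"
    using e edge_neq[OF e] by (auto simp: branch_def)
  moreover have "{v, v'} \<in> edges_at E v'"
    using e by (simp add: edges_at_def)
  ultimately have "v \<notin> branch E v' e'"
    using branch_disjoint e' by metis
  then have "(c, v) \<notin> (adj_avoid E {v'})\<^sup>*"
    using branch_edge[OF c(3)] c(1) by simp
  moreover have "(c, x) \<in> (adj_avoid E {v'})\<^sup>*"
    using x branch_edge[OF c(3)] c(1) by simp
  ultimately have "(c, x) \<in> (adj_avoid E {v})\<^sup>*"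
    by (rule avoid_switch[rotated])
  moreover have "(v', c) \<in> adj_avoid E {v}"
    using c cv edge_neq[OF e] by (auto simp: adj_avoid_def)
  ultimately show "x \<in> branch E v {v, v'}"
    using branch_edge[OF e] by (auto intro: converse_rtrancl_into_rtrancl)
qed

text \<open>The larger branch contains \<open>v'\<close>, the smaller one does not. The size of a
  branch is the measure for inductions that walk outwards along the tree.\<close>

lemma branch_psub:
  assumes e: "{v, v'} \<in> E" and e': "e' \<in> edges_at E v'" "e' \<noteq> {v, v'}"
  shows "card (branch E v' e') < card (branch E v {v, v'})"
proof (rule psubset_card_mono)
  show "finite (branch E v {v, v'})"
    using finite_branch e by blast
  have "v' \<in> branch E v {v, v'}"
    using branch_edge[OF e] by simp
  then show "branch E v' e' \<subset> branch E v {v, v'}"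
    using branch_sub[OF assms] branch_notin[of v' e'] by blast
qed

text \<open>A walk from \<open>v'\<close> that avoids \<open>v\<close> can leave \<open>v'\<close>
  only through other edges, hence into other branches at \<open>v'\<close>.\<close>

lemma branch_both_ends:
  assumes e: "{v, v'} \<in> E"
  shows "branch E v {v, v'} \<inter> branch E v' {v, v'} = {}"
proof (rule ccontr)
  assume "branch E v {v, v'} \<inter> branch E v' {v, v'} \<noteq> {}"
  then obtain x where x: "x \<in> branch E v {v, v'}" "x \<in> branch E v' {v, v'}"
    by blast
  have "(v', x) \<in> (adj_avoid E {v})\<^sup>*"
    using x(1) branch_edge[OF e] by simp
  then have "x = v' \<or> (\<exists>e'\<in>edges_at E v'. e' \<noteq> {v, v'} \<and> x \<in> branch E v' e')"
  proof (induction rule: rtrancl_induct)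
    case (step y z)
    have yz: "{y, z} \<in> E" "y \<noteq> v" "z \<noteq> v"
      using step.hyps(2) by (auto simp: adj_avoid_def)
    show ?case
    proof (cases "z = v'")
      case False
      show ?thesis
      proof (cases "y = v'")
        case True
        then have "{v', z} \<in> edges_at E v'" "z \<in> branch E v' {v', z}" "{v', z} \<noteq> {v, v'}"
          using yz branch_edge edges_at_iff edge_neq[OF e] by (auto simp: doubleton_eq_iff)
        then show ?thesis
          by (intro disjI2 bexI[of _ "{v', z}"] conjI)
      next
        case F: False
        then obtain e' where e': "e' \<in> edges_at E v'" "e' \<noteq> {v, v'}" "y \<in> branch E v' e'"
          using step.IH by blast
        have "(y, z) \<in> adj_avoid E {v'}"
          using F False yz by (simp add: adj_avoid_def)
        then have "z \<in> branch E v' e'"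
          using branch_step[OF e'(3)] by blast
        then show ?thesis
          using e'(1,2) by (intro disjI2 bexI[of _ e'] conjI)
      qed
    qed simp
  qed simp
  then show False
  proof
    assume "x = v'"
    then show False
      using x(2) branch_notin by blast
  next
    assume "\<exists>e'\<in>edges_at E v'. e' \<noteq> {v, v'} \<and> x \<in> branch E v' e'"
    then obtain e' where e': "e' \<in> edges_at E v'" "e' \<noteq> {v, v'}" "x \<in> branch E v' e'"
      by blast
    have "{v, v'} \<in> edges_at E v'"
      using e by (simp add: edges_at_def)
    then show False
      using branch_disjoint[OF e'(1) _ e'(3) x(2)] e'(2) by blast
  qed
qed

text \<open>From a common vertex one could return to \<open>w\<close> inside the branch at
  \<open>w\<close>, which avoids \<open>w'\<close>; so \<open>w\<close> would lie in the branch at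
  \<open>w'\<close>.\<close>

lemma distinct_branches_disjoint:
  assumes "w \<noteq> w'" "e \<in> edges_at E w" "e' \<in> edges_at E w'"
    and "w' \<notin> branch E w e" "w \<notin> branch E w' e'"
  shows "branch E w e \<inter> branch E w' e' = {}"
proof (rule ccontr)
  assume "branch E w e \<inter> branch E w' e' \<noteq> {}"
  then obtain x where x: "x \<in> branch E w e" "x \<in> branch E w' e'"
    by blast
  obtain c where c: "e = {w, c}" "c \<noteq> w" "{w, c} \<in> E"
    using edge_other[OF assms(2)] by metis
  have "(c, w') \<notin> (adj_avoid E {w})\<^sup>*" "(c, x) \<in> (adj_avoid E {w})\<^sup>*"
    using assms(4) x(1) branch_edge[OF c(3)] c(1) by auto
  then have "(c, x) \<in> (adj_avoid E {w'})\<^sup>*"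
    using avoid_switch by metis
  moreover have "c \<noteq> w'"
    using \<open>(c, w') \<notin> (adj_avoid E {w})\<^sup>*\<close> by auto
  then have "(w, c) \<in> adj_avoid E {w'}"
    using assms(1) c by (simp add: adj_avoid_def)
  ultimately have "(x, w) \<in> (adj_avoid E {w'})\<^sup>*"
    by (meson adj_avoid_rtrancl_sym converse_rtrancl_into_rtrancl)
  then show False
    using branch_step[OF x(2)] assms(5) by blast
qed

lemma branch_has_leaf:
  assumes "e \<in> edges_at E v"
  shows "\<exists>x. x \<in> leaves V E \<and> x \<in> branch E v e"
  using assms
proof (induction "card (branch E v e)" arbitrary: v e rule: less_induct)
  case less
  obtain u where u: "e = {v, u}" "{v, u} \<in> E" "u \<in> V"
    using edge_other[OF less.prems] by metis
  have ub: "u \<in> branch E v e"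
    using branch_edge[OF u(2)] u(1) by simp
  show ?case
  proof (cases "u \<in> leaves V E")
    case True
    then show ?thesis using ub by blast
  next
    case False
    then have "val E u \<noteq> 1"
      using u by (simp add: leaves_def)
    moreover have eu: "e \<in> edges_at E u"
      using u by (simp add: edges_at_def)
    ultimately have "edges_at E u \<noteq> {e}"
      by (auto simp: val_def)
    then obtain e' where e': "e' \<in> edges_at E u" "e' \<noteq> {v, u}"
      using eu u(1) by blast
    obtain x where "x \<in> leaves V E" "x \<in> branch E u e'"
      using less.hyps[of u e'] branch_psub[OF u(2) e'] e' u(1) by blast
    then show ?thesis
      using branch_sub[OF u(2) e'] u(1) by blast
  qed
qed

text \<open>With \<open>r\<close> as root, every other vertex owns its edge towards
  \<open>r\<close>. Each edge is owned exactly once, because \<open>r\<close> lies on exactly one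
  side of it.\<close>

lemma card_edges:
  assumes "r \<in> V"
  shows "card E + 1 = card V"
proof -
  define par where "par v = (THE e. e \<in> edges_at E v \<and> r \<in> branch E v e)" for v
  have par_eq: "par v = e" if "e \<in> edges_at E v" "r \<in> branch E v e" for v e
    unfolding par_def by (rule the_equality) (use that branch_disjoint in blast)+
  have par: "par v \<in> edges_at E v \<and> r \<in> branch E v (par v)" if v: "v \<in> V - {r}" for v
  proof -
    obtain e where "e \<in> edges_at E v" "r \<in> branch E v e"
      using in_some_branch[of v r] v assms by auto
    then show ?thesis
      using par_eq by metis
  qed
  have "bij_betw par (V - {r}) E"
  proof (rule bij_betw_imageI)
    show "inj_on par (V - {r})"
    proof (rule inj_onI, rule ccontr)
      fix v v' assume v: "v \<in> V - {r}" "v' \<in> V - {r}" "par v = par v'" "v \<noteq> v'"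
      obtain u where u: "par v = {v, u}" "{v, u} \<in> E"
        using edge_other[of "par v" v] par[OF v(1)] by metis
      have "v' \<in> par v"
        using par[OF v(2)] v(3) by (simp add: edges_at_def)
      then have "par v = {v, v'}"
        using u v(4) by auto
      then show False
        using branch_both_ends[of v v'] par[OF v(1)] par[OF v(2)] v(3) by (auto simp: edges_at_def)
    qed
    show "par ` (V - {r}) = E"
    proof
      show "par ` (V - {r}) \<subseteq> E"
        using par by (auto simp: edges_at_def)
      show "E \<subseteq> par ` (V - {r})"
      proof
        fix e assume e: "e \<in> E"
        obtain a b where ab: "e = {a, b}" "a \<noteq> b"
          using edge2[OF e] by (meson card_2_iff)
        have abV: "a \<in> V" "b \<in> V"
          using edgeV[OF e] ab by auto
        have ea: "e \<in> edges_at E a" "e \<in> edges_at E b"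
          using e ab by (auto simp: edges_at_def)
        show "e \<in> par ` (V - {r})"
        proof (cases "r = a")
          case True
          then have "r \<in> branch E b e"
            using ab by (auto simp: branch_def)
          then have "par b = e"
            using par_eq ea by blast
          then show ?thesis
            using abV ab True by blast
        next
          case False
          then obtain e1 where e1: "e1 \<in> edges_at E a" "r \<in> branch E a e1"
            using in_some_branch[of a r] abV assms by metis
          show ?thesis
          proof (cases "e1 = e")
            case True
            then have "par a = e"
              using par_eq e1 by blast
            then show ?thesis
              using abV False by blast
          next
            case F: False
            have "{b, a} \<in> E" "e1 \<noteq> {b, a}"
              using e ab F by (auto simp: insert_commute)
            then have rb: "r \<in> branch E b e"
              using branch_sub[of b a e1] e1 ab by (auto simp: insert_commute)
            then have "par b = e" "r \<noteq> b"
              using par_eq ea branch_notin by auto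
            then show ?thesis
              using abV by blast
          qed
        qed
      qed
    qed
  qed
  then have "card E = card (V - {r})"
    by (metis bij_betw_same_card)
  then show ?thesis
    using assms finV by (metis Suc_eq_plus1 card_Suc_Diff1)
qed

text \<open>Two adjacent leaves would be the entire tree, since any further vertex would lie on both
  sides of their edge; three leaves exclude this.\<close>

lemma leaf_edge:
  assumes "y \<in> leaves V E" "3 \<le> card (leaves V E)"
  obtains u where "edges_at E y = {{y, u}}" "u \<noteq> y" "{y, u} \<in> E" "u \<in> internal V E"
proof -
  have "card (edges_at E y) = 1" "y \<in> V"
    using assms by (auto simp: leaves_def val_def)
  then obtain e where e: "edges_at E y = {e}"
    by (meson card_1_singletonE)
  then obtain u where u: "e = {y, u}" "u \<noteq> y" "{y, u} \<in> E" "u \<in> V"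
    using edge_other[of e y] by (metis insertI1)
  have "u \<notin> leaves V E"
  proof
    assume "u \<in> leaves V E"
    then have "card (edges_at E u) = 1"
      by (simp add: leaves_def val_def)
    moreover have "e \<in> edges_at E u"
      using u by (simp add: edges_at_def)
    ultimately have eu: "edges_at E u = {e}"
      by (metis card_1_singletonE singletonD)
    have "V \<subseteq> {y, u}"
    proof
      fix x assume x: "x \<in> V"
      show "x \<in> {y, u}"
      proof (rule ccontr)
        assume n: "x \<notin> {y, u}"
        obtain e1 where "e1 \<in> edges_at E y" "x \<in> branch E y e1"
          using in_some_branch[OF \<open>y \<in> V\<close> x] n by auto
        moreover obtain e2 where "e2 \<in> edges_at E u" "x \<in> branch E u e2"
          using in_some_branch[OF u(4) x] n by auto
        ultimately have "x \<in> branch E y e" "x \<in> branch E u e"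
          using e eu by auto
        then show False
          using branch_both_ends[OF u(3)] u(1) by blast
      qed
    qed
    then have "card (leaves V E) \<le> card {y, u}"
      by (intro card_mono) (auto simp: leaves_def)
    then show False
      using assms(2) u(2) by simp
  qed
  then show ?thesis
    using that[of u] e u by (auto simp: internal_def)
qed

lemma amap_eq:
  assumes "tE T = E" "e \<in> edges_at E v" "x \<in> branch E v e"
  shows "amap T v x = ti T v e"
proof -
  have "(THE e. e \<in> edges_at E v \<and> x \<in> branch E v e) = e"
    by (rule the_equality) (use assms branch_disjoint in blast)+
  then show ?thesis
    using assms(1) by (simp add: amap_def)
qed

lemma sum_val: "(\<Sum>v\<in>V. val E v) = 2 * card E"
proof -
  have "(\<Sum>v\<in>V. val E v) = (\<Sum>v\<in>V. \<Sum>e\<in>{e \<in> E. v \<in> e}. 1)"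
    by (simp add: val_def edges_at_def)
  also have "\<dots> = (\<Sum>e\<in>E. \<Sum>v\<in>{v \<in> V. v \<in> e}. 1)"
    by (rule sum.swap_restrict[OF finV finE])
  also have "\<dots> = (\<Sum>e\<in>E. 2)"
  proof (rule sum.cong[OF refl])
    fix e assume e: "e \<in> E"
    have "{v \<in> V. v \<in> e} = e"
      using edgeV[OF e] by blast
    then show "(\<Sum>v\<in>{v \<in> V. v \<in> e}. 1) = (2::nat)"
      using edge2[OF e] by simp
  qed
  finally show ?thesis
    by simp
qed

text \<open>Over all vertices \<open>val - 2\<close> adds up to
  \<open>2 card E - 2 card V = - 2\<close>, and each leaf contributes \<open>- 1\<close>.\<close>

lemma sum_internal_val:
  assumes "r \<in> V"
  shows "(\<Sum>v\<in>internal V E. int (val E v) - 2) = int (card (leaves V E)) - 2"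
proof -
  have sub: "leaves V E \<subseteq> V" "finite (leaves V E)"
    using finV by (auto simp: leaves_def intro: finite_subset[of _ V])
  have "(\<Sum>v\<in>V. int (val E v) - 2) = int (\<Sum>v\<in>V. val E v) - 2 * int (card V)"
    by (simp add: sum_subtractf)
  also have "\<dots> = - 2"
    using sum_val card_edges[OF assms] by simp
  finally have tot: "(\<Sum>v\<in>V. int (val E v) - 2) = - 2" .
  have "(\<Sum>v\<in>leaves V E. int (val E v) - 2) = (\<Sum>v\<in>leaves V E. - 1)"
    by (rule sum.cong) (auto simp: leaves_def)
  then have "(\<Sum>v\<in>leaves V E. int (val E v) - 2) = - int (card (leaves V E))"
    by simp
  then show ?thesis
    using tot sum.subset_diff[OF sub(1) finV, of "\<lambda>v. int (val E v) - 2"]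
    by (simp add: internal_def)
qed

end

section \<open>Degrees of vertices and edges, and the number of critical leaves\<close>

section \<open>Covers between trees of spheres\<close>

locale spheres_cover =
  fixes TY TZ :: "('v, 'a::topological_space) tos" and F :: "'v \<Rightarrow> 'v" and f :: "'v \<Rightarrow> 'a \<Rightarrow> 'a"
  assumes cover: "is_cover TY TZ F f"
    and stZ: "stable (tV TZ) (tE TZ)"
begin

sublocale Y: tree "tV TY" "tE TY"
  using cover by unfold_locales (simp add: is_cover_def tree_of_spheres_def)

sublocale Z: tree "tV TZ" "tE TZ"
  using cover by unfold_locales (simp add: is_cover_def tree_of_spheres_def)

abbreviation EY :: "'v \<Rightarrow> 'v set set" where "EY \<equiv> edges_at (tE TY)"
abbreviation EZ :: "'v \<Rightarrow> 'v set set" where "EZ \<equiv> edges_at (tE TZ)"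
abbreviation BY :: "'v \<Rightarrow> 'v set \<Rightarrow> 'v set" where "BY \<equiv> branch (tE TY)"
abbreviation BZ :: "'v \<Rightarrow> 'v set \<Rightarrow> 'v set" where "BZ \<equiv> branch (tE TZ)"
abbreviation mdeg :: "'v \<Rightarrow> nat" where "mdeg v \<equiv> map_degree (tS TY v) (f v) (tS TZ (F v))"
abbreviation ldeg :: "'v \<Rightarrow> 'a \<Rightarrow> nat" where "ldeg v \<equiv> local_degree (tS TY v) (f v) (tS TZ (F v))"
abbreviation ndeg :: "'v \<Rightarrow> nat" where "ndeg \<equiv> vdeg TY TZ F f"

lemma toY: "tree_of_spheres TY" and toZ: "tree_of_spheres TZ"
  using cover by (auto simp: is_cover_def)

lemma FE: "e \<in> tE TY \<Longrightarrow> F ` e \<in> tE TZ"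
  using cover by (auto simp: is_cover_def)

lemma F_leaf: "v \<in> LV TY \<Longrightarrow> F v \<in> LV TZ" and F_int: "v \<in> IV TY \<Longrightarrow> F v \<in> IV TZ"
  using cover by (auto simp: is_cover_def)

lemma IV_V: "v \<in> IV TY \<Longrightarrow> v \<in> tV TY" "v \<in> LV TY \<Longrightarrow> v \<in> tV TY"
  "v \<in> IV TY \<Longrightarrow> v \<notin> LV TY" "v \<in> tV TY \<Longrightarrow> v \<notin> LV TY \<Longrightarrow> v \<in> IV TY"
  by (auto simp: IV_def LV_def internal_def leaves_def)

lemma IVZ_V: "v \<in> IV TZ \<Longrightarrow> v \<in> tV TZ" "v \<in> LV TZ \<Longrightarrow> v \<in> tV TZ"
  "v \<in> IV TZ \<Longrightarrow> v \<notin> LV TZ" "v \<in> tV TZ \<Longrightarrow> v \<notin> LV TZ \<Longrightarrow> v \<in> IV TZ"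
  by (auto simp: IV_def LV_def internal_def leaves_def)

lemma F_EZ: "e \<in> EY v \<Longrightarrow> F ` e \<in> EZ (F v)"
  using FE by (auto simp: edges_at_def)

lemma ti_inj: "v \<in> IV TY \<Longrightarrow> inj_on (ti TY v) (EY v)" and tiZ_inj: "w \<in> IV TZ \<Longrightarrow> inj_on (ti TZ w) (EZ w)"
  and ti_S: "v \<in> IV TY \<Longrightarrow> e \<in> EY v \<Longrightarrow> ti TY v e \<in> tS TY v"
  and tiZ_S: "w \<in> IV TZ \<Longrightarrow> e \<in> EZ w \<Longrightarrow> ti TZ w e \<in> tS TZ w"
  using toY toZ by (auto simp: tree_of_spheres_def image_subset_iff)

lemma f_ti: "v \<in> IV TY \<Longrightarrow> e \<in> EY v \<Longrightarrow> f v (ti TY v e) = ti TZ (F v) (F ` e)"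
  using cover by (auto simp: is_cover_def)

lemma valZ: "w \<in> IV TZ \<Longrightarrow> 3 \<le> card (EZ w)"
  using stZ by (auto simp: stable_def IV_def val_def)

lemma card_attachY: "v \<in> IV TY \<Longrightarrow> card (attach TY v) = val (tE TY) v"
  and card_attachZ: "w \<in> IV TZ \<Longrightarrow> card (attach TZ w) = val (tE TZ) w"
  unfolding attach_def val_def using ti_inj tiZ_inj by (simp_all add: card_image)

lemma sphere_map:
  assumes v: "v \<in> IV TY"
  shows "sphere_map (tS TY v) (tS TZ (F v)) (f v) (attach TY v) (attach TZ (F v))"
proof
  have w: "F v \<in> IV TZ"
    using F_int v .
  show "tS TY v homeomorphic sphere (0::real^3) 1" "tS TZ (F v) homeomorphic sphere (0::real^3) 1"
    using toY toZ v w by (auto simp: tree_of_spheres_def)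
  show "branched_cover (tS TY v) (f v) (tS TZ (F v))"
    "covering_space (tS TY v - attach TY v) (f v) (tS TZ (F v) - attach TZ (F v))"
    using cover v by (auto simp: is_cover_def)
  show "finite (attach TY v)" "finite (attach TZ (F v))"
    unfolding attach_def using Y.fin_edges_at Z.fin_edges_at by auto
  show "attach TY v \<subseteq> tS TY v" "attach TZ (F v) \<subseteq> tS TZ (F v)"
    using toY toZ v w by (auto simp: attach_def tree_of_spheres_def)
  have "EZ (F v) \<noteq> {}"
    using valZ[OF w] by force
  then show "attach TZ (F v) \<noteq> {}"
    by (simp add: attach_def)
  show "f v ` attach TY v \<subseteq> attach TZ (F v)"
    unfolding attach_def using f_ti[OF v] F_EZ by auto
qed

lemma ldeg_pos: "v \<in> IV TY \<Longrightarrow> x \<in> tS TY v \<Longrightarrow> 1 \<le> ldeg v x"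
  using sphere_map.ld_model(2)[OF sphere_map] by blast

lemma critical_is_attaching:
  assumes v: "v \<in> IV TY" and x: "x \<in> tS TY v" "2 \<le> ldeg v x"
  obtains e where "e \<in> EY v" "x = ti TY v e"
proof -
  have "x \<in> attach TY v"
    using sphere_map.local_degree_off_attaching[OF sphere_map[OF v], of x] x by auto
  then show ?thesis
    using that by (auto simp: attach_def)
qed

text \<open>The covering maps non-attaching points to non-attaching points, so a fibre over an
  attaching point consists of attaching points.\<close>

lemma edge_fibre:
  assumes v: "v \<in> IV TY" and \<epsilon>: "\<epsilon> \<in> EZ (F v)"
  shows "{x \<in> tS TY v. f v x = ti TZ (F v) \<epsilon>} = ti TY v ` {e \<in> EY v. F ` e = \<epsilon>}"
proof
  show "ti TY v ` {e \<in> EY v. F ` e = \<epsilon>} \<subseteq> {x \<in> tS TY v. f v x = ti TZ (F v) \<epsilon>}"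
    using ti_S[OF v] f_ti[OF v] by auto
  show "{x \<in> tS TY v. f v x = ti TZ (F v) \<epsilon>} \<subseteq> ti TY v ` {e \<in> EY v. F ` e = \<epsilon>}"
  proof
    fix x assume x: "x \<in> {x \<in> tS TY v. f v x = ti TZ (F v) \<epsilon>}"
    then have "f v x \<in> attach TZ (F v)"
      using \<epsilon> by (auto simp: attach_def)
    then have "x \<in> attach TY v"
      using sphere_map.A_iff[OF sphere_map[OF v], of x] x by auto
    then obtain e where e: "e \<in> EY v" "x = ti TY v e"
      by (auto simp: attach_def)
    then have "ti TZ (F v) (F ` e) = ti TZ (F v) \<epsilon>"
      using x f_ti[OF v] by auto
    then have "F ` e = \<epsilon>"
      using inj_onD[OF tiZ_inj[OF F_int[OF v]]] F_EZ[OF e(1)] \<epsilon> by blast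
    then show "x \<in> ti TY v ` {e \<in> EY v. F ` e = \<epsilon>}"
      using e by blast
  qed
qed

lemma mdeg_sum:
  assumes v: "v \<in> IV TY" and \<epsilon>: "\<epsilon> \<in> EZ (F v)"
  shows "mdeg v = (\<Sum>e\<in>{e \<in> EY v. F ` e = \<epsilon>}. ldeg v (ti TY v e))"
proof -
  have inj: "inj_on (ti TY v) {e \<in> EY v. F ` e = \<epsilon>}"
    by (rule inj_on_subset[OF ti_inj[OF v]]) auto
  have "mdeg v = (\<Sum>x\<in>{x \<in> tS TY v. f v x = ti TZ (F v) \<epsilon>}. ldeg v x)"
    using sphere_map.sphere_map_invariants(2)[OF sphere_map[OF v]] tiZ_S[OF F_int[OF v] \<epsilon>] by simp
  then show ?thesis
    unfolding edge_fibre[OF assms] sum.reindex[OF inj] by simp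
qed

lemma ldeg_le_mdeg:
  assumes "v \<in> IV TY" "e \<in> EY v"
  shows "ldeg v (ti TY v e) \<le> mdeg v"
  unfolding mdeg_sum[OF assms(1) F_EZ[OF assms(2)]]
  using assms Y.fin_edges_at[of v] by (intro member_le_sum) auto

lemma mdeg_ge_2:
  assumes v: "v \<in> IV TY" and e: "e \<in> EY v" "e' \<in> EY v" "e \<noteq> e'" "F ` e = F ` e'"
  shows "2 \<le> mdeg v"
proof -
  have "(\<Sum>d\<in>{e, e'}. ldeg v (ti TY v d)) \<le> mdeg v"
    unfolding mdeg_sum[OF v F_EZ[OF e(1)]]
    using e Y.fin_edges_at[of v] by (intro sum_mono2) auto
  moreover have "1 \<le> ldeg v (ti TY v e)" "1 \<le> ldeg v (ti TY v e')"
    using ldeg_pos[OF v ti_S[OF v]] e by auto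
  ultimately show ?thesis
    using e(3) by simp
qed

text \<open>The source of non-backtracking: of the critical points, all of them attaching points,
  one lies off the fibre that belongs to the edge one comes from.\<close>

lemma other_critical_edge:
  assumes v: "v \<in> IV TY" and "2 \<le> mdeg v" and \<epsilon>: "\<epsilon> \<in> EZ (F v)"
  obtains e where "e \<in> EY v" "F ` e \<noteq> \<epsilon>" "2 \<le> ldeg v (ti TY v e)"
proof -
  obtain x where x: "x \<in> tS TY v" "f v x \<noteq> ti TZ (F v) \<epsilon>" "2 \<le> ldeg v x"
    using sphere_map.sphere_map_invariants(3)[OF sphere_map[OF v] assms(2) tiZ_S[OF F_int[OF v] \<epsilon>]]
    by blast
  obtain e where e: "e \<in> EY v" "x = ti TY v e"
    using critical_is_attaching[OF v x(1,3)] by blast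
  then show ?thesis
    using that[of e] x f_ti[OF v] by auto
qed

lemma card3Y: "3 \<le> card (leaves (tV TY) (tE TY))" and card3Z: "3 \<le> card (leaves (tV TZ) (tE TZ))"
  using toY toZ by (auto simp: tree_of_spheres_def LV_def)

lemma leafY:
  assumes "y \<in> LV TY"
  obtains u where "EY y = {{y, u}}" "u \<noteq> y" "{y, u} \<in> tE TY" "u \<in> IV TY" "ndeg y = ldeg u (ti TY u {y, u})"
proof -
  obtain u where u: "EY y = {{y, u}}" "u \<noteq> y" "{y, u} \<in> tE TY" "u \<in> IV TY"
    using Y.leaf_edge[OF assms[unfolded LV_def] card3Y] unfolding IV_def by blast
  have 1: "(THE e. e \<in> EY y) = {y, u}"
    using u(1) by simp
  have 2: "(THE u'. u' \<in> {y, u} \<and> u' \<noteq> y) = u"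
    using u(2) by (intro the_equality) auto
  have "y \<notin> IV TY"
    using assms IV_V by blast
  then have "ndeg y = ldeg u (ti TY u {y, u})"
    unfolding vdeg_def Let_def 1 2 by simp
  then show ?thesis
    using that u by blast
qed

lemma leafZ:
  assumes "z \<in> LV TZ"
  obtains \<epsilon> where "EZ z = {\<epsilon>}"
  using Z.leaf_edge[OF assms[unfolded LV_def] card3Z] by blast

text \<open>The local degree at an internal end of the edge. By condition (c) both ends give the
  same number; an edge to a leaf has only one end to read it from.\<close>

definition edeg :: "'v set \<Rightarrow> nat" where
  "edeg e = (SOME d. \<exists>v\<in>IV TY. v \<in> e \<and> d = ldeg v (ti TY v e))"

lemma edeg_eq:
  assumes "v \<in> IV TY" "e \<in> EY v"
  shows "edeg e = ldeg v (ti TY v e)"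
proof -
  have uniq: "ldeg u (ti TY u e) = ldeg v (ti TY v e)" if u: "u \<in> IV TY" "u \<in> e" for u
  proof (cases "u = v")
    case False
    obtain c where c: "e = {v, c}" "{v, c} \<in> tE TY"
      using Y.edge_other[OF assms(2)] by metis
    then have "c = u"
      using u False by auto
    then show ?thesis
      using cover c u assms(1) unfolding is_cover_def by metis
  qed simp
  have "\<exists>d. \<exists>v\<in>IV TY. v \<in> e \<and> d = ldeg v (ti TY v e)"
    using assms by (auto simp: edges_at_def)
  then have "\<exists>u\<in>IV TY. u \<in> e \<and> edeg e = ldeg u (ti TY u e)"
    unfolding edeg_def by (rule someI_ex)
  then show ?thesis
    using uniq by auto
qed

text \<open>Internal vertices and leaves obey one rule: a leaf has a single edge, which lies over
  the single edge at the image leaf.\<close>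

lemma ndeg_sum:
  assumes v: "v \<in> tV TY" and \<epsilon>: "\<epsilon> \<in> EZ (F v)"
  shows "ndeg v = (\<Sum>e\<in>{e \<in> tE TY. v \<in> e \<and> F ` e = \<epsilon>}. edeg e)"
proof (cases "v \<in> IV TY")
  case True
  then have "ndeg v = mdeg v"
    by (simp add: vdeg_def)
  also have "\<dots> = (\<Sum>e\<in>{e \<in> EY v. F ` e = \<epsilon>}. ldeg v (ti TY v e))"
    by (rule mdeg_sum[OF True \<epsilon>])
  also have "\<dots> = (\<Sum>e\<in>{e \<in> tE TY. v \<in> e \<and> F ` e = \<epsilon>}. edeg e)"
    using edeg_eq[OF True] by (intro sum.cong) (auto simp: edges_at_def)
  finally show ?thesis .
next
  case False
  then have vL: "v \<in> LV TY"
    using v IV_V by blast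
  obtain u where u: "EY v = {{v, u}}" "{v, u} \<in> tE TY" "u \<in> IV TY" "ndeg v = ldeg u (ti TY u {v, u})"
    using leafY[OF vL] by metis
  obtain \<epsilon>' where "EZ (F v) = {\<epsilon>'}"
    using leafZ[OF F_leaf[OF vL]] by blast
  then have "F ` {v, u} = \<epsilon>"
    using \<epsilon> F_EZ[of "{v, u}" v] u(1) by auto
  then have "{e \<in> tE TY. v \<in> e \<and> F ` e = \<epsilon>} = {{v, u}}"
    using u(1) by (auto simp: edges_at_def)
  moreover have "edeg {v, u} = ldeg u (ti TY u {v, u})"
    using u by (intro edeg_eq) (auto simp: edges_at_def)
  ultimately show ?thesis
    using u(4) by simp
qed

definition fibdeg :: "'v \<Rightarrow> nat" where
  "fibdeg w = (\<Sum>v\<in>{v \<in> tV TY. F v = w}. ndeg v)"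

text \<open>Double counting: an edge over \<open>\<epsilon>\<close> has exactly one end over
  \<open>w\<close>, because the two ends of \<open>\<epsilon>\<close> differ. The result depends on
  the edge alone, not on which of its ends is \<open>w\<close>.\<close>

lemma fibdeg_edge:
  assumes \<epsilon>: "\<epsilon> \<in> EZ w"
  shows "fibdeg w = (\<Sum>e\<in>{e \<in> tE TY. F ` e = \<epsilon>}. edeg e)"
proof -
  let ?V = "{v \<in> tV TY. F v = w}" and ?E = "{e \<in> tE TY. F ` e = \<epsilon>}"
  have "fibdeg w = (\<Sum>v\<in>?V. \<Sum>e\<in>{e \<in> ?E. v \<in> e}. edeg e)"
    unfolding fibdeg_def
  proof (rule sum.cong[OF refl])
    fix v assume v: "v \<in> ?V"
    have "{e \<in> ?E. v \<in> e} = {e \<in> tE TY. v \<in> e \<and> F ` e = \<epsilon>}"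
      by auto
    then show "ndeg v = (\<Sum>e\<in>{e \<in> ?E. v \<in> e}. edeg e)"
      using ndeg_sum[of v \<epsilon>] v \<epsilon> by simp
  qed
  also have "\<dots> = (\<Sum>e\<in>?E. \<Sum>v\<in>{v \<in> ?V. v \<in> e}. edeg e)"
    using Y.finV Y.finE by (intro sum.swap_restrict) auto
  also have "\<dots> = (\<Sum>e\<in>?E. edeg e)"
  proof (rule sum.cong[OF refl])
    fix e assume e: "e \<in> ?E"
    obtain a b where ab: "e = {a, b}" "a \<noteq> b"
      using Y.edge2 e by (metis (no_types, lifting) card_2_iff mem_Collect_eq)
    have "card \<epsilon> = 2" "w \<in> \<epsilon>"
      using \<epsilon> Z.edge2 by (auto simp: edges_at_def)
    moreover have "\<epsilon> = {F a, F b}"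
      using e ab by auto
    ultimately have "F a \<noteq> F b" "w = F a \<or> w = F b"
      by (auto simp: card_2_iff doubleton_eq_iff)
    moreover have "a \<in> tV TY" "b \<in> tV TY"
      using Y.edgeV e ab by auto
    ultimately have "{v \<in> ?V. v \<in> e} = {a} \<or> {v \<in> ?V. v \<in> e} = {b}"
      using ab by auto
    then show "(\<Sum>v\<in>{v \<in> ?V. v \<in> e}. edeg e) = edeg e"
      by auto
  qed
  finally show ?thesis .
qed

text \<open>Neighbouring vertices share an edge and hence the edge sum of
  \<open>fibdeg_edge\<close>; connectedness does the rest. The vertex chosen in
  \<open>cover_degree\<close> is thereby immaterial.\<close>

lemma fibdeg_const:
  assumes "w \<in> tV TZ"
  shows "fibdeg w = cover_degree TY TZ F f"
proof -
  define w0 where "w0 = (SOME w. w \<in> tV TZ)"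
  have w0: "w0 \<in> tV TZ"
    unfolding w0_def using assms by (rule someI)
  have "(w0, w) \<in> (adj_avoid (tE TZ) {})\<^sup>*"
    using Z.tree w0 assms by (auto simp: is_tree_def connected_graph_def)
  then have "fibdeg w = fibdeg w0"
  proof (induction rule: rtrancl_induct)
    case (step a b)
    then have "{a, b} \<in> EZ a" "{a, b} \<in> EZ b"
      by (auto simp: adj_avoid_def edges_at_def)
    then show ?case
      using step.IH fibdeg_edge by metis
  qed simp
  then show ?thesis
    by (simp add: cover_degree_def w0_def fibdeg_def Let_def)
qed

lemma finLV: "finite (LV TY)" "finite (LV TZ)" "finite (IV TY)" "finite (IV TZ)"
  using Y.finV Z.finV by (auto simp: LV_def IV_def leaves_def internal_def)

lemma ndeg_leaf_pos:
  assumes "y \<in> LV TY"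
  shows "1 \<le> ndeg y"
proof -
  obtain u where "{y, u} \<in> tE TY" "u \<in> IV TY" "ndeg y = ldeg u (ti TY u {y, u})"
    using leafY[OF assms] by metis
  then show ?thesis
    using ldeg_pos ti_S by (simp add: edges_at_def)
qed

lemma sum_leaf_degree: "(\<Sum>y\<in>LV TY. ndeg y) = cover_degree TY TZ F f * card (LV TZ)"
proof -
  have "(\<Sum>y\<in>LV TY. ndeg y) = (\<Sum>z\<in>LV TZ. \<Sum>y\<in>{y \<in> LV TY. F y = z}. ndeg y)"
    using finLV F_leaf by (intro sum.group[symmetric]) auto
  also have "\<dots> = (\<Sum>z\<in>LV TZ. cover_degree TY TZ F f)"
  proof (rule sum.cong[OF refl])
    fix z assume z: "z \<in> LV TZ"
    have "{y \<in> LV TY. F y = z} = {v \<in> tV TY. F v = z}"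
      using z IV_V F_int IVZ_V by blast
    then show "(\<Sum>y\<in>{y \<in> LV TY. F y = z}. ndeg y) = cover_degree TY TZ F f"
      using fibdeg_const[OF IVZ_V(2)[OF z]] by (simp add: fibdeg_def)
  qed
  finally show ?thesis
    by simp
qed

text \<open>The puncture inequality at each internal vertex \<open>v\<close>, with
  \<open>mdeg v\<close> sheets, is summed over \<open>TY\<close>. Grouped by images, the degrees
  over each \<open>w\<close> add up to \<open>D\<close>, and \<open>sum_internal_val\<close> turns
  both totals into numbers of leaves.\<close>

lemma leaf_count: "int (cover_degree TY TZ F f) * (int (card (LV TZ)) - 2) \<le> int (card (LV TY)) - 2"
proof -
  let ?D = "int (cover_degree TY TZ F f)"
  have "LV TY \<noteq> {}" "LV TZ \<noteq> {}"
    using toY toZ by (auto simp: tree_of_spheres_def)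
  then obtain a b where ab: "a \<in> tV TY" "b \<in> tV TZ"
    using IV_V(2) IVZ_V(2) by blast
  have "?D * (int (card (LV TZ)) - 2) = (\<Sum>w\<in>IV TZ. ?D * (int (val (tE TZ) w) - 2))"
    using Z.sum_internal_val[OF ab(2)] unfolding IV_def LV_def sum_distrib_left[symmetric] by simp
  also have "\<dots> = (\<Sum>w\<in>IV TZ. \<Sum>v\<in>{v \<in> IV TY. F v = w}. int (mdeg v) * (int (val (tE TZ) (F v)) - 2))"
  proof (rule sum.cong[OF refl])
    fix w assume w: "w \<in> IV TZ"
    \<comment> \<open>Leaves go to leaves, so only internal vertices lie over the internal vertex
      \<open>w\<close>.\<close>
    have "{v \<in> IV TY. F v = w} = {v \<in> tV TY. F v = w}"
      using w IV_V F_leaf IVZ_V by blast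
    then have "?D = (\<Sum>v\<in>{v \<in> IV TY. F v = w}. int (ndeg v))"
      using fibdeg_const[OF IVZ_V(1)[OF w]] by (simp add: fibdeg_def flip: of_nat_sum)
    also have "\<dots> = (\<Sum>v\<in>{v \<in> IV TY. F v = w}. int (mdeg v))"
      by (rule sum.cong) (auto simp: vdeg_def)
    finally have D: "?D = (\<Sum>v\<in>{v \<in> IV TY. F v = w}. int (mdeg v))" .
    show "?D * (int (val (tE TZ) w) - 2) =
        (\<Sum>v\<in>{v \<in> IV TY. F v = w}. int (mdeg v) * (int (val (tE TZ) (F v)) - 2))"
      unfolding D sum_distrib_right by (rule sum.cong) auto
  qed
  also have "\<dots> = (\<Sum>v\<in>IV TY. int (mdeg v) * (int (val (tE TZ) (F v)) - 2))"
    using finLV F_int by (intro sum.group) auto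
  also have "\<dots> \<le> (\<Sum>v\<in>IV TY. int (val (tE TY) v) - 2)"
  proof (rule sum_mono)
    fix v assume v: "v \<in> IV TY"
    have "mdeg v * val (tE TZ) (F v) + 2 \<le> val (tE TY) v + 2 * mdeg v"
      using sphere_map.sphere_map_invariants(4)[OF sphere_map[OF v]] card_attachY[OF v]
        card_attachZ[OF F_int[OF v]] by simp
    then have "int (mdeg v * val (tE TZ) (F v) + 2) \<le> int (val (tE TY) v + 2 * mdeg v)"
      by (rule of_nat_mono)
    then show "int (mdeg v) * (int (val (tE TZ) (F v)) - 2) \<le> int (val (tE TY) v) - 2"
      by (simp add: algebra_simps)
  qed
  also have "\<dots> = int (card (LV TY)) - 2"
    using Y.sum_internal_val[OF ab(1)] by (simp add: IV_def LV_def)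
  finally show ?thesis .
qed

text \<open>A critical leaf contributes at least 1 to the sum of \<open>ndeg y - 1\<close>, and
  every other leaf contributes at least 0; the total is bounded by
  \<open>leaf_count\<close>.\<close>

lemma card_critical_leaves:
  "int (card {y \<in> LV TY. 2 \<le> ndeg y}) \<le> 2 * int (cover_degree TY TZ F f) - 2"
proof -
  let ?D = "int (cover_degree TY TZ F f)"
  have "int (card {y \<in> LV TY. 2 \<le> ndeg y}) = (\<Sum>y\<in>{y \<in> LV TY. 2 \<le> ndeg y}. 1)"
    by simp
  also have "\<dots> \<le> (\<Sum>y\<in>{y \<in> LV TY. 2 \<le> ndeg y}. int (ndeg y) - 1)"
    by (rule sum_mono) auto
  also have "\<dots> \<le> (\<Sum>y\<in>LV TY. int (ndeg y) - 1)"
    using finLV ndeg_leaf_pos by (intro sum_mono2) force+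
  also have "\<dots> = ?D * int (card (LV TZ)) - int (card (LV TY))"
    using sum_leaf_degree by (simp add: sum_subtractf flip: of_nat_sum of_nat_mult)
  also have "\<dots> \<le> 2 * ?D - 2"
    using leaf_count by (simp add: algebra_simps)
  finally show ?thesis .
qed

section \<open>Critical leaves and images of branches\<close>

text \<open>A critical edge ends at a leaf, which is then critical, or at an internal vertex of
  degree at least 2. There \<open>other_critical_edge\<close> gives a next critical edge whose image
  does not go back, so source and image both walk outwards.\<close>

lemma critical_leaf_in_branch:
  assumes "v \<in> IV TY" "e \<in> EY v" "2 \<le> ldeg v (ti TY v e)"
  shows "\<exists>y\<in>LV TY. y \<in> BY v e \<and> F y \<in> BZ (F v) (F ` e) \<and> 2 \<le> ndeg y"
  using assms
proof (induction "card (BY v e)" arbitrary: v e rule: less_induct)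
  case less
  obtain u where u: "e = {v, u}" "u \<noteq> v" "{v, u} \<in> tE TY" "u \<in> tV TY"
    using Y.edge_other[OF less.prems(2)] by metis
  have Fe: "{F v, F u} \<in> tE TZ" "F ` e = {F v, F u}"
    using FE[OF u(3)] u(1) by auto
  have ub: "u \<in> BY v e" "F u \<in> BZ (F v) (F ` e)"
    using Y.branch_edge[OF u(3)] Z.branch_edge[OF Fe(1)] u(1) Fe(2) by auto
  show ?case
  proof (cases "u \<in> LV TY")
    case True
    obtain v' where "EY u = {{u, v'}}" "ndeg u = ldeg v' (ti TY v' {u, v'})"
      using leafY[OF True] by metis
    moreover have "{v, u} \<in> EY u"
      using u(3) by (simp add: edges_at_def)
    ultimately have "ndeg u = ldeg v (ti TY v e)"
      using u(1,2) by (auto simp: doubleton_eq_iff insert_commute)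
    then show ?thesis
      using True ub less.prems(3) by auto
  next
    case False
    then have uI: "u \<in> IV TY"
      using u(4) IV_V by blast
    have eu: "e \<in> EY u"
      using u by (simp add: edges_at_def)
    have "ldeg u (ti TY u e) = ldeg v (ti TY v e)"
      using edeg_eq[OF uI eu] edeg_eq[OF less.prems(1,2)] by simp
    then have "2 \<le> mdeg u"
      using ldeg_le_mdeg[OF uI eu] less.prems(3) by simp
    then obtain e' where e': "e' \<in> EY u" "F ` e' \<noteq> F ` e" "2 \<le> ldeg u (ti TY u e')"
      using other_critical_edge[OF uI _ F_EZ[OF eu]] by metis
    have ne: "e' \<noteq> {v, u}"
      using e'(2) u(1) by auto
    obtain y where y: "y \<in> LV TY" "y \<in> BY u e'" "F y \<in> BZ (F u) (F ` e')" "2 \<le> ndeg y"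
      using less.hyps[of u e'] Y.branch_psub[OF u(3) e'(1) ne] uI e' u(1) by auto
    have "y \<in> BY v e"
      using Y.branch_sub[OF u(3) e'(1) ne] y(2) u(1) by auto
    moreover have "F y \<in> BZ (F v) (F ` e)"
      using Z.branch_sub[OF Fe(1) F_EZ[OF e'(1)]] e'(2) y(3) Fe(2) by auto
    ultimately show ?thesis
      using y by blast
  qed
qed

text \<open>The image of a branch can turn back only where a further edge has the same image as the
  incoming one. Such a fold gives degree at least 2, and then a critical edge with another image
  leads to a leaf of the excluded kind.\<close>

lemma branch_image:
  assumes "v \<in> IV TY" "e \<in> EY v"
    and "\<not> (\<exists>y\<in>LV TY. y \<in> BY v e \<and> F y \<in> BZ (F v) (F ` e) \<and> 2 \<le> ndeg y)"
    and "x \<in> BY v e"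
  shows "F x \<in> BZ (F v) (F ` e)"
  using assms
proof (induction "card (BY v e)" arbitrary: v e rule: less_induct)
  case less
  obtain u where u: "e = {v, u}" "u \<noteq> v" "{v, u} \<in> tE TY" "u \<in> tV TY"
    using Y.edge_other[OF less.prems(2)] by metis
  have Fe: "{F v, F u} \<in> tE TZ" "F ` e = {F v, F u}"
    using FE[OF u(3)] u(1) by auto
  show ?case
  proof (cases "x = u")
    case True
    then show ?thesis
      using Z.branch_edge[OF Fe(1)] Fe(2) by simp
  next
    case False
    have eE: "e \<in> tE TY"
      using u by simp
    have xV: "x \<in> tV TY"
      using Y.branch_V[OF eE] less.prems(4) by blast
    obtain e' where e': "e' \<in> EY u" "x \<in> BY u e'"
      using Y.in_some_branch[OF u(4) xV False] by metis
    have ne: "e' \<noteq> {v, u}"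
      using Y.branch_both_ends[OF u(3)] e'(2) less.prems(4) u(1) by auto
    have eu: "e \<in> EY u"
      using u by (simp add: edges_at_def)
    \<comment> \<open>\<open>x\<close> lies beyond \<open>u\<close>, so \<open>u\<close> has a
      second edge and is not a leaf.\<close>
    have "EY u \<noteq> {{y, w}}" for y w
      using e' eu ne u(1) by auto
    then have uI: "u \<in> IV TY"
      using u(4) IV_V leafY by metis
    have up: "y \<in> BY v e \<and> F y \<in> BZ (F v) (F ` e)"
      if "d \<in> EY u" "F ` d \<noteq> F ` e" "y \<in> BY u d" "F y \<in> BZ (F u) (F ` d)" for y d
    proof -
      have "d \<noteq> {v, u}"
        using that(2) u(1) by auto
      then have "y \<in> BY v e"
        using Y.branch_sub[OF u(3) that(1)] that(3) u(1) by auto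
      moreover have "F y \<in> BZ (F v) (F ` e)"
        using Z.branch_sub[OF Fe(1) F_EZ[OF that(1)]] that(2,4) Fe(2) by auto
      ultimately show ?thesis ..
    qed
    have Fne: "F ` e' \<noteq> F ` e"
    proof
      assume "F ` e' = F ` e"
      then have "2 \<le> mdeg u"
        using mdeg_ge_2[OF uI e'(1) eu] ne u(1) by blast
      then obtain d where d: "d \<in> EY u" "F ` d \<noteq> F ` e" "2 \<le> ldeg u (ti TY u d)"
        using other_critical_edge[OF uI _ F_EZ[OF eu]] by metis
      then obtain y where "y \<in> LV TY" "y \<in> BY u d" "F y \<in> BZ (F u) (F ` d)" "2 \<le> ndeg y"
        using critical_leaf_in_branch[OF uI] by metis
      then show False
        using less.prems(3) up[OF d(1,2)] by blast
    qed
    have "\<not> (\<exists>y\<in>LV TY. y \<in> BY u e' \<and> F y \<in> BZ (F u) (F ` e') \<and> 2 \<le> ndeg y)"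
      using less.prems(3) up[OF e'(1) Fne] by blast
    then have "F x \<in> BZ (F u) (F ` e')"
      using less.hyps[of u e'] Y.branch_psub[OF u(3) e'(1) ne] uI e' u(1) by auto
    then show ?thesis
      using up[OF e'(1) Fne e'(2)] by blast
  qed
qed

end

section \<open>Directions in the three trees, and the leaf assigned to a cycle\<close>

section \<open>Dynamics\<close>

context tree
begin

text \<open>Valence at least 3 leaves two edges besides the one towards \<open>w\<close>, each with
  a leaf behind it. The outcome is a separated triple, which is what compatibility of trees
  transports.\<close>

lemma separating_leaves:
  assumes "u \<in> V" "w \<in> V" "u \<noteq> w" "3 \<le> card (edges_at E u)"
  obtains x x' where "x \<in> leaves V E" "x' \<in> leaves V E" "separates E u w x x'"
proof -
  obtain e0 where e0: "e0 \<in> edges_at E u" "w \<in> branch E u e0"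
    using in_some_branch[OF assms(1,2)] assms(3) by metis
  have "1 < card (edges_at E u - {e0})"
    using assms(4) e0(1) fin_edges_at by (simp add: card_Diff_singleton)
  then obtain e1 e2 where e: "e1 \<in> edges_at E u - {e0}" "e2 \<in> edges_at E u - {e0}" "e1 \<noteq> e2"
    by (metis One_nat_def card_le_Suc0_iff_eq fin_edges_at finite_Diff linorder_not_le)
  obtain x x' where x: "x \<in> leaves V E" "x \<in> branch E u e1" "x' \<in> leaves V E" "x' \<in> branch E u e2"
    using branch_has_leaf e by (metis DiffD1)
  have ne: "w \<noteq> u" "x \<noteq> u" "x' \<noteq> u"
    using e0 x branch_notin by auto
  have sep: "(a, b) \<notin> (adj_avoid E {u})\<^sup>*"
    if "d \<in> edges_at E u" "d' \<in> edges_at E u" "d \<noteq> d'" "a \<in> branch E u d" "b \<in> branch E u d'" for a b d d'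
    using branch_step[OF that(4), of b] branch_disjoint[OF that(1,2) _ that(5)] that(3) by blast
  have "separates E u w x x'"
    unfolding separates_def using ne sep e0 e x by (metis DiffD1 DiffD2 insertI1)
  then show ?thesis
    using that x by blast
qed

text \<open>The branch at \<open>u\<close> that contains \<open>x\<close> misses \<open>w\<close>,
  so the way from \<open>u\<close> to \<open>x\<close> through it avoids \<open>w\<close>.\<close>

lemma separates_same_side:
  assumes "u \<in> V" "x \<in> V" "separates E u w x x'"
  shows "(u, x) \<in> (adj_avoid E {w})\<^sup>*"
proof -
  have s: "w \<noteq> u" "x \<noteq> u" "(w, x) \<notin> (adj_avoid E {u})\<^sup>*"
    using assms(3) by (auto simp: separates_def)
  obtain e where e: "e \<in> edges_at E u" "x \<in> branch E u e"
    using in_some_branch[OF assms(1,2) s(2)] by metis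
  obtain c where c: "e = {u, c}" "{u, c} \<in> E"
    using edge_other[OF e(1)] by metis
  have cx: "(c, x) \<in> (adj_avoid E {u})\<^sup>*"
    using e(2) branch_edge[OF c(2)] c(1) by simp
  have cw: "(c, w) \<notin> (adj_avoid E {u})\<^sup>*"
    using cx s(3) adj_avoid_rtrancl_sym rtrancl_trans by metis
  then have "c \<noteq> w"
    by auto
  then have "(u, c) \<in> adj_avoid E {w}"
    using c(2) s(1) by (simp add: adj_avoid_def)
  then show ?thesis
    using avoid_switch[OF cx cw] by (rule converse_rtrancl_into_rtrancl)
qed

lemma amap_branch:
  assumes "tE T = E" "w \<in> V" "u \<in> V" "u \<noteq> w"
  obtains e where "e \<in> edges_at E w" "u \<in> branch E w e" "amap T w u = ti T w e"
  using in_some_branch[OF assms(2-4)] amap_eq[OF assms(1)] by metis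

lemma amap_same_side:
  assumes "tE T = E" "w \<in> V" "u \<in> V" "u \<noteq> w" "(u, x) \<in> (adj_avoid E {w})\<^sup>*"
  shows "amap T w u = amap T w x"
proof -
  obtain e where e: "e \<in> edges_at E w" "u \<in> branch E w e" "amap T w u = ti T w e"
    using amap_branch[OF assms(1-4)] by metis
  then show ?thesis
    using amap_eq[OF assms(1) e(1) branch_step[OF e(2) assms(5)]] by simp
qed

end

lemma Prep_iff: "v \<in> Prep TX F \<longleftrightarrow> (\<forall>k. (F ^^ k) v \<in> IV TX)"
proof -
  have "v \<in> IVit TX F k \<longleftrightarrow> (\<forall>j\<le>k. (F ^^ j) v \<in> IV TX)" for k
    by (induction k) (auto simp: le_Suc_eq)
  then show ?thesis
    by (auto simp: Prep_def)
qed

lemma Prep_funpow: "v \<in> Prep TX F \<Longrightarrow> (F ^^ j) v \<in> Prep TX F"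
  unfolding Prep_iff by (metis comp_apply funpow_add)

text \<open>Lets a cycle be recovered from any one of its vertices, as the injectivity of the final
  assignment requires.\<close>

lemma sphere_cycle_orbit:
  assumes C: "C \<in> sphere_cycles TX F" and w: "w \<in> C"
  shows "C = {(F ^^ j) w | j. True}" "finite C" "w \<in> Prep TX F"
proof -
  obtain v k where v: "1 \<le> k" "v \<in> Prep TX F" "(F ^^ k) v = v" "C = {(F ^^ j) v | j. j < k}"
    using C unfolding sphere_cycles_def by blast
  obtain i where i: "i < k" "w = (F ^^ i) v"
    using w v by blast
  have md: "(F ^^ (m mod k)) v = (F ^^ m) v" for m
    using funpow_mod_eq[OF v(3)] .
  have inC: "(F ^^ m) v \<in> C" for m
  proof -
    have "m mod k < k"
      using v(1) by simp
    then have "(F ^^ (m mod k)) v \<in> C"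
      unfolding v(4) by blast
    then show ?thesis
      unfolding md .
  qed
  show "C = {(F ^^ j) w | j. True}"
  proof
    show "{(F ^^ j) w | j. True} \<subseteq> C"
    proof
      fix z assume "z \<in> {(F ^^ j) w | j. True}"
      then obtain j where "z = (F ^^ j) w"
        by blast
      then have "z = (F ^^ (j + i)) v"
        using i(2) by (simp add: funpow_add)
      then show "z \<in> C"
        using inC by blast
    qed
    show "C \<subseteq> {(F ^^ j) w | j. True}"
    proof
      fix z assume "z \<in> C"
      then obtain j where j: "z = (F ^^ j) v"
        using v(4) by blast
      have "(F ^^ (j + (k - i))) w = (F ^^ (j + (k - i) + i)) v"
        using i(2) by (simp add: funpow_add)
      also have "\<dots> = (F ^^ (j + k)) v"
        using i(1) by simp
      also have "\<dots> = (F ^^ j) v"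
        using v(3) by (simp add: funpow_add)
      finally show "z \<in> {(F ^^ j) w | j. True}"
        using j by (metis (mono_tags, lifting) mem_Collect_eq)
    qed
  qed
  have "C = (\<lambda>j. (F ^^ j) v) ` {..<k}"
    unfolding v(4) by auto
  then show "finite C"
    by simp
  show "w \<in> Prep TX F"
    unfolding i(2) by (rule Prep_funpow[OF v(2)])
qed

locale spheres_dynamics =
  fixes TX TY TZ :: "('v, 'a::topological_space) tos" and F :: "'v \<Rightarrow> 'v" and f :: "'v \<Rightarrow> 'a \<Rightarrow> 'a"
  assumes dyn: "dyn_sys TX TY TZ F f"
begin

sublocale spheres_cover TY TZ F f
  using dyn by unfold_locales (auto simp: dyn_sys_def)

sublocale X: tree "tV TX" "tE TX"
  using dyn by unfold_locales (simp add: dyn_sys_def tree_of_spheres_def)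

lemma compatY: "tree_compat TX TY" and compatZ: "tree_compat TX TZ"
  using dyn by (auto simp: dyn_sys_def tos_compat_def)

lemma amapY: "v \<in> IV TX \<Longrightarrow> x \<in> LV TX \<Longrightarrow> amap TY v x = amap TX v x"
  and amapZ: "v \<in> IV TX \<Longrightarrow> x \<in> LV TX \<Longrightarrow> amap TZ v x = amap TX v x"
  using dyn by (auto simp: dyn_sys_def tos_compat_def)

lemma IVX_IVY: "v \<in> IV TX \<Longrightarrow> v \<in> IV TY" and IVX_IVZ: "v \<in> IV TX \<Longrightarrow> v \<in> IV TZ"
  and LVX_LVY: "v \<in> LV TX \<Longrightarrow> v \<in> LV TY" and LVX_LVZ: "v \<in> LV TX \<Longrightarrow> v \<in> LV TZ"
  using compatY compatZ by (auto simp: tree_compat_def)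

lemma IVX_V: "v \<in> IV TX \<Longrightarrow> v \<in> tV TX" "v \<in> LV TX \<Longrightarrow> v \<in> tV TX" "v \<in> IV TX \<Longrightarrow> v \<notin> LV TX"
  by (auto simp: IV_def LV_def internal_def leaves_def)

text \<open>For internal \<open>w\<close> these are the attaching points of \<open>TX\<close> at
  \<open>w\<close>, since every branch contains a leaf. Written through leaves, they can be read off
  in \<open>TY\<close> and \<open>TZ\<close> as well.\<close>

definition marked :: "'v \<Rightarrow> 'a set" where
  "marked w = amap TX w ` LV TX"

lemma finite_marked: "finite (marked w)"
  unfolding marked_def LV_def leaves_def using X.finV by simp

lemma marked_attach:
  assumes "w \<in> IV TX" "p \<in> marked w"
  obtains e where "e \<in> EY w" "p = ti TY w e"
proof -
  obtain x where x: "x \<in> LV TX" "p = amap TX w x"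
    using assms by (auto simp: marked_def)
  have "x \<noteq> w" "x \<in> tV TY" "w \<in> tV TY"
    using x(1) assms(1) IVX_V(3) IVX_IVY LVX_LVY IV_V(1,2) by auto
  then obtain e where "e \<in> EY w" "amap TY w x = ti TY w e"
    using Y.amap_branch[OF refl, of w x] by metis
  then show ?thesis
    using that x amapY assms(1) by metis
qed

text \<open>The directions at \<open>w\<close> of an internal vertex \<open>u\<close> of \<open>TX\<close> in the three trees are controlled by a
  leaf \<open>x\<close>: as \<open>u\<close> separates \<open>x\<close> from \<open>w\<close>, the vertices \<open>u\<close> and \<open>x\<close> lie on the same side of \<open>w\<close>.\<close>

lemma amap_internal:
  assumes "u \<in> IV TX" "w \<in> IV TX" "u \<noteq> w"
  shows "amap TY w u = amap TZ w u" "amap TZ w u \<in> marked w"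
proof -
  have "3 \<le> card (edges_at (tE TX) u)"
    using dyn assms(1) by (auto simp: dyn_sys_def stable_def IV_def val_def)
  then obtain x x' where x: "x \<in> LV TX" "x' \<in> LV TX" "separates (tE TX) u w x x'"
    using X.separating_leaves[of u w] assms IVX_V(1) unfolding LV_def by metis
  have "separates (tE TY) u w x x'" "separates (tE TZ) u w x x'"
    using compatY compatZ x assms IVX_V unfolding tree_compat_def by blast+
  moreover have "u \<in> tV TY" "u \<in> tV TZ" "w \<in> tV TY" "w \<in> tV TZ" "x \<in> tV TY" "x \<in> tV TZ"
    using assms x IVX_IVY IVX_IVZ LVX_LVY LVX_LVZ IV_V(1,2) IVZ_V(1,2) by auto
  ultimately have "amap TY w u = amap TY w x" "amap TZ w u = amap TZ w x"
    using Y.amap_same_side[OF refl _ _ assms(3)] Z.amap_same_side[OF refl _ _ assms(3)]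
      Y.separates_same_side Z.separates_same_side by metis+
  then show "amap TY w u = amap TZ w u" "amap TZ w u \<in> marked w"
    using amapY amapZ assms(2) x(1) by (auto simp: marked_def)
qed

lemma cycle_critical_leaf:
  assumes C: "C \<in> sphere_cycles TX F" and npcf: "not_pcf TX TY TZ F f C"
  shows "\<exists>y\<in>LV TY. 2 \<le> ndeg y \<and>
    (\<exists>w\<in>C. \<exists>e\<in>EZ w. F y \<in> BZ w e \<and> Prep TX F \<inter> BZ w e = {})"
proof -
  obtain v x where v: "v \<in> C" and crit: "critical_point TY TZ F f v x"
      and inf: "infinite (orbit TX F f v x)"
    using npcf by (auto simp: not_pcf_def)
  define V where "V j = (F ^^ j) v" for j
  define p where "p j = fit F f j v x" for j
  note cyc = sphere_cycle_orbit[OF C v]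
  have VC: "V j \<in> C" for j
    unfolding V_def cyc(1) by blast
  have VP: "V j \<in> Prep TX F" for j
    unfolding V_def by (rule Prep_funpow[OF cyc(3)])
  have VX: "V j \<in> IV TX" for j
    using VP[of j] unfolding Prep_iff by (metis funpow_0)
  have VY: "V j \<in> IV TY" for j
    using VX IVX_IVY by blast
  have VS: "V (Suc j) = F (V j)" for j
    by (simp add: V_def)
  have pS: "p (Suc j) = f (V j) (p j)" for j
    by (simp add: p_def V_def)
  have v0: "V 0 = v" "p 0 = x"
    by (simp_all add: V_def p_def)
  \<comment> \<open>The finitely many spheres of the cycle carry finitely many marked points, so an
    infinite orbit must leave them. Time 0 is set apart because \<open>x\<close> is known only as an
    attaching point of \<open>TY\<close>.\<close>
  have "\<exists>m\<ge>1. p m \<notin> marked (V m)"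
  proof (rule ccontr)
    assume "\<not> ?thesis"
    then have all: "p m \<in> marked (V m)" if "1 \<le> m" for m
      using that by blast
    have "orbit TX F f v x \<subseteq> insert x (\<Union>w\<in>C. marked w)"
    proof
      fix z assume "z \<in> orbit TX F f v x"
      then obtain m where m: "z = p m"
        by (auto simp: orbit_def p_def)
      show "z \<in> insert x (\<Union>w\<in>C. marked w)"
      proof (cases m)
        case 0
        then show ?thesis
          using m v0 by simp
      next
        case (Suc n)
        then show ?thesis
          using m all[of m] VC[of m] by auto
      qed
    qed
    moreover have "finite (insert x (\<Union>w\<in>C. marked w))"
      using cyc(2) finite_marked by simp
    ultimately show False
      using inf finite_subset by blast
  qed
  then have "\<exists>m. (1 \<le> m \<and> p m \<notin> marked (V m)) \<and>
      (\<forall>i<m. \<not> (1 \<le> i \<and> p i \<notin> marked (V i)))"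
    by (subst (asm) exists_least_iff)
  then obtain m where m: "1 \<le> m" "p m \<notin> marked (V m)"
      and mlt: "\<And>i. 1 \<le> i \<Longrightarrow> i < m \<Longrightarrow> p i \<in> marked (V i)"
    by blast
  have "\<exists>e. e \<in> EY (V j) \<and> p j = ti TY (V j) e" if j: "j < m" for j
  proof (cases "j = 0")
    case True
    have "v \<in> IV TY" "x \<in> tS TY v" "2 \<le> ldeg v x"
      using crit by (auto simp: critical_point_def)
    then show ?thesis
      using critical_is_attaching v0 True by metis
  next
    case False
    then show ?thesis
      using marked_attach[OF VX mlt[of j]] j by (metis One_nat_def Suc_leI neq0_conv)
  qed
  then obtain e where e: "\<And>j. j < m \<Longrightarrow> e j \<in> EY (V j)" "\<And>j. j < m \<Longrightarrow> p j = ti TY (V j) (e j)"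
    by metis
  have pZ: "p (Suc j) = ti TZ (V (Suc j)) (F ` e j)" if "j < m" for j
    using pS f_ti[OF VY e(1)[OF that]] e(2)[OF that] VS by simp
  have eZ: "F ` e j \<in> EZ (V (Suc j))" if "j < m" for j
    using F_EZ[OF e(1)[OF that]] VS by simp
  \<comment> \<open>The alternative of \<open>branch_image\<close>: where \<open>P j\<close> fails,
    the whole branch in direction \<open>e j\<close> is mapped into the branch in the image
    direction.\<close>
  define P where "P j \<longleftrightarrow>
    (\<exists>y\<in>LV TY. y \<in> BY (V j) (e j) \<and> F y \<in> BZ (F (V j)) (F ` e j) \<and> 2 \<le> ndeg y)" for j
  have P0: "P 0"
  proof -
    have "2 \<le> ldeg (V 0) (ti TY (V 0) (e 0))"
      using crit e(2)[of 0] m v0 by (auto simp: critical_point_def)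
    then show ?thesis
      unfolding P_def using critical_leaf_in_branch[OF VY e(1)] m by simp
  qed
  define s where "s = Max {j. j < m \<and> P j}"
  have "0 \<in> {j. j < m \<and> P j}"
    using P0 m(1) by simp
  then have fin: "finite {j. j < m \<and> P j}" "{j. j < m \<and> P j} \<noteq> {}"
    by auto
  have s: "s < m" "P s"
    using Max_in[OF fin] by (auto simp: s_def)
  have smax: "\<not> P i" if "s < i" "i < m" for i
  proof
    assume "P i"
    then have "i \<le> s"
      unfolding s_def using that fin(1) by (intro Max_ge) auto
    then show False
      using that(1) by simp
  qed
  have noPrep: "u \<notin> BZ (V (Suc s)) (F ` e s)" if u: "u \<in> Prep TX F" for u
  proof
    assume uB: "u \<in> BZ (V (Suc s)) (F ` e s)"
    have uX: "(F ^^ d) u \<in> IV TX" for d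
      using u by (simp add: Prep_iff)
    have dir: "amap TZ (V (Suc i)) z = p (Suc i)" if "i < m" "z \<in> BZ (V (Suc i)) (F ` e i)" for i z
      using Z.amap_eq[OF refl eZ[OF that(1)] that(2)] pZ[OF that(1)] by simp
    have step: "(F ^^ d) u \<in> BZ (V (Suc (s + d))) (F ` e (s + d))" if "s + d < m" for d
      using that
    proof (induction d)
      case 0
      then show ?case using uB by simp
    next
      case (Suc d)
      define i where "i = Suc (s + d)"
      define z where "z = (F ^^ d) u"
      have i: "i < m" "s < i"
        using Suc.prems by (auto simp: i_def)
      have zB: "z \<in> BZ (V i) (F ` e (s + d))"
        using Suc by (simp add: i_def z_def)
      have zX: "z \<in> IV TX" "z \<noteq> V i"
        using uX zB Z.branch_notin by (auto simp: z_def)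
      \<comment> \<open>As an internal vertex of \<open>TX\<close>, \<open>z\<close> has the same
        direction at \<open>V i\<close> in \<open>TY\<close> as in \<open>TZ\<close>. In
        \<open>TZ\<close> it is \<open>p i\<close>, the attaching point of \<open>e i\<close> in
        \<open>TY\<close>.\<close>
      have zp: "amap TY (V i) z = ti TY (V i) (e i)"
        using amap_internal(1)[OF zX(1) VX zX(2)] dir[of "s + d" z] zB Suc.prems e(2)[OF i(1)]
        by (simp add: i_def)
      obtain d' where d': "d' \<in> EY (V i)" "z \<in> BY (V i) d'" "amap TY (V i) z = ti TY (V i) d'"
        using Y.amap_branch[OF refl IV_V(1)[OF VY] IV_V(1)[OF IVX_IVY[OF zX(1)]] zX(2)] by metis
      have "d' = e i"
        using inj_onD[OF ti_inj[OF VY]] d' zp e(1)[OF i(1)] by metis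
      then have "F z \<in> BZ (F (V i)) (F ` e i)"
        using branch_image[OF VY e(1)[OF i(1)]] smax[OF i(2,1)] d'(2) unfolding P_def by blast
      then show ?case
        using VS by (simp add: i_def z_def)
    qed
    \<comment> \<open>After \<open>d\<close> steps the image of \<open>u\<close> lies in the branch
      of \<open>TZ\<close> at \<open>V m\<close> in direction \<open>p m\<close>. That direction is
      unmarked, but an internal vertex of \<open>TX\<close> lies in a marked one.\<close>
    define d where "d = m - Suc s"
    have d: "s + d < m" "Suc (s + d) = m"
      using s(1) by (auto simp: d_def)
    have "(F ^^ d) u \<noteq> V m"
      using step[OF d(1)] d(2) Z.branch_notin by metis
    then have "amap TZ (V m) ((F ^^ d) u) \<in> marked (V m)"
      using amap_internal(2)[OF uX VX] by blast
    then show False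
      using dir[OF d(1) step[OF d(1)]] d(2) m(2) by simp
  qed
  obtain y where y: "y \<in> LV TY" "F y \<in> BZ (F (V s)) (F ` e s)" "2 \<le> ndeg y"
    using s(2) unfolding P_def by blast
  have "F y \<in> BZ (V (Suc s)) (F ` e s)"
    using y(2) VS by simp
  moreover have "Prep TX F \<inter> BZ (V (Suc s)) (F ` e s) = {}"
    using noPrep by blast
  ultimately show ?thesis
    using y VC eZ[OF s(1)] by blast
qed

lemma card_not_pcf_cycles:
  "int (card {C \<in> sphere_cycles TX F. not_pcf TX TY TZ F f C}) \<le> 2 * int (cover_degree TY TZ F f) - 2"
proof -
  let ?N = "{C \<in> sphere_cycles TX F. not_pcf TX TY TZ F f C}"
  let ?L = "{y \<in> LV TY. 2 \<le> ndeg y}"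
  define Q where "Q C y \<longleftrightarrow> y \<in> ?L \<and> (\<exists>w\<in>C. \<exists>e\<in>EZ w. F y \<in> BZ w e \<and> Prep TX F \<inter> BZ w e = {})" for C y
  have "\<forall>C\<in>?N. \<exists>y. Q C y"
    using cycle_critical_leaf unfolding Q_def by blast
  then obtain g where g: "\<And>C. C \<in> ?N \<Longrightarrow> Q C (g C)"
    by metis
  have "inj_on g ?N"
  proof (rule inj_onI)
    fix C C' assume C: "C \<in> ?N" "C' \<in> ?N" "g C = g C'"
    obtain w e where w: "w \<in> C" "e \<in> EZ w" "F (g C) \<in> BZ w e" "Prep TX F \<inter> BZ w e = {}"
      using g[OF C(1)] unfolding Q_def by blast
    obtain w' e' where w': "w' \<in> C'" "e' \<in> EZ w'" "F (g C) \<in> BZ w' e'" "Prep TX F \<inter> BZ w' e' = {}"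
      using g[OF C(2)] C(3) unfolding Q_def by metis
    have o: "C = {(F ^^ j) w | j. True}" "w \<in> Prep TX F"
      using sphere_cycle_orbit[of C TX F w] C(1) w(1) by auto
    have o': "C' = {(F ^^ j) w' | j. True}" "w' \<in> Prep TX F"
      using sphere_cycle_orbit[of C' TX F w'] C(2) w'(1) by auto
    have "w = w'"
    proof (rule ccontr)
      assume "w \<noteq> w'"
      moreover have "w' \<notin> BZ w e" "w \<notin> BZ w' e'"
        using o(2) o'(2) w(4) w'(4) by blast+
      ultimately show False
        using Z.distinct_branches_disjoint[OF _ w(2) w'(2)] w(3) w'(3) by blast
    qed
    then show "C = C'"
      using o(1) o'(1) by simp
  qed
  moreover have "g ` ?N \<subseteq> ?L"
    using g unfolding Q_def by blast
  ultimately have "card ?N \<le> card ?L"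
    using finLV(1) by (intro card_inj_on_le) auto
  then show ?thesis
    using card_critical_leaves by linarith
qed

end

theorem theorem1:
  fixes TX TY TZ :: "('v, 'a::topological_space) tos"
    and F :: "'v \<Rightarrow> 'v" and f :: "'v \<Rightarrow> 'a \<Rightarrow> 'a"
  assumes "dyn_sys TX TY TZ F f"
  shows "int (card {C \<in> sphere_cycles TX F. not_pcf TX TY TZ F f C})
           \<le> 2 * int (cover_degree TY TZ F f) - 2"
proof -
  interpret spheres_dynamics TX TY TZ F f
    using assms by unfold_locales
  show ?thesis
    by (rule card_not_pcf_cycles)
qed

end
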